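(* Let $\pi$ be a strongly cuspidal representation of $\mathrm{GL}_4(\mathfrak{o}_2)$. Then $\pi_{N,\psi}$ is a multiplicity free representation of $\mathrm{GL}_2(\mathfrak{o}_2)$, i.e. for any irreducible representation $\sigma$ of $\mathrm{GL}_2(\mathfrak{o}_2)$ we have $$\dim\left(\mathrm{Hom}_{\mathrm{GL}_2(\mathfrak{o}_2)}(\pi_{N,\psi},\sigma)\right)\leq 1.$$
   Context: Let $p$ be an odd prime and let $F$ be a finite unramified extension of $\mathbb{Q}_p$ or $\mathbb{F}_p((t))$, with ring of integers $\mathfrak{o}$, uniformizer $\varpi$ and residue field $\mathfrak{o}/(\varpi)\cong\mathbb{F}_q$. Put $\mathfrak{o}_2=\mathfrak{o}/(\varpi^2)$. Representations are finite dimensional and complex. Fix an additive character $\psi_0:\mathfrak{o}_2\to\mathbb{C}^\times$ whose restriction to $\varpi\mathfrak{o}_2$ is non-trivial. Let $N=\left\{\begin{pmatrix} I & X\\0&I\end{pmatrix}:X\in M_2(\mathfrak{o}_2)\right\}\subset\mathrm{GL}_4(\mathfrak{o}_2)$ and $\psi\begin{pmatrix} I & X\\0&I\end{pmatrix}=\psi_0(\mathrm{tr}(X))$. For a representation $(\pi,V)$ of $\mathrm{GL}_4(\mathfrak{o}_2)$, $\pi_{N,\psi}$ denotes the space $\{v\in V:\pi(n)v=\psi(n)v\ \forall n\in N\}$ regarded as a representation of $\mathrm{GL}_2(\mathfrak{o}_2)$ via $g\mapsto\begin{pmatrix} g&0\\0&g\end{pmatrix}$. Let $K^1_2=I+\varpi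 M_4(\mathfrak{o}_2)\cong M_4(\mathbb{F}_q)$. For $x\in M_4(\mathbb{F}_q)$ with lift $\tilde x\in M_4(\mathfrak{o}_2)$, let $\phi_x(I+\varpi A)=\psi_0(\varpi\,\mathrm{tr}(\tilde xA))$, a character of $K^1_2$. An irreducible representation of $\mathrm{GL}_4(\mathfrak{o}_2)$ is called strongly cuspidal if its restriction to $K^1_2$ contains $\phi_x$ for some $x\in M_4(\mathbb{F}_q)$ whose characteristic polynomial is irreducible over $\mathbb{F}_q$. *)

theory Defs
  imports
    "Jordan_Normal_Form.Char_Poly"
    "Berlekamp_Zassenhaus.Finite_Field"
    "HOL-Computational_Algebra.Formal_Laurent_Series"
    "HOL-Computational_Algebra.Fraction_Field"
    "HOL-Library.Function_Algebras"
begin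

section \<open>Discretely valued fields\<close>

text \<open>
  \<open>dval\<close> is a normalized discrete valuation. Its value at \<open>0\<close> carries no information; it is set
  to \<open>0\<close>, the convention of \<^const>\<open>fls_subdegree\<close>.
\<close>

class valued_idom = idom +
  fixes dval :: "'a \<Rightarrow> int"
  assumes dval_0 [simp]: "dval 0 = 0"
    and dval_mult: "x \<noteq> 0 \<Longrightarrow> y \<noteq> 0 \<Longrightarrow> dval (x * y) = dval x + dval y"
    and dval_add: "x \<noteq> 0 \<Longrightarrow> y \<noteq> 0 \<Longrightarrow> x + y \<noteq> 0 \<Longrightarrow> min (dval x) (dval y) \<le> dval (x + y)"
    and dval_normalized: "\<exists>x. dval x = 1"

class disc_valued_field = field + valued_idom

lemma dval_1 [simp]: "dval (1 :: 'a::valued_idom) = 0"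
  using dval_mult[of "1::'a" 1] by simp

lemma dval_uminus [simp]: "dval (- x) = dval (x :: 'a::valued_idom)"
proof -
  have "dval (-1 :: 'a) = 0"
    using dval_mult[of "-1::'a" "-1"] by simp
  then show ?thesis
    using dval_mult[of "-1::'a" x] by (cases "x = 0") auto
qed

lemma dval_diff:
  "(x :: 'a::valued_idom) \<noteq> 0 \<Longrightarrow> y \<noteq> 0 \<Longrightarrow> x - y \<noteq> 0 \<Longrightarrow> min (dval x) (dval y) \<le> dval (x - y)"
  using dval_add[of x "- y"] by simp

instantiation fls :: (field) disc_valued_field
begin

definition dval_fls :: "'a fls \<Rightarrow> int" where "dval_fls = fls_subdegree"

instance
proof
  show "\<exists>x :: 'a fls. dval x = 1"
    by (rule exI[of _ fls_X]) (simp add: dval_fls_def)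
qed (auto simp: dval_fls_def intro: fls_plus_subdegree)

end

text \<open>A valuation on a domain extends to its field of fractions by \<open>dval (a/b) = dval a - dval b\<close>.\<close>

instantiation fract :: (valued_idom) disc_valued_field
begin

definition dval_fract :: "'a fract \<Rightarrow> int" where
  "dval_fract q = (if q = 0 then 0 else
     (THE k. \<exists>a b. a \<noteq> 0 \<and> b \<noteq> 0 \<and> q = Fract a b \<and> k = dval a - dval b))"

lemma dval_Fract:
  assumes "a \<noteq> 0" "b \<noteq> 0"
  shows "dval (Fract a b) = dval a - dval b"
proof -
  have "Fract a b \<noteq> 0"
    using assms by (simp add: fract_expand eq_fract)
  moreover have "(THE k. \<exists>c d. c \<noteq> 0 \<and> d \<noteq> 0 \<and> Fract a b = Fract c d \<and> k = dval c - dval d)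
      = dval a - dval b"
  proof (rule the_equality)
    show "\<exists>c d. c \<noteq> 0 \<and> d \<noteq> 0 \<and> Fract a b = Fract c d \<and> dval a - dval b = dval c - dval d"
      using assms by blast
  next
    fix k
    assume "\<exists>c d. c \<noteq> 0 \<and> d \<noteq> 0 \<and> Fract a b = Fract c d \<and> k = dval c - dval d"
    then obtain c d where *: "c \<noteq> 0" "d \<noteq> 0" "Fract a b = Fract c d" "k = dval c - dval d"
      by blast
    then have "a * d = c * b"
      using assms by (simp add: eq_fract)
    then have "dval a + dval d = dval c + dval b"
      using assms * by (metis dval_mult)
    then show "k = dval a - dval b"
      using * by simp
  qed
  ultimately show ?thesis
    by (simp add: dval_fract_def)
qed

instance
proof
  show "dval (0 :: 'a fract) = 0"
    by (simp add: dval_fract_def)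
next
  fix x y :: "'a fract"
  assume "x \<noteq> 0" "y \<noteq> 0"
  then show "dval (x * y) = dval x + dval y"
    by (cases x rule: Fract_cases_nonzero; cases y rule: Fract_cases_nonzero)
      (auto simp: dval_Fract dval_mult)
next
  fix x y :: "'a fract"
  assume nz: "x \<noteq> 0" "y \<noteq> 0" "x + y \<noteq> 0"
  obtain a b where x: "x = Fract a b" "a \<noteq> 0" "b \<noteq> 0"
    using nz(1) by (cases x rule: Fract_cases_nonzero) auto
  obtain c d where y: "y = Fract c d" "c \<noteq> 0" "d \<noteq> 0"
    using nz(2) by (cases y rule: Fract_cases_nonzero) auto
  have s: "x + y = Fract (a * d + c * b) (b * d)"
    using x y by simp
  then have n: "a * d + c * b \<noteq> 0"
    using nz(3) by (auto simp: fract_collapse)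
  have "min (dval a + dval d) (dval c + dval b) \<le> dval (a * d + c * b)"
    using dval_add[of "a * d" "c * b"] n x y by (simp add: dval_mult)
  then show "min (dval x) (dval y) \<le> dval (x + y)"
    using x y n unfolding s by (simp add: dval_Fract dval_mult)
next
  obtain a :: 'a where a: "dval a = 1"
    using dval_normalized by blast
  then have "a \<noteq> 0" by auto
  with a have "dval (Fract a 1) = 1"
    by (simp add: dval_Fract)
  then show "\<exists>x :: 'a fract. dval x = 1" ..
qed

end


section \<open>The p-adic numbers\<close>

text \<open>
  \<open>'p padic_int\<close> is the inverse limit of the rings \<open>\<int>/p\<^sup>n\<close> with \<open>p = CARD('p)\<close>; the residue class
  modulo \<open>p\<^sup>n\<close> is represented by its element in \<open>{0..<p\<^sup>n}\<close>.
\<close>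

typedef ('p::prime_card) padic_int =
  "{a :: nat \<Rightarrow> int. \<forall>n. a n \<in> {0..<int CARD('p) ^ n} \<and> a (Suc n) mod int CARD('p) ^ n = a n}"
  using prime_card_int[where 'a = 'p] by (intro exI[of _ "\<lambda>_. 0"]) (auto simp: prime_gt_0_int)

setup_lifting type_definition_padic_int

lemma CARD_pos: "0 < int CARD('p::prime_card)"
  using prime_card_int[where 'a = 'p] by (rule prime_gt_0_int)

instantiation padic_int :: (prime_card) comm_ring_1
begin

lift_definition zero_padic_int :: "'a padic_int" is "\<lambda>n. 0"
  using CARD_pos[where 'p = 'a] by auto

lift_definition one_padic_int :: "'a padic_int" is "\<lambda>n. 1 mod int CARD('a) ^ n"
  using CARD_pos[where 'p = 'a] by (auto simp: mod_mod_cancel)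

lift_definition plus_padic_int :: "'a padic_int \<Rightarrow> 'a padic_int \<Rightarrow> 'a padic_int"
  is "\<lambda>a b n. (a n + b n) mod int CARD('a) ^ n"
proof -
  fix a b :: "nat \<Rightarrow> int" and n
  let ?p = "int CARD('a)"
  assume a: "\<And>n. a n \<in> {0..<?p ^ n} \<and> a (Suc n) mod ?p ^ n = a n"
    and b: "\<And>n. b n \<in> {0..<?p ^ n} \<and> b (Suc n) mod ?p ^ n = b n"
  have "(a (Suc n) + b (Suc n)) mod ?p ^ Suc n mod ?p ^ n = (a (Suc n) + b (Suc n)) mod ?p ^ n"
    by (simp add: mod_mod_cancel)
  also have "\<dots> = (a (Suc n) mod ?p ^ n + b (Suc n) mod ?p ^ n) mod ?p ^ n"
    by (simp only: mod_add_eq)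
  finally show "(a n + b n) mod ?p ^ n \<in> {0..<?p ^ n} \<and>
      (a (Suc n) + b (Suc n)) mod ?p ^ Suc n mod ?p ^ n = (a n + b n) mod ?p ^ n"
    using a b CARD_pos[where 'p = 'a] by simp
qed

lift_definition uminus_padic_int :: "'a padic_int \<Rightarrow> 'a padic_int"
  is "\<lambda>a n. (- a n) mod int CARD('a) ^ n"
proof -
  fix a :: "nat \<Rightarrow> int" and n
  let ?p = "int CARD('a)"
  assume a: "\<And>n. a n \<in> {0..<?p ^ n} \<and> a (Suc n) mod ?p ^ n = a n"
  have "(- a (Suc n)) mod ?p ^ Suc n mod ?p ^ n = (- a (Suc n)) mod ?p ^ n"
    by (simp add: mod_mod_cancel)
  also have "\<dots> = (- (a (Suc n) mod ?p ^ n)) mod ?p ^ n"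
    by (simp only: mod_minus_eq)
  finally show "(- a n) mod ?p ^ n \<in> {0..<?p ^ n} \<and>
      (- a (Suc n)) mod ?p ^ Suc n mod ?p ^ n = (- a n) mod ?p ^ n"
    using a CARD_pos[where 'p = 'a] by simp
qed

definition minus_padic_int :: "'a padic_int \<Rightarrow> 'a padic_int \<Rightarrow> 'a padic_int"
  where "minus_padic_int a b = a + - b"

lift_definition times_padic_int :: "'a padic_int \<Rightarrow> 'a padic_int \<Rightarrow> 'a padic_int"
  is "\<lambda>a b n. (a n * b n) mod int CARD('a) ^ n"
proof -
  fix a b :: "nat \<Rightarrow> int" and n
  let ?p = "int CARD('a)"
  assume a: "\<And>n. a n \<in> {0..<?p ^ n} \<and> a (Suc n) mod ?p ^ n = a n"
    and b: "\<And>n. b n \<in> {0..<?p ^ n} \<and> b (Suc n) mod ?p ^ n = b n"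
  have "(a (Suc n) * b (Suc n)) mod ?p ^ Suc n mod ?p ^ n = (a (Suc n) * b (Suc n)) mod ?p ^ n"
    by (simp add: mod_mod_cancel)
  also have "\<dots> = ((a (Suc n) mod ?p ^ n) * (b (Suc n) mod ?p ^ n)) mod ?p ^ n"
    by (simp only: mod_mult_eq)
  finally show "(a n * b n) mod ?p ^ n \<in> {0..<?p ^ n} \<and>
      (a (Suc n) * b (Suc n)) mod ?p ^ Suc n mod ?p ^ n = (a n * b n) mod ?p ^ n"
    using a b CARD_pos[where 'p = 'a] by simp
qed

instance
proof
  fix a b c :: "'a padic_int"
  show "a * b * c = a * (b * c)"
    by transfer (auto simp: fun_eq_iff mod_mult_left_eq mod_mult_right_eq mult.assoc)
  show "a * b = b * a"
    by transfer (auto simp: fun_eq_iff mult.commute)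
  show "1 * a = a"
    by transfer (auto simp: fun_eq_iff mod_mult_left_eq)
  show "a + b + c = a + (b + c)"
    by transfer (auto simp: fun_eq_iff mod_add_left_eq mod_add_right_eq add.assoc)
  show "a + b = b + a"
    by transfer (auto simp: fun_eq_iff add.commute)
  show "0 + a = a"
    by transfer (auto simp: fun_eq_iff)
  show "- a + a = 0"
    by transfer (auto simp: fun_eq_iff mod_add_left_eq)
  show "a - b = a + - b"
    by (rule minus_padic_int_def)
  show "(a + b) * c = a * c + b * c"
    by transfer (auto simp: fun_eq_iff mod_mult_left_eq mod_add_eq distrib_right)
  show "(0 :: 'a padic_int) \<noteq> 1"
  proof
    assume "(0 :: 'a padic_int) = 1"
    then have "(\<lambda>n. 0 :: int) = (\<lambda>n. 1 mod int CARD('a) ^ n)"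
      by transfer
    then have "(0::int) = 1 mod int CARD('a) ^ 1"
      by metis
    then show False
      using prime_card_int[where 'a = 'a] by (simp add: prime_gt_1_int)
  qed
qed

end

lemma padic_coherent:
  assumes "k \<le> n"
  shows "Rep_padic_int (a :: 'p::prime_card padic_int) n mod int CARD('p) ^ k = Rep_padic_int a k"
  using assms
proof (induction rule: dec_induct)
  case base
  then show ?case using Rep_padic_int[of a] by auto
next
  case (step n)
  have "Rep_padic_int a (Suc n) mod int CARD('p) ^ k =
      Rep_padic_int a (Suc n) mod int CARD('p) ^ n mod int CARD('p) ^ k"
    using step by (simp add: mod_mod_cancel le_imp_power_dvd)
  then show ?case
    using step Rep_padic_int[of a] by auto
qed

lemma padic_dvd_iff:
  assumes "k \<le> n"
  shows "int CARD('p) ^ k dvd Rep_padic_int (a :: 'p::prime_card padic_int) n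
    \<longleftrightarrow> Rep_padic_int a k = 0"
  using padic_coherent[OF assms, of a] by (simp add: dvd_eq_mod_eq_0)

definition padic_ord :: "'p::prime_card padic_int \<Rightarrow> nat" where
  "padic_ord a = (LEAST k. Rep_padic_int a (Suc k) \<noteq> 0)"

lemma padic_eq_0_iff: "a = 0 \<longleftrightarrow> (\<forall>n. Rep_padic_int (a :: 'p::prime_card padic_int) n = 0)"
  by transfer auto

lemma padic_Rep_0: "Rep_padic_int (a :: 'p::prime_card padic_int) 0 = 0"
proof -
  have "Rep_padic_int a 0 \<in> {0..<int CARD('p) ^ 0}"
    using Rep_padic_int[of a] by blast
  then show ?thesis by simp
qed

lemma padic_zero_iff_le_ord:
  assumes "(a :: 'p::prime_card padic_int) \<noteq> 0"
  shows "Rep_padic_int a k = 0 \<longleftrightarrow> k \<le> padic_ord a"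
proof -
  obtain m where "Rep_padic_int a m \<noteq> 0"
    using assms padic_eq_0_iff by blast
  moreover from this have "m \<noteq> 0"
    using padic_Rep_0[of a] by metis
  ultimately have "\<exists>k. Rep_padic_int a (Suc k) \<noteq> 0"
    by (metis not0_implies_Suc)
  then have nz: "Rep_padic_int a (Suc (padic_ord a)) \<noteq> 0"
    unfolding padic_ord_def by (rule LeastI_ex)
  have "Rep_padic_int a k = 0" if "k \<le> padic_ord a"
  proof (cases k)
    case 0
    then show ?thesis by (simp add: padic_Rep_0)
  next
    case (Suc j)
    then have "j < (LEAST k. Rep_padic_int a (Suc k) \<noteq> 0)"
      using that unfolding padic_ord_def by simp
    from not_less_Least[OF this] show ?thesis using Suc by simp
  qed
  moreover have "Rep_padic_int a k \<noteq> 0" if "\<not> k \<le> padic_ord a"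
  proof
    assume "Rep_padic_int a k = 0"
    moreover have "Rep_padic_int a k mod int CARD('p) ^ Suc (padic_ord a)
        = Rep_padic_int a (Suc (padic_ord a))"
      using that by (intro padic_coherent) simp
    ultimately show False using nz by simp
  qed
  ultimately show ?thesis by blast
qed

lemma padic_ordI:
  assumes "Rep_padic_int (a :: 'p::prime_card padic_int) k = 0" "Rep_padic_int a (Suc k) \<noteq> 0"
  shows "a \<noteq> 0" "padic_ord a = k"
proof -
  show "a \<noteq> 0" using assms(2) padic_eq_0_iff by blast
  then show "padic_ord a = k"
    using assms padic_zero_iff_le_ord[of a k] padic_zero_iff_le_ord[of a "Suc k"] by simp
qed

lemma padic_ord_times:
  assumes "(a :: 'p::prime_card padic_int) \<noteq> 0" "b \<noteq> 0"
  shows "a * b \<noteq> 0" "padic_ord (a * b) = padic_ord a + padic_ord b"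
proof -
  let ?p = "int CARD('p)" and ?v = "padic_ord a" and ?w = "padic_ord b"
  let ?N = "Suc (?v + ?w)"
  have d: "?p ^ ?v dvd Rep_padic_int a n" "?p ^ ?w dvd Rep_padic_int b m"
    if "?v \<le> n" "?w \<le> m" for n m
    using that assms by (simp_all add: padic_dvd_iff padic_zero_iff_le_ord)
  obtain u where u: "Rep_padic_int a ?N = ?p ^ ?v * u"
    using d(1)[of ?N ?w] by (auto elim: dvdE)
  obtain t where t: "Rep_padic_int b ?N = ?p ^ ?w * t"
    using d(2)[of ?v ?N] by (auto elim: dvdE)
  have "\<not> ?p ^ Suc ?v dvd Rep_padic_int a ?N" "\<not> ?p ^ Suc ?w dvd Rep_padic_int b ?N"
    using assms by (simp_all only: padic_dvd_iff padic_zero_iff_le_ord) (simp_all add: padic_dvd_iff padic_zero_iff_le_ord del: power_Suc)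
  then have "\<not> ?p dvd u" "\<not> ?p dvd t"
    using CARD_pos[where 'p = 'p] unfolding u t by auto
  then have ndvd: "\<not> ?p dvd u * t"
    using prime_card_int[where 'a = 'p] by (simp add: prime_dvd_mult_iff)
  have "\<not> ?p ^ ?N dvd Rep_padic_int a ?N * Rep_padic_int b ?N"
  proof
    assume "?p ^ ?N dvd Rep_padic_int a ?N * Rep_padic_int b ?N"
    then have "?p ^ (?v + ?w) * ?p dvd ?p ^ (?v + ?w) * (u * t)"
      unfolding u t by (simp add: power_add mult_ac)
    then show False
      using ndvd CARD_pos[where 'p = 'p] by auto
  qed
  then have 1: "Rep_padic_int (a * b) ?N \<noteq> 0"
    by (simp add: times_padic_int.rep_eq dvd_eq_mod_eq_0 del: power_Suc)
  have "?p ^ (?v + ?w) dvd Rep_padic_int a (?v + ?w) * Rep_padic_int b (?v + ?w)"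
    unfolding power_add by (intro mult_dvd_mono d) auto
  then have 2: "Rep_padic_int (a * b) (?v + ?w) = 0"
    by (simp add: times_padic_int.rep_eq)
  show "a * b \<noteq> 0" "padic_ord (a * b) = ?v + ?w"
    using padic_ordI[OF 2 1] by auto
qed

instantiation padic_int :: (prime_card) valued_idom
begin

definition dval_padic_int :: "'a padic_int \<Rightarrow> int" where
  "dval_padic_int a = (if a = 0 then 0 else int (padic_ord a))"

instance
proof
  fix a b :: "'a padic_int"
  show "dval (0 :: 'a padic_int) = 0"
    by (simp add: dval_padic_int_def)
  show "a \<noteq> 0 \<Longrightarrow> b \<noteq> 0 \<Longrightarrow> a * b \<noteq> 0"
    by (rule padic_ord_times)
  show "a \<noteq> 0 \<Longrightarrow> b \<noteq> 0 \<Longrightarrow> dval (a * b) = dval a + dval b"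
    by (simp add: dval_padic_int_def padic_ord_times)
  show "min (dval a) (dval b) \<le> dval (a + b)" if nz: "a \<noteq> 0" "b \<noteq> 0" "a + b \<noteq> 0"
  proof -
    let ?m = "min (padic_ord a) (padic_ord b)"
    have "Rep_padic_int a ?m = 0" "Rep_padic_int b ?m = 0"
      using nz by (simp_all add: padic_zero_iff_le_ord)
    then have "Rep_padic_int (a + b) ?m = 0"
      by (simp add: plus_padic_int.rep_eq)
    then have "?m \<le> padic_ord (a + b)"
      using nz by (simp add: padic_zero_iff_le_ord)
    then show ?thesis
      using nz by (simp add: dval_padic_int_def min_def split: if_splits)
  qed
  let ?p = "int CARD('a)"
  have p: "?p > 1"
    using prime_card_int[where 'a = 'a] by (rule prime_gt_1_int)
  let ?x = "Abs_padic_int (\<lambda>n. ?p mod ?p ^ n) :: 'a padic_int"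
  have r: "Rep_padic_int ?x = (\<lambda>n. ?p mod ?p ^ n)"
    using p by (subst Abs_padic_int_inverse) (auto simp: mod_mod_cancel le_imp_power_dvd simp del: power_Suc)
  have "Rep_padic_int ?x 1 = 0" "Rep_padic_int ?x (Suc 1) \<noteq> 0"
    using p unfolding r by (auto simp: zmod_trivial_iff)
  from padic_ordI[OF this] show "\<exists>x :: 'a padic_int. dval x = 1"
    by (intro exI[of _ ?x]) (simp add: dval_padic_int_def)
qed

end

type_synonym 'p padic = "'p padic_int fract"

text \<open>
  \<open>\<iota>\<close> exhibits \<open>'f\<close> as a finite extension of \<open>'k\<close> of ramification index \<open>1\<close>: the normalized
  valuation of \<open>'f\<close> extends that of \<open>'k\<close>. Separability of the residue field extension is not
  required, being automatic over the perfect residue field of \<open>\<rat>\<^sub>p\<close> or \<open>\<bbbF>\<^sub>p((t))\<close>.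
\<close>

definition finite_unramified :: "('k::disc_valued_field \<Rightarrow> 'f::disc_valued_field) \<Rightarrow> bool" where
  "finite_unramified \<iota> \<longleftrightarrow>
     field_hom \<iota> \<and>
     (\<exists>B. finite B \<and> module.span (\<lambda>c x. \<iota> c * x) B = UNIV) \<and>
     (\<forall>x. dval (\<iota> x) = dval x)"


section \<open>The ring of integers and its quotients\<close>

typedef (overloaded) ('f::disc_valued_field) oring = "{x :: 'f. 0 \<le> dval x}"
  by (rule exI[of _ 0]) simp

setup_lifting type_definition_oring

lemma dval_add_nonneg: "0 \<le> dval x \<Longrightarrow> 0 \<le> dval y \<Longrightarrow> 0 \<le> dval (x + y :: 'a::valued_idom)"
  using dval_add[of x y] by (cases "x = 0"; cases "y = 0"; cases "x + y = 0") auto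

lemma dval_mult_nonneg: "0 \<le> dval x \<Longrightarrow> 0 \<le> dval y \<Longrightarrow> 0 \<le> dval (x * y :: 'a::valued_idom)"
  using dval_mult[of x y] by (cases "x = 0"; cases "y = 0") auto

instantiation oring :: (disc_valued_field) idom
begin

lift_definition zero_oring :: "'a oring" is 0 by simp
lift_definition one_oring :: "'a oring" is 1 by simp
lift_definition plus_oring :: "'a oring \<Rightarrow> 'a oring \<Rightarrow> 'a oring" is "(+)"
  by (rule dval_add_nonneg)
lift_definition uminus_oring :: "'a oring \<Rightarrow> 'a oring" is uminus by simp
lift_definition minus_oring :: "'a oring \<Rightarrow> 'a oring \<Rightarrow> 'a oring" is "(-)"
  using dval_add_nonneg[of _ "- _"] by fastforce
lift_definition times_oring :: "'a oring \<Rightarrow> 'a oring \<Rightarrow> 'a oring" is "(*)"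
  by (rule dval_mult_nonneg)

instance
  by standard (transfer; simp add: algebra_simps)+

end

definition uniformizer :: "'f::disc_valued_field oring \<Rightarrow> bool" where
  "uniformizer w \<longleftrightarrow> dval (Rep_oring w) = 1"

text \<open>Congruence modulo the ideal generated by the \<open>n\<close>-th power of a uniformizer.\<close>

definition ocong :: "nat \<Rightarrow> 'f::disc_valued_field oring \<Rightarrow> 'f oring \<Rightarrow> bool" where
  "ocong n x y \<longleftrightarrow> (\<exists>w. uniformizer w \<and> w ^ n dvd x - y)"

lemma uniformizer_nonzero: "uniformizer w \<Longrightarrow> w \<noteq> 0"
  by (auto simp: uniformizer_def zero_oring.rep_eq)

lemma ex_uniformizer: "\<exists>w :: 'f::disc_valued_field oring. uniformizer w"
proof -
  obtain x :: 'f where "dval x = 1" using dval_normalized by blast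
  then show ?thesis
    by (intro exI[of _ "Abs_oring x"]) (simp add: uniformizer_def Abs_oring_inverse)
qed

lemma dval_oring_power: "uniformizer w \<Longrightarrow> dval (Rep_oring (w ^ n)) = int n"
proof (induction n)
  case 0
  then show ?case by (simp add: one_oring.rep_eq)
next
  case (Suc n)
  have "w ^ n \<noteq> 0" "w \<noteq> 0" using Suc.prems uniformizer_nonzero by auto
  then have "Rep_oring (w ^ n) \<noteq> 0" "Rep_oring w \<noteq> 0"
    by (metis Rep_oring_inject zero_oring.rep_eq)+
  then show ?case
    using Suc by (simp add: times_oring.rep_eq dval_mult uniformizer_def)
qed

lemma oring_dvd_iff:
  assumes "x \<noteq> 0"
  shows "x dvd y \<longleftrightarrow> y = 0 \<or> dval (Rep_oring x) \<le> dval (Rep_oring y)"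
proof (cases "y = 0")
  case False
  have nz: "Rep_oring x \<noteq> 0" "Rep_oring y \<noteq> 0"
    using assms False by (metis Rep_oring_inject zero_oring.rep_eq)+
  show ?thesis
  proof
    assume "x dvd y"
    then obtain z where z: "y = x * z" by (elim dvdE)
    then have "z \<noteq> 0" using False by auto
    then have "Rep_oring z \<noteq> 0" by (metis Rep_oring_inject zero_oring.rep_eq)
    then show "y = 0 \<or> dval (Rep_oring x) \<le> dval (Rep_oring y)"
      using nz Rep_oring[of z] unfolding z by (simp add: times_oring.rep_eq dval_mult)
  next
    assume "y = 0 \<or> dval (Rep_oring x) \<le> dval (Rep_oring y)"
    then have le: "dval (Rep_oring x) \<le> dval (Rep_oring y)" using False by simp
    define q where "q = Rep_oring y / Rep_oring x"
    have q: "Rep_oring y = Rep_oring x * q" "q \<noteq> 0"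
      using nz by (simp_all add: q_def)
    have "dval (Rep_oring y) = dval (Rep_oring x) + dval q"
      using nz(1) q by (simp add: dval_mult)
    then have "0 \<le> dval q" using le by simp
    then have "y = x * Abs_oring q"
      using q(1) by (simp add: Rep_oring_inject[symmetric] times_oring.rep_eq Abs_oring_inverse)
    then show "x dvd y" by simp
  qed
qed simp

lemma ocong_iff_dvd:
  assumes "uniformizer w"
  shows "ocong n x y \<longleftrightarrow> w ^ n dvd x - y"
proof -
  have "w ^ n dvd z \<longleftrightarrow> u ^ n dvd z" if "uniformizer u" for u z
    using assms that by (simp add: oring_dvd_iff dval_oring_power uniformizer_nonzero)
  then show ?thesis
    using assms unfolding ocong_def by blast
qed

lemma equivp_ocong: "equivp (ocong n :: 'f::disc_valued_field oring \<Rightarrow> _)"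
proof -
  obtain w :: "'f oring" where w: "uniformizer w" using ex_uniformizer by blast
  show ?thesis
  proof (intro equivpI reflpI sympI transpI)
    fix x y z :: "'f oring"
    show "ocong n x x"
      by (simp add: ocong_iff_dvd[OF w])
    show "ocong n x y \<Longrightarrow> ocong n y x"
      using dvd_minus_iff[of "w ^ n" "x - y"] by (simp add: ocong_iff_dvd[OF w])
    show "ocong n x y \<Longrightarrow> ocong n y z \<Longrightarrow> ocong n x z"
      using dvd_add[of "w ^ n" "x - y" "y - z"] by (simp add: ocong_iff_dvd[OF w])
  qed
qed

lemma ocong_add: "ocong n x x' \<Longrightarrow> ocong n y y' \<Longrightarrow> ocong n (x + y) (x' + y')"
  for x :: "'f::disc_valued_field oring"
proof -
  obtain w :: "'f oring" where w: "uniformizer w" using ex_uniformizer by blast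
  assume "ocong n x x'" "ocong n y y'"
  moreover have "x + y - (x' + y') = (x - x') + (y - y')" by simp
  ultimately show ?thesis
    unfolding ocong_iff_dvd[OF w] by (metis dvd_add)
qed

lemma ocong_uminus: "ocong n x x' \<Longrightarrow> ocong n (- x) (- x')"
  for x :: "'f::disc_valued_field oring"
proof -
  obtain w :: "'f oring" where w: "uniformizer w" using ex_uniformizer by blast
  assume "ocong n x x'"
  moreover have "- x - - x' = - (x - x')" by simp
  ultimately show ?thesis
    unfolding ocong_iff_dvd[OF w] by (metis dvd_minus_iff)
qed

lemma ocong_diff: "ocong n x x' \<Longrightarrow> ocong n y y' \<Longrightarrow> ocong n (x - y) (x' - y')"
  for x :: "'f::disc_valued_field oring"
  using ocong_add[of n x x' "- y" "- y'"] ocong_uminus[of n y y'] by simp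

lemma ocong_mult: "ocong n x x' \<Longrightarrow> ocong n y y' \<Longrightarrow> ocong n (x * y) (x' * y')"
  for x :: "'f::disc_valued_field oring"
proof -
  obtain w :: "'f oring" where w: "uniformizer w" using ex_uniformizer by blast
  assume "ocong n x x'" "ocong n y y'"
  moreover have "x * y - x' * y' = (x - x') * y + x' * (y - y')" by (simp add: algebra_simps)
  ultimately show ?thesis
    unfolding ocong_iff_dvd[OF w] by (metis dvd_add dvd_mult dvd_mult2)
qed

lemma ocong_mono: "m \<le> n \<Longrightarrow> ocong n x y \<Longrightarrow> ocong m x y"
  unfolding ocong_def by (meson dvd_trans le_imp_power_dvd)

lemma not_ocong_0_1: "0 < n \<Longrightarrow> \<not> ocong n 0 (1 :: 'f::disc_valued_field oring)"
proof
  assume n: "0 < n" and c: "ocong n 0 (1 :: 'f oring)"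
  then obtain w :: "'f oring" where w: "uniformizer w" "w ^ n dvd 1"
    unfolding ocong_def by (metis diff_0 dvd_minus_iff)
  then show False
    using n by (simp add: oring_dvd_iff uniformizer_nonzero dval_oring_power one_oring.rep_eq)
qed

text \<open>\<open>'f o2\<close> is \<open>\<oo>/(\<varpi>\<^sup>2)\<close>, and \<open>'f resfield\<close> is \<open>\<oo>/(\<varpi>) \<cong> \<bbbF>\<^sub>q\<close>.\<close>

quotient_type (overloaded) 'f o2 = "'f::disc_valued_field oring" / "ocong 2"
  by (rule equivp_ocong)

quotient_type (overloaded) 'f resfield = "'f::disc_valued_field oring" / "ocong 1"
  by (rule equivp_ocong)

instantiation o2 :: (disc_valued_field) comm_ring_1
begin

lift_definition zero_o2 :: "'a o2" is 0 .
lift_definition one_o2 :: "'a o2" is 1 .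
lift_definition plus_o2 :: "'a o2 \<Rightarrow> 'a o2 \<Rightarrow> 'a o2" is "(+)" by (rule ocong_add)
lift_definition uminus_o2 :: "'a o2 \<Rightarrow> 'a o2" is uminus by (rule ocong_uminus)
lift_definition minus_o2 :: "'a o2 \<Rightarrow> 'a o2 \<Rightarrow> 'a o2" is "(-)" by (rule ocong_diff)
lift_definition times_o2 :: "'a o2 \<Rightarrow> 'a o2 \<Rightarrow> 'a o2" is "(*)" by (rule ocong_mult)

instance
proof
  show "(0 :: 'a o2) \<noteq> 1"
    by transfer (rule not_ocong_0_1, simp)
qed (transfer; simp add: algebra_simps equivp_reflp[OF equivp_ocong])+

end

lemma oring_unit: "\<not> ocong 1 x 0 \<Longrightarrow> \<exists>y. x * y = (1 :: 'f::disc_valued_field oring)"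
proof -
  obtain w :: "'f oring" where w: "uniformizer w" using ex_uniformizer by blast
  assume "\<not> ocong 1 x 0"
  then have x: "x \<noteq> 0" "dval (Rep_oring x) < 1"
    using w dval_oring_power[OF w, of 1]
    by (auto simp: ocong_iff_dvd[OF w] oring_dvd_iff uniformizer_nonzero)
  then have "dval (Rep_oring x) = 0" using Rep_oring[of x] by simp
  then have "x dvd 1"
    using x by (simp add: oring_dvd_iff one_oring.rep_eq)
  then show ?thesis by (metis dvdE)
qed

lemma oring_some_inverse:
  "\<not> ocong 1 x 0 \<Longrightarrow> x * (SOME y. x * y = 1) = (1 :: 'f::disc_valued_field oring)"
  by (rule someI_ex[of "\<lambda>y. x * y = 1", OF oring_unit])

lemma ocong_inverse_unique:
  fixes x :: "'f::disc_valued_field oring"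
  assumes "ocong n x x'" "ocong n (x * y) 1" "ocong n (x' * y') 1"
  shows "ocong n y y'"
proof -
  note refl = equivp_reflp[OF equivp_ocong] and trans = equivp_transp[OF equivp_ocong]
    and sym = equivp_symp[OF equivp_ocong]
  have 1: "ocong n (1 * y) (x' * y' * y)"
    by (rule ocong_mult[OF sym[OF assms(3)] refl])
  have 2: "ocong n (x' * (y' * y)) (x * (y' * y))"
    by (rule ocong_mult[OF sym[OF assms(1)] refl])
  have 3: "ocong n (x * y * y') (1 * y')"
    by (rule ocong_mult[OF assms(2) refl])
  have "ocong n y (x' * (y' * y))"
    using 1 by (simp only: mult.assoc mult_1)
  moreover have "ocong n (x * (y' * y)) y'"
    using 3 by (simp only: mult.assoc mult.commute[of y' y] mult_1)
  ultimately show ?thesis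
    using trans[OF trans[OF _ 2]] by blast
qed

instantiation resfield :: (disc_valued_field) field
begin

lift_definition zero_resfield :: "'a resfield" is 0 .
lift_definition one_resfield :: "'a resfield" is 1 .
lift_definition plus_resfield :: "'a resfield \<Rightarrow> 'a resfield \<Rightarrow> 'a resfield" is "(+)" by (rule ocong_add)
lift_definition uminus_resfield :: "'a resfield \<Rightarrow> 'a resfield" is uminus by (rule ocong_uminus)
lift_definition minus_resfield :: "'a resfield \<Rightarrow> 'a resfield \<Rightarrow> 'a resfield" is "(-)" by (rule ocong_diff)
lift_definition times_resfield :: "'a resfield \<Rightarrow> 'a resfield \<Rightarrow> 'a resfield" is "(*)" by (rule ocong_mult)

lift_definition inverse_resfield :: "'a resfield \<Rightarrow> 'a resfield"
  is "\<lambda>x. if ocong 1 x 0 then 0 else (SOME y. x * y = 1)"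
proof -
  fix x x' :: "'a oring"
  assume c: "ocong 1 x x'"
  have iff: "ocong 1 x 0 \<longleftrightarrow> ocong 1 x' 0"
    using equivp_transp[OF equivp_ocong c] equivp_transp[OF equivp_ocong equivp_symp[OF equivp_ocong c]]
    by blast
  show "ocong 1 (if ocong 1 x 0 then 0 else (SOME y. x * y = 1))
     (if ocong 1 x' 0 then 0 else (SOME y. x' * y = 1))"
  proof (cases "ocong 1 x 0")
    case True
    then show ?thesis using iff equivp_reflp[OF equivp_ocong] by simp
  next
    case False
    have "\<not> ocong 1 x' 0" using False iff by blast
    have "ocong 1 (x * (SOME y. x * y = 1)) 1" "ocong 1 (x' * (SOME y. x' * y = 1)) 1"
      unfolding oring_some_inverse[OF False] oring_some_inverse[OF \<open>\<not> ocong 1 x' 0\<close>]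
      by (rule equivp_reflp[OF equivp_ocong])+
    from ocong_inverse_unique[OF c this]
    show ?thesis using False iff by simp
  qed
qed

definition divide_resfield :: "'a resfield \<Rightarrow> 'a resfield \<Rightarrow> 'a resfield" where
  "x div y = x * inverse (y :: 'a resfield)"

instance
proof
  show "(0 :: 'a resfield) \<noteq> 1"
    by transfer (rule not_ocong_0_1, simp)
  show "x div y = x * inverse y" for x y :: "'a resfield"
    by (rule divide_resfield_def)
  show "inverse x * x = 1" if "x \<noteq> 0" for x :: "'a resfield"
    using that
  proof transfer
    fix x :: "'a oring"
    assume "\<not> ocong 1 x 0"
    moreover from this have "x * (SOME y. x * y = 1) = 1"
      by (rule oring_some_inverse)
    ultimately show "ocong 1 ((if ocong 1 x 0 then 0 else SOME y. x * y = 1) * x) 1"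
      by (simp add: mult.commute equivp_reflp[OF equivp_ocong])
  qed
  show "inverse (0 :: 'a resfield) = 0"
    by transfer (simp add: equivp_reflp[OF equivp_ocong])
qed (transfer; simp add: algebra_simps equivp_reflp[OF equivp_ocong])+

end

lift_definition residue :: "'f::disc_valued_field o2 \<Rightarrow> 'f resfield" is "\<lambda>x. x"
  by (rule ocong_mono[of 1 2]) auto

lemma residue_surj: "surj residue"
  unfolding surj_def
proof
  fix y :: "'f::disc_valued_field resfield"
  show "\<exists>x. y = residue x"
    by (induction y) (rule exI[of _ "abs_o2 _"], simp add: residue.abs_eq)
qed

lemma residue_add: "residue (x + y) = residue x + residue y"
  by transfer (simp add: equivp_reflp[OF equivp_ocong])

lemma residue_mult: "residue (x * y) = residue x * residue y"
  by transfer (simp add: equivp_reflp[OF equivp_ocong])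

lemma uniformizer_times_eq_iff:
  fixes x y :: "'f::disc_valued_field o2"
  assumes w: "uniformizer w"
  shows "abs_o2 w * x = abs_o2 w * y \<longleftrightarrow> residue x = residue y"
proof -
  have "ocong 2 (w * a) (w * b) \<longleftrightarrow> ocong 1 a b" for a b
  proof -
    have "w * a - w * b = w * (a - b)"
      by (rule right_diff_distrib[symmetric])
    then show ?thesis
      using uniformizer_nonzero[OF w] unfolding ocong_iff_dvd[OF w]
      by (simp only: power2_eq_square power_one_right dvd_mult_cancel_left) simp
  qed
  then show ?thesis
    by (induction x; induction y)
      (simp add: times_o2.abs_eq residue.abs_eq o2.abs_eq_iff resfield.abs_eq_iff)
qed


section \<open>Matrix groups and the characters psi and phi\<close>

definition GL :: "nat \<Rightarrow> 'a::comm_ring_1 mat monoid" where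
  "GL n = units_of (ring_mat TYPE('a) n ())"

lemma group_GL: "group (GL n)"
proof -
  interpret R: ring "ring_mat TYPE('a::comm_ring_1) n ()" by (rule ring_mat)
  show ?thesis unfolding GL_def by (rule R.units_group)
qed

definition mat_tr :: "'a::comm_monoid_add mat \<Rightarrow> 'a" where
  "mat_tr A = (\<Sum>i<dim_row A. A $$ (i, i))"

definition additive_character :: "('a::comm_ring_1 \<Rightarrow> complex) \<Rightarrow> bool" where
  "additive_character \<psi> \<longleftrightarrow> (\<forall>x. \<psi> x \<noteq> 0) \<and> (\<forall>x y. \<psi> (x + y) = \<psi> x * \<psi> y)"

definition unip :: "'a::comm_ring_1 mat \<Rightarrow> 'a mat" where
  "unip X = four_block_mat (1\<^sub>m 2) X (0\<^sub>m 2 2) (1\<^sub>m 2)"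

definition N_subgroup :: "'a::comm_ring_1 mat set" where
  "N_subgroup = unip ` carrier_mat 2 2"

definition psi :: "('a::comm_ring_1 \<Rightarrow> complex) \<Rightarrow> 'a mat \<Rightarrow> complex" where
  "psi \<psi>0 n = \<psi>0 (mat_tr (mat 2 2 (\<lambda>(i, j). n $$ (i, j + 2))))"

lemma psi_unip: "X \<in> carrier_mat 2 2 \<Longrightarrow> psi \<psi>0 (unip X) = \<psi>0 (mat_tr X)"
  by (auto simp: psi_def unip_def mat_tr_def intro!: arg_cong[of _ _ \<psi>0] sum.cong)

definition diag_embed :: "'a::comm_ring_1 mat \<Rightarrow> 'a mat" where
  "diag_embed g = four_block_mat g (0\<^sub>m 2 2) (0\<^sub>m 2 2) g"

definition one_plus :: "'f::disc_valued_field oring \<Rightarrow> 'f o2 mat \<Rightarrow> 'f o2 mat" where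
  "one_plus w A = 1\<^sub>m 4 + abs_o2 w \<cdot>\<^sub>m A"

definition K1 :: "'f::disc_valued_field oring \<Rightarrow> 'f o2 mat set" where
  "K1 w = one_plus w ` carrier_mat 4 4"

text \<open>
  \<open>phi \<psi>0 w x (I + \<varpi> A) = \<psi>0 (\<varpi> tr (y A))\<close> for every lift \<open>y\<close> of \<open>x\<close>; the lemma \<open>phi_one_plus\<close>
  shows that the choices of \<open>y\<close> and \<open>A\<close> do not matter.
\<close>

definition phi ::
  "('f::disc_valued_field o2 \<Rightarrow> complex) \<Rightarrow> 'f oring \<Rightarrow> 'f resfield mat \<Rightarrow> 'f o2 mat \<Rightarrow> complex"
where
  "phi \<psi>0 w x k = (THE c. \<exists>y \<in> carrier_mat 4 4. \<exists>A \<in> carrier_mat 4 4.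
     map_mat residue y = x \<and> k = one_plus w A \<and> c = \<psi>0 (abs_o2 w * mat_tr (y * A)))"

lemma residue_sum: "residue (sum f S) = (\<Sum>i\<in>S. residue (f i))"
proof -
  have 0: "residue 0 = 0"
    by transfer (simp add: equivp_reflp[OF equivp_ocong])
  show ?thesis
    by (induction S rule: infinite_finite_induct) (auto simp: 0 residue_add)
qed

lemma residue_mat_tr_mult:
  assumes "y \<in> carrier_mat n n" "A \<in> carrier_mat n n"
  shows "residue (mat_tr (y * A)) = mat_tr (map_mat residue y * map_mat residue A)"
  using assms
  by (auto simp: mat_tr_def scalar_prod_def residue_sum residue_mult intro!: sum.cong)

lemma phi_one_plus:
  assumes w: "uniformizer w"
    and y: "y \<in> carrier_mat 4 4" and A: "A \<in> carrier_mat 4 4"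
  shows "phi \<psi>0 w (map_mat residue y) (one_plus w A) = \<psi>0 (abs_o2 w * mat_tr (y * A))"
  unfolding phi_def
proof (rule the_equality)
  show "\<exists>z\<in>carrier_mat 4 4. \<exists>B\<in>carrier_mat 4 4. map_mat residue z = map_mat residue y \<and>
      one_plus w A = one_plus w B \<and> \<psi>0 (abs_o2 w * mat_tr (y * A)) = \<psi>0 (abs_o2 w * mat_tr (z * B))"
    using y A by blast
next
  fix c
  assume "\<exists>z\<in>carrier_mat 4 4. \<exists>B\<in>carrier_mat 4 4. map_mat residue z = map_mat residue y \<and>
      one_plus w A = one_plus w B \<and> c = \<psi>0 (abs_o2 w * mat_tr (z * B))"
  then obtain z B where z: "z \<in> carrier_mat 4 4" "map_mat residue z = map_mat residue y"
    and B: "B \<in> carrier_mat 4 4" "one_plus w A = one_plus w B"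
    and c: "c = \<psi>0 (abs_o2 w * mat_tr (z * B))" by blast
  have "map_mat residue A = map_mat residue B"
  proof (rule eq_matI)
    fix i j assume "i < dim_row (map_mat residue B)" "j < dim_col (map_mat residue B)"
    then have ij: "i < 4" "j < 4" using B by auto
    have "one_plus w A $$ (i, j) = one_plus w B $$ (i, j)" using B(2) by simp
    then have "abs_o2 w * A $$ (i, j) = abs_o2 w * B $$ (i, j)"
      using ij A B(1) by (simp add: one_plus_def)
    then show "map_mat residue A $$ (i, j) = map_mat residue B $$ (i, j)"
      using ij A B(1) by (simp add: uniformizer_times_eq_iff[OF w])
  qed (use A B in auto)
  then have "residue (mat_tr (z * B)) = residue (mat_tr (y * A))"
    using z y A B by (simp add: residue_mat_tr_mult)
  then show "c = \<psi>0 (abs_o2 w * mat_tr (y * A))"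
    unfolding c by (simp add: uniformizer_times_eq_iff[OF w, symmetric])
qed


section \<open>Representations\<close>

text \<open>
  The representation space is a finite-dimensional subspace \<open>V\<close> of an ambient complex vector space,
  so that subspaces such as the twisted invariants are again representations. Only the values of
  \<open>\<rho> g\<close> on \<open>V\<close> for \<open>g \<in> carrier G\<close> are meaningful.
\<close>

locale fd_representation = group G + vector_space scale
  for G :: "('g, 'm) monoid_scheme" (structure)
    and scale :: "complex \<Rightarrow> 'v::ab_group_add \<Rightarrow> 'v" +
  fixes V :: "'v set" and \<rho> :: "'g \<Rightarrow> 'v \<Rightarrow> 'v"
  assumes subspace_V: "subspace V"
    and finite_dim: "\<exists>B. finite B \<and> span B = V"
    and rho_closed: "g \<in> carrier G \<Longrightarrow> v \<in> V \<Longrightarrow> \<rho> g v \<in> V"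
    and rho_add: "g \<in> carrier G \<Longrightarrow> u \<in> V \<Longrightarrow> v \<in> V \<Longrightarrow> \<rho> g (u + v) = \<rho> g u + \<rho> g v"
    and rho_scale: "g \<in> carrier G \<Longrightarrow> v \<in> V \<Longrightarrow> \<rho> g (scale c v) = scale c (\<rho> g v)"
    and rho_one: "v \<in> V \<Longrightarrow> \<rho> \<one> v = v"
    and rho_mult: "g \<in> carrier G \<Longrightarrow> h \<in> carrier G \<Longrightarrow> v \<in> V \<Longrightarrow> \<rho> (g \<otimes> h) v = \<rho> g (\<rho> h v)"

locale irreducible_representation = fd_representation +
  assumes nontrivial: "V \<noteq> {0}"
    and irreducible: "subspace W \<Longrightarrow> W \<subseteq> V \<Longrightarrow> (\<And>g v. g \<in> carrier G \<Longrightarrow> v \<in> W \<Longrightarrow> \<rho> g v \<in> W)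
      \<Longrightarrow> W = {0} \<or> W = V"

definition eigenspace ::
  "(complex \<Rightarrow> 'v \<Rightarrow> 'v) \<Rightarrow> 'v set \<Rightarrow> ('g \<Rightarrow> 'v \<Rightarrow> 'v) \<Rightarrow> 'g set \<Rightarrow> ('g \<Rightarrow> complex) \<Rightarrow> 'v set"
where
  "eigenspace scale V \<rho> H \<chi> = {v \<in> V. \<forall>h\<in>H. \<rho> h v = scale (\<chi> h) v}"

definition strongly_cuspidal ::
  "('f::disc_valued_field o2 \<Rightarrow> complex) \<Rightarrow> 'f oring \<Rightarrow>
    (complex \<Rightarrow> 'v::ab_group_add \<Rightarrow> 'v) \<Rightarrow> 'v set \<Rightarrow> ('f o2 mat \<Rightarrow> 'v \<Rightarrow> 'v) \<Rightarrow> bool"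
where
  "strongly_cuspidal \<psi>0 w scale V \<pi> \<longleftrightarrow>
     irreducible_representation (GL 4) scale V \<pi> \<and>
     (\<exists>x \<in> carrier_mat 4 4. Factorial_Ring.irreducible (char_poly x) \<and>
        eigenspace scale V \<pi> (K1 w) (phi \<psi>0 w x) \<noteq> {0})"

text \<open>
  A homomorphism is a function on the ambient type, so it is extended by \<open>0\<close> outside \<open>V\<close>. Both spaces
  being finite-dimensional, so is the space of homomorphisms, and \<open>hom_dim\<close> is its true dimension.
\<close>

definition hom_space ::
  "('g, 'm) monoid_scheme \<Rightarrow>
    (complex \<Rightarrow> 'v::ab_group_add \<Rightarrow> 'v) \<Rightarrow> 'v set \<Rightarrow> ('g \<Rightarrow> 'v \<Rightarrow> 'v) \<Rightarrow>
    (complex \<Rightarrow> 'u::ab_group_add \<Rightarrow> 'u) \<Rightarrow> 'u set \<Rightarrow> ('g \<Rightarrow> 'u \<Rightarrow> 'u) \<Rightarrow> ('v \<Rightarrow> 'u) set"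
where
  "hom_space G scaleV V \<rho> scaleU U \<sigma> = {f.
     (\<forall>v. v \<notin> V \<longrightarrow> f v = 0) \<and>
     (\<forall>v\<in>V. f v \<in> U) \<and>
     (\<forall>v\<in>V. \<forall>v'\<in>V. f (v + v') = f v + f v') \<and>
     (\<forall>c. \<forall>v\<in>V. f (scaleV c v) = scaleU c (f v)) \<and>
     (\<forall>g\<in>carrier G. \<forall>v\<in>V. f (\<rho> g v) = \<sigma> g (f v))}"

definition hom_dim ::
  "('g, 'm) monoid_scheme \<Rightarrow>
    (complex \<Rightarrow> 'v::ab_group_add \<Rightarrow> 'v) \<Rightarrow> 'v set \<Rightarrow> ('g \<Rightarrow> 'v \<Rightarrow> 'v) \<Rightarrow>
    (complex \<Rightarrow> 'u::ab_group_add \<Rightarrow> 'u) \<Rightarrow> 'u set \<Rightarrow> ('g \<Rightarrow> 'u \<Rightarrow> 'u) \<Rightarrow> nat"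
where
  "hom_dim G scaleV V \<rho> scaleU U \<sigma> =
     vector_space.dim (\<lambda>c f v. scaleU c (f v)) (hom_space G scaleV V \<rho> scaleU U \<sigma>)"

end

theory Submission
  imports Defs
begin

text \<open>
  Restricted to the congruence subgroup \<open>K\<^sup>1\<close>, a strongly cuspidal \<open>\<pi>\<close> is the direct sum of lines
  \<open>L\<^sub>y\<close>, \<open>y\<close> running over a conjugacy class in \<open>M\<^sub>4(\<bbbF>\<^sub>q)\<close>. Averaging over \<open>N\<close> identifies homomorphisms
  \<open>\<pi>\<^bsub>N,\<psi>\<^esub> \<rightarrow> \<sigma>\<close> with maps \<open>F : V \<rightarrow> U\<close> that are \<open>(N,\<psi>)\<close>- and \<open>GL\<^sub>2\<close>-equivariant. Such an \<open>F\<close> lives on the \<open>L\<^sub>y\<close>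
  whose lower left block is \<open>1\<close>, and \<open>N\<close> moves these to \<open>y = [0 b; 1 d]\<close>; there \<open>F\<close> takes values in the
  \<open>\<phi>\<^sub>d\<close>-isotypic part of \<open>\<sigma>\<close>. Since \<open>\<sigma>\<close> is irreducible, only one conjugacy class of \<open>d\<close> contributes, and
  for fixed \<open>d\<close> the centralizer of \<open>d\<close> permutes the possible \<open>b\<close> transitively, because \<open>tr b\<close>, \<open>tr db\<close>
  and \<open>det b\<close> are read off the irreducible characteristic polynomial of \<open>y\<close>. So \<open>F\<close> is determined by its
  value at one vector. If \<open>d\<close> is not scalar, this value lies in the \<open>\<phi>\<^sub>d\<close>-isotypic line of \<open>\<sigma>\<close>; if \<open>d\<close> is
  scalar, it lies in an eigenspace of the non-split torus centralizing \<open>b\<close>, which is at most a line by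
  Gelfand's trick.
\<close>

text \<open>The twisted invariants are not a sum of lines \<open>L_y\<close>, since \<open>N\<close>
  permutes these lines; hence homomorphisms are extended to all of \<open>V\<close> and evaluated
  line by line. The case distinction on \<open>d\<close> has this reason: if \<open>d\<close> is
  scalar, all of \<open>GL 2\<close> fixes \<phi>_d, so its isotypic part in \<sigma>, once nonzero,
  is the whole of \<open>U\<close>, and the congruence subgroup gives no bound. What is left is the
  action on \<open>L_y\<close> of the elements commuting with \<open>b\<close> modulo the
  uniformizer; the anti-automorphism for Gelfand's trick is transposition twisted so as to fix
  \<open>b\<close>. Irreducibility of the characteristic polynomial enters twice. The matrices over
  the residue field that commute with \<open>y\<close> form a field, which makes \<open>L_y\<close>
  a line; and \<open>b\<close>, \<open>d\<close> have no common eigenvector, which makes every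
  nonzero \<open>s\<close> with \<open>s b = b' s\<close> and \<open>s d = d s\<close> invertible.
  Bounds on multiplicities all rest on one criterion: an isotypic subspace of an irreducible
  representation is a line as soon as the operators \<open>proj \<circ> \<rho> g\<close> on it
  commute. Averaging requires finite groups; finiteness of the residue field is obtained from the
  finite dimension of \<open>V\<close>.\<close>

no_notation fps_nth (infixl "$" 75)

section \<open>Commuting operators on a complex vector space\<close>

locale complex_vector_space = vector_space scale
  for scale :: "complex \<Rightarrow> 'v::ab_group_add \<Rightarrow> 'v"
begin

definition endo_on :: "'v set \<Rightarrow> ('v \<Rightarrow> 'v) \<Rightarrow> bool" where
  "endo_on E T \<longleftrightarrow> (\<forall>v\<in>E. T v \<in> E) \<and> (\<forall>u\<in>E. \<forall>v\<in>E. T (u + v) = T u + T v) \<and>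
     (\<forall>c. \<forall>v\<in>E. T (scale c v) = scale c (T v))"

text \<open>Horner evaluation of \<open>p(T) e\<close>. Since \<open>T\<close> is linear only on
  \<open>E\<close>, polynomials in \<open>T\<close> are applied to vectors of \<open>E\<close> and
  never formed as operators.\<close>

definition poly_act :: "('v \<Rightarrow> 'v) \<Rightarrow> complex poly \<Rightarrow> 'v \<Rightarrow> 'v" where
  "poly_act T p e = fold_coeffs (\<lambda>a v. scale a e + T v) p 0"

context
  fixes E T
  assumes E: "subspace E" and T: "endo_on E T"
begin

lemma endo_on_zero: "T 0 = 0"
  using T subspace_0[OF E] by (metis endo_on_def scale_zero_left)

lemma poly_act_0 [simp]: "poly_act T 0 e = 0"
  by (simp add: poly_act_def)

lemma poly_act_pCons [simp]: "poly_act T (pCons a p) e = scale a e + T (poly_act T p e)"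
  by (cases "a = 0"; cases "p = 0") (auto simp: poly_act_def endo_on_zero)

lemma poly_act_closed: "e \<in> E \<Longrightarrow> poly_act T p e \<in> E"
  using T E by (induction p) (auto simp: endo_on_def subspace_0 intro!: subspace_add subspace_scale)

lemma poly_act_add: "e \<in> E \<Longrightarrow> poly_act T (p + q) e = poly_act T p e + poly_act T q e"
proof (induction p q rule: poly_induct2)
  case (pCons a p b q)
  then show ?case
    using T poly_act_closed by (simp add: endo_on_def scale_left_distrib algebra_simps)
qed simp

lemma poly_act_smult: "e \<in> E \<Longrightarrow> poly_act T (Polynomial.smult c p) e = scale c (poly_act T p e)"
proof (induction p)
  case (pCons a p)
  then show ?case
    using T poly_act_closed by (simp add: endo_on_def scale_right_distrib)
qed simp

lemma poly_act_monom: "e \<in> E \<Longrightarrow> poly_act T (Polynomial.monom c i) e = scale c ((T ^^ i) e)"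
proof (induction i)
  case 0
  then show ?case by (simp add: monom_0 endo_on_zero)
next
  case (Suc i)
  have "(T ^^ i) e \<in> E" using Suc.prems T by (induction i) (auto simp: endo_on_def)
  then show ?case using Suc T by (simp add: Polynomial.monom_Suc endo_on_def)
qed

lemma poly_act_sum:
  "e \<in> E \<Longrightarrow> poly_act T (\<Sum>i\<in>I. f i) e = (\<Sum>i\<in>I. poly_act T (f i) e)"
  by (induction I rule: infinite_finite_induct) (simp_all add: poly_act_add)

text \<open>Split off a root: \<open>p = (X - l) q\<close>. Either \<open>q(T) e\<close> is an
  eigenvector for \<open>l\<close>, or \<open>q\<close> is an annihilator of smaller degree.\<close>

lemma eigenvector_of_annihilator:
  "p \<noteq> 0 \<Longrightarrow> e \<in> E \<Longrightarrow> e \<noteq> 0 \<Longrightarrow> poly_act T p e = 0 \<Longrightarrow> \<exists>l. \<exists>v\<in>E. v \<noteq> 0 \<and> T v = scale l v"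
proof (induction "Polynomial.degree p" arbitrary: p)
  case 0
  then obtain a where "p = [:a:]" "a \<noteq> 0" by (metis degree_eq_zeroE pCons_0_0)
  with 0 show ?case by (simp add: endo_on_zero)
next
  case (Suc n)
  then have "\<not> constant (poly p)" by (simp add: constant_degree)
  then obtain l where "poly p l = 0" using fundamental_theorem_of_algebra by blast
  then obtain q where p: "p = [:- l, 1:] * q" by (metis dvdE poly_eq_0_iff_dvd)
  have "q \<noteq> 0" using p Suc.prems(1) by auto
  then have "Polynomial.degree p = Suc (Polynomial.degree q)" unfolding p by (subst degree_mult_eq) auto
  with Suc.hyps(2) \<open>q \<noteq> 0\<close> have q: "q \<noteq> 0" "n = Polynomial.degree q" by auto
  have "poly_act T p e = poly_act T (Polynomial.smult (- l) q + pCons 0 q) e" by (simp add: p)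
  also have "\<dots> = - scale l (poly_act T q e) + T (poly_act T q e)"
    by (simp only: poly_act_add[OF Suc(4)] poly_act_smult[OF Suc(4)]) simp
  finally have "T (poly_act T q e) = scale l (poly_act T q e)" using Suc by simp
  then show ?case using Suc q poly_act_closed by blast
qed

text \<open>One more iterate \<open>T^i e\<close> than there are elements of \<open>B\<close> forces
  a linear relation, hence an annihilating polynomial.\<close>

lemma eigenvector_exists:
  assumes ne: "E \<noteq> {0}" and fin: "finite B" "E \<subseteq> span B"
  shows "\<exists>l. \<exists>v\<in>E. v \<noteq> 0 \<and> T v = scale l v"
proof -
  obtain e where e: "e \<in> E" "e \<noteq> 0" using ne subspace_0[OF E] by blast
  define x where "x i = (T ^^ i) e" for i
  have xE: "x i \<in> E" for i
    unfolding x_def using e T by (induction i) (auto simp: endo_on_def)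
  define n where "n = card B"
  have "\<exists>p. p \<noteq> 0 \<and> poly_act T p e = 0"
  \<comment> \<open>\<open>dependent\<close> is a property of sets and does not see repeated
    iterates; a repetition gives the annihilator \<open>X^i - X^j\<close> directly.\<close>
  proof (cases "inj_on x {..n}")
    case True
    have "dependent (x ` {..n})"
    proof (rule ccontr)
      assume "\<not> dependent (x ` {..n})"
      then have "card (x ` {..n}) \<le> card B"
        using independent_span_bound[OF fin(1)] xE fin(2) by blast
      then show False using card_image[OF True] by (simp add: n_def)
    qed
    then obtain u v where u: "v \<in> x ` {..n}" "u v \<noteq> 0" "(\<Sum>v\<in>x ` {..n}. scale (u v) v) = 0"
      by (auto simp: dependent_finite)
    then obtain i where i: "i \<le> n" "u (x i) \<noteq> 0" by auto
    let ?p = "\<Sum>i\<le>n. Polynomial.monom (u (x i)) i"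
    have "Polynomial.coeff ?p i = u (x i)" using i by (simp add: coeff_sum)
    then have "?p \<noteq> 0" using i by auto
    moreover have "poly_act T ?p e = (\<Sum>i\<le>n. scale (u (x i)) (x i))"
      using e by (simp add: poly_act_sum poly_act_monom x_def)
    then have "poly_act T ?p e = 0"
      using u(3) by (simp add: sum.reindex[OF True] o_def)
    ultimately show ?thesis by blast
  next
    case False
    then obtain i j where ij: "i \<noteq> j" "x i = x j" by (auto simp: inj_on_def)
    let ?p = "Polynomial.monom 1 i + Polynomial.monom (-1) j :: complex poly"
    have "Polynomial.coeff ?p i = 1" using ij by (simp add: Polynomial.coeff_monom)
    then have "?p \<noteq> 0" by (metis Polynomial.coeff_0 zero_neq_one)
    moreover have "poly_act T ?p e = 0"
      using e ij by (simp add: poly_act_add poly_act_monom x_def)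
    ultimately show ?thesis by blast
  qed
  then show ?thesis using eigenvector_of_annihilator e by blast
qed

end

text \<open>An eigenspace of one operator is stable under those commuting with it, so the remaining
  operators can be restricted to it.\<close>

lemma common_eigenvector:
  assumes "finite \<T>" "finite B"
    and "subspace E" "E \<noteq> {0}" "E \<subseteq> span B"
    and "\<And>T. T \<in> \<T> \<Longrightarrow> endo_on E T"
    and "\<And>S T v. S \<in> \<T> \<Longrightarrow> T \<in> \<T> \<Longrightarrow> v \<in> E \<Longrightarrow> S (T v) = T (S v)"
  shows "\<exists>v\<in>E. v \<noteq> 0 \<and> (\<forall>T\<in>\<T>. \<exists>l. T v = scale l v)"
  using assms
proof (induction \<T> arbitrary: E rule: finite_induct)
  case empty
  then show ?case using subspace_0 by blast
next
  case (insert T \<T>)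
  have T: "endo_on E T" using insert.prems by blast
  obtain l v where v: "v \<in> E" "v \<noteq> 0" "T v = scale l v"
    using eigenvector_exists[OF insert.prems(2) T insert.prems(3,1,4)] by blast
  let ?F = "{u \<in> E. T u = scale l u}"
  have T0: "T 0 = 0" by (rule endo_on_zero[OF insert.prems(2) T])
  have "\<exists>v\<in>?F. v \<noteq> 0 \<and> (\<forall>S\<in>\<T>. \<exists>l. S v = scale l v)"
  proof (rule insert.IH)
    show "subspace ?F"
      using insert.prems(2) T T0
      by (auto simp: subspace_def endo_on_def scale_right_distrib mult.commute)
    show "?F \<noteq> {0}" using v by blast
    show "?F \<subseteq> span B" using insert.prems by blast
    show "endo_on ?F S" if "S \<in> \<T>" for S
    proof -
      have S: "endo_on E S" using that insert.prems by blast
      have "T (S u) = scale l (S u)" if "u \<in> ?F" for u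
      proof -
        have "T (S u) = S (T u)" using that \<open>S \<in> \<T>\<close> insert.prems(6)[of T S u] by simp
        then show ?thesis using that S by (simp add: endo_on_def)
      qed
      then show ?thesis using S by (auto simp: endo_on_def)
    qed
  qed (use insert.prems in auto)
  then show ?case by blast
qed

end


section \<open>Isotypic vectors and multiplicity one\<close>

sublocale fd_representation \<subseteq> complex_vector_space scale ..

context fd_representation
begin

lemma V_add: "u \<in> V \<Longrightarrow> v \<in> V \<Longrightarrow> u + v \<in> V"
  and V_scale: "v \<in> V \<Longrightarrow> scale c v \<in> V"
  and V_0: "0 \<in> V"
  using subspace_V by (auto intro: subspace_add subspace_scale subspace_0)

lemma V_sum: "(\<And>i. i \<in> I \<Longrightarrow> f i \<in> V) \<Longrightarrow> sum f I \<in> V"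
  using subspace_V by (rule subspace_sum)

lemma rho_zero: "g \<in> carrier G \<Longrightarrow> \<rho> g 0 = 0"
  using rho_scale[of g 0 0] V_0 by simp

lemma rho_sum:
  "g \<in> carrier G \<Longrightarrow> (\<And>i. i \<in> I \<Longrightarrow> f i \<in> V) \<Longrightarrow> \<rho> g (sum f I) = (\<Sum>i\<in>I. \<rho> g (f i))"
  by (induction I rule: infinite_finite_induct) (auto simp: rho_zero rho_add V_sum)

lemma eigenspace_subspace:
  assumes "H \<subseteq> carrier G"
  shows "subspace (eigenspace scale V \<rho> H \<chi>)"
  using assms by (auto simp: subspace_def eigenspace_def V_0 V_add V_scale rho_zero rho_add rho_scale
      scale_right_distrib mult.commute subsetD)

end

lemma (in irreducible_representation) span_orbits:
  assumes "S \<subseteq> V" "u \<in> S" "u \<noteq> 0"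
  shows "span (\<Union>g\<in>carrier G. \<rho> g ` S) = V"
proof -
  let ?O = "\<Union>g\<in>carrier G. \<rho> g ` S"
  have O: "?O \<subseteq> V" using rho_closed assms by auto
  then have W: "span ?O \<subseteq> V" by (simp add: span_minimal subspace_V)
  have "u \<in> ?O" using assms rho_one one_closed by (force simp: subset_iff)
  then have "u \<in> span ?O" by (rule span_base)
  then have ne: "span ?O \<noteq> {0}" using assms(3) by auto
  \<comment> \<open>Membership in \<open>V\<close> is carried through the induction because
    \<open>\<rho> g\<close> is linear only there.\<close>
  have "v \<in> V \<and> \<rho> g v \<in> span ?O" if "g \<in> carrier G" "v \<in> span ?O" for g v
    using that(2)
  proof (induction rule: span_induct_alt)
    case base
    then show ?case using that by (simp add: rho_zero span_zero V_0)
  next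
    case (step c x y)
    then obtain h s where x: "x = \<rho> h s" "h \<in> carrier G" "s \<in> S" by auto
    have xV: "x \<in> V" using x assms rho_closed by blast
    have "\<rho> g x = \<rho> (g \<otimes> h) s" using x that assms by (auto simp: rho_mult)
    then have "\<rho> g x \<in> span ?O" using x that by (auto intro!: span_base)
    moreover have "\<rho> g (scale c x + y) = scale c (\<rho> g x) + \<rho> g y"
      using xV step that by (simp add: V_scale rho_scale rho_add)
    ultimately show ?case using step xV by (simp add: span_add span_scale V_add V_scale)
  qed
  then show ?thesis using irreducible[OF subspace_span W] ne by blast
qed

section \<open>Averaging over a finite subgroup against a character\<close>

locale isotypic = fd_representation +
  fixes H and \<chi> :: "'a \<Rightarrow> complex"
  assumes subgroup_H: "subgroup H G" and finite_H: "finite H"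
    and chi_nonzero: "h \<in> H \<Longrightarrow> \<chi> h \<noteq> 0"
    and chi_mult: "h \<in> H \<Longrightarrow> k \<in> H \<Longrightarrow> \<chi> (h \<otimes> k) = \<chi> h * \<chi> k"
begin

definition proj where
  "proj v = scale (inverse (of_nat (card H))) (\<Sum>h\<in>H. scale (inverse (\<chi> h)) (\<rho> h v))"

abbreviation "E \<equiv> eigenspace scale V \<rho> H \<chi>"

lemma H_carrier: "h \<in> H \<Longrightarrow> h \<in> carrier G"
  using subgroup_H by (rule subgroup.mem_carrier)

lemma card_H: "of_nat (card H) \<noteq> (0 :: complex)"
  using finite_H subgroup.one_closed[OF subgroup_H] by auto

lemma proj_closed: "v \<in> V \<Longrightarrow> proj v \<in> V"
  unfolding proj_def by (intro V_scale V_sum rho_closed H_carrier)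

lemma proj_add: "u \<in> V \<Longrightarrow> v \<in> V \<Longrightarrow> proj (u + v) = proj u + proj v"
  unfolding proj_def
  by (simp add: rho_add H_carrier scale_right_distrib sum.distrib)

lemma proj_scale: "v \<in> V \<Longrightarrow> proj (scale c v) = scale c (proj v)"
  unfolding proj_def
  by (simp add: rho_scale H_carrier scale_sum_right mult_ac)

lemma proj_zero: "proj 0 = 0"
  using proj_scale[OF V_0, of 0] by simp

lemma proj_sum: "(\<And>i. i \<in> I \<Longrightarrow> f i \<in> V) \<Longrightarrow> proj (sum f I) = (\<Sum>i\<in>I. proj (f i))"
  by (induction I rule: infinite_finite_induct) (auto simp: proj_zero proj_add V_sum)

lemma proj_rho:
  assumes h: "h \<in> H" and v: "v \<in> V"
  shows "proj (\<rho> h v) = scale (\<chi> h) (proj v)"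
proof -
  have bij: "bij_betw (\<lambda>k. k \<otimes> h) H H"
    by (rule bij_betw_byWitness[where f' = "\<lambda>k. k \<otimes> inv h"])
      (use h subgroup_H H_carrier in \<open>auto simp: m_assoc intro: subgroup.m_closed subgroup.m_inv_closed\<close>)
  have "(\<Sum>k\<in>H. scale (inverse (\<chi> k)) (\<rho> k (\<rho> h v)))
      = (\<Sum>k\<in>H. scale (\<chi> h) (scale (inverse (\<chi> (k \<otimes> h))) (\<rho> (k \<otimes> h) v)))"
    using h v by (intro sum.cong refl) (simp add: chi_mult rho_mult H_carrier chi_nonzero)
  also have "\<dots> = (\<Sum>k\<in>H. scale (\<chi> h) (scale (inverse (\<chi> k)) (\<rho> k v)))"
    by (rule sum.reindex_bij_betw[OF bij])
  finally show ?thesis unfolding proj_def by (simp add: scale_sum_right mult_ac)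
qed

lemma rho_proj:
  assumes h: "h \<in> H" and v: "v \<in> V"
  shows "\<rho> h (proj v) = scale (\<chi> h) (proj v)"
proof -
  have bij: "bij_betw (\<lambda>k. h \<otimes> k) H H"
    by (rule bij_betw_byWitness[where f' = "\<lambda>k. inv h \<otimes> k"])
      (use h subgroup_H H_carrier in
        \<open>auto simp: m_assoc[symmetric] intro: subgroup.m_closed subgroup.m_inv_closed\<close>)
  have "\<rho> h (\<Sum>k\<in>H. scale (inverse (\<chi> k)) (\<rho> k v))
      = (\<Sum>k\<in>H. scale (inverse (\<chi> k)) (\<rho> h (\<rho> k v)))"
    using h v by (simp add: rho_sum rho_scale rho_closed V_scale H_carrier)
  also have "\<dots> = (\<Sum>k\<in>H. scale (\<chi> h) (scale (inverse (\<chi> (h \<otimes> k))) (\<rho> (h \<otimes> k) v)))"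
    using h v by (intro sum.cong refl) (simp add: chi_mult rho_mult H_carrier chi_nonzero)
  also have "\<dots> = (\<Sum>k\<in>H. scale (\<chi> h) (scale (inverse (\<chi> k)) (\<rho> k v)))"
    by (rule sum.reindex_bij_betw[OF bij])
  finally have *: "\<rho> h (\<Sum>k\<in>H. scale (inverse (\<chi> k)) (\<rho> k v)) =
      scale (\<chi> h) (\<Sum>k\<in>H. scale (inverse (\<chi> k)) (\<rho> k v))"
    by (simp only: scale_sum_right)
  have "(\<Sum>k\<in>H. scale (inverse (\<chi> k)) (\<rho> k v)) \<in> V"
    using v by (intro V_sum V_scale rho_closed H_carrier)
  from rho_scale[OF H_carrier[OF h] this] show ?thesis
    unfolding proj_def * by (simp only: * scale_scale mult.commute)
qed

lemma proj_in_E: "v \<in> V \<Longrightarrow> proj v \<in> E"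
  by (simp add: eigenspace_def proj_closed rho_proj)

lemma proj_id: "v \<in> E \<Longrightarrow> proj v = v"
proof -
  assume v: "v \<in> E"
  have "(\<Sum>h\<in>H. scale (inverse (\<chi> h)) (\<rho> h v)) = (\<Sum>h\<in>H. v)"
    using v by (intro sum.cong refl) (simp add: eigenspace_def chi_nonzero)
  then show ?thesis using card_H by (simp add: proj_def sum_constant_scale)
qed

lemma E_subset: "E \<subseteq> V"
  by (auto simp: eigenspace_def)

lemma subspace_E: "subspace E"
  by (rule eigenspace_subspace) (use H_carrier in blast)

text \<open>Orthogonality of distinct characters: \<open>proj (\<rho> h v)\<close> is
  \<open>proj v\<close> multiplied by \<open>\<chi> h\<close>, and also by
  \<open>\<chi>' h\<close>.\<close>

lemma proj_other_eigenspace: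
  assumes "v \<in> eigenspace scale V \<rho> H \<chi>'" "h \<in> H" "\<chi>' h \<noteq> \<chi> h"
  shows "proj v = 0"
proof -
  have v: "v \<in> V" "\<rho> h v = scale (\<chi>' h) v" using assms by (auto simp: eigenspace_def)
  then have "scale (\<chi> h) (proj v) = scale (\<chi>' h) (proj v)"
    using proj_rho[OF assms(2) v(1)] proj_scale[OF v(1), of "\<chi>' h"] v(2) by metis
  then show ?thesis using assms(3) by (metis scale_cancel_right)
qed

end

section \<open>Operators cut down to an isotypic subspace\<close>

locale irreducible_isotypic = isotypic + irreducible_representation +
  assumes finite_G: "finite (carrier G)"
begin

text \<open>The operators \<open>proj \<circ> \<rho> g\<close> act irreducibly on \<open>E\<close>, so if they commute, \<open>E\<close> is a line.\<close>

lemma multiplicity_one: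
  assumes comm: "\<And>g h e. g \<in> carrier G \<Longrightarrow> h \<in> carrier G \<Longrightarrow> e \<in> E \<Longrightarrow>
      proj (\<rho> g (proj (\<rho> h e))) = proj (\<rho> h (proj (\<rho> g e)))"
    and ab: "a \<in> E" "b \<in> E" "a \<noteq> 0"
  shows "\<exists>c. b = scale c a"
proof -
  let ?T = "(\<lambda>g e. proj (\<rho> g e)) ` carrier G"
  obtain B where B: "finite B" "span B = V" using finite_dim by blast
  have "\<exists>w\<in>E. w \<noteq> 0 \<and> (\<forall>T\<in>?T. \<exists>l. T w = scale l w)"
  proof (rule common_eigenvector)
    show "finite ?T" using finite_G by simp
    show "finite B" by fact
    show "subspace E" by (rule subspace_E)
    show "E \<noteq> {0}" using ab by blast
    show "E \<subseteq> span B" using E_subset B by simp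
    show "endo_on E T" if T: "T \<in> ?T" for T
      using T E_subset
      by (auto simp: endo_on_def subset_iff proj_in_E rho_closed rho_add rho_scale proj_add proj_scale)
    show "S (T v) = T (S v)" if "S \<in> ?T" "T \<in> ?T" "v \<in> E" for S T v
      using that comm by auto
  qed
  then obtain w where w: "w \<in> E" "w \<noteq> 0"
    and l: "\<And>g. g \<in> carrier G \<Longrightarrow> \<exists>l. proj (\<rho> g w) = scale l w" by auto
  have wV: "w \<in> V" using w E_subset by blast
  have span: "span (\<Union>g\<in>carrier G. \<rho> g ` {w}) = V" by (rule span_orbits[OF _ _ w(2)]) (use wV in auto)
  \<comment> \<open>The orbit of the common eigenvector \<open>w\<close> spans \<open>V\<close>, and
    \<open>proj\<close> sends it into the line of \<open>w\<close>. As \<open>proj\<close> is the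
    identity on \<open>E\<close>, all of \<open>E\<close> lies in that line.\<close>
  have "v \<in> V \<and> (\<exists>l. proj v = scale l w)" if "v \<in> span (\<Union>g\<in>carrier G. \<rho> g ` {w})" for v
    using that
  proof (induction rule: span_induct_alt)
    case base
    show ?case using proj_zero V_0 by (metis scale_zero_left)
  next
    case (step c x y)
    then obtain g where x: "x = \<rho> g w" "g \<in> carrier G" by auto
    have xy: "x \<in> V" "y \<in> V" using x step wV rho_closed by auto
    obtain l m where "proj x = scale l w" "proj y = scale m w" using l x step by blast
    moreover have "proj (scale c x + y) = scale c (proj x) + proj y"
      using xy by (simp add: proj_add proj_scale V_scale)
    ultimately have "proj (scale c x + y) = scale (c * l + m) w" by (simp add: scale_left_distrib)
    then show ?case using xy by (blast intro: V_add V_scale)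
  qed
  then have *: "\<exists>l. v = scale l w" if "v \<in> E" for v
    using that proj_id E_subset span by (metis subsetD)
  obtain k m where km: "a = scale k w" "b = scale m w" using * ab by blast
  then have "b = scale (m / k) a" using ab by auto
  then show ?thesis ..
qed

text \<open>Gelfand's trick: \<open>\<tau>\<close> reverses products but does not change \<open>proj \<circ> \<rho> g\<close> on \<open>E\<close>, so these operators
  commute.\<close>

lemma multiplicity_one_anti_automorphism:
  assumes \<tau>: "\<And>g. g \<in> carrier G \<Longrightarrow> \<tau> g \<in> carrier G"
      "\<And>g h. g \<in> carrier G \<Longrightarrow> h \<in> carrier G \<Longrightarrow> \<tau> (g \<otimes> h) = \<tau> h \<otimes> \<tau> g"
      "inj_on \<tau> (carrier G)"
    and coset: "\<And>g. g \<in> carrier G \<Longrightarrow> \<exists>s\<in>H. \<exists>t\<in>H. \<tau> g = s \<otimes> g \<otimes> t \<and> \<chi> s * \<chi> t = 1"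
    and ab: "a \<in> E" "b \<in> E" "a \<noteq> 0"
  shows "\<exists>c. b = scale c a"
proof (rule multiplicity_one[OF _ ab])
  define A where "A g e = proj (\<rho> g e)" for g e
  have A\<tau>: "A (\<tau> g) e = A g e" if g: "g \<in> carrier G" and e: "e \<in> E" for g e
  proof -
    obtain s t where st: "s \<in> H" "t \<in> H" "\<tau> g = s \<otimes> g \<otimes> t" "\<chi> s * \<chi> t = 1"
      using coset[OF g] by blast
    have eV: "e \<in> V" using e E_subset by blast
    have "\<rho> (\<tau> g) e = \<rho> s (\<rho> g (scale (\<chi> t) e))"
      using st g e eV by (simp add: rho_mult H_carrier rho_closed) (simp add: eigenspace_def)
    then have "A (\<tau> g) e = scale (\<chi> s) (proj (\<rho> g (scale (\<chi> t) e)))"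
      unfolding A_def using st g eV by (simp add: proj_rho rho_closed V_scale)
    also have "\<dots> = scale (\<chi> s * \<chi> t) (A g e)"
      unfolding A_def using g eV by (simp add: rho_scale proj_scale rho_closed)
    finally show ?thesis using st by simp
  qed
  \<comment> \<open>Expanding the inner projection writes a product of two operators as a weighted
    sum of single ones, to which \<open>A\<tau>\<close> applies term by term.\<close>
  have AA: "A g (A h e) = scale (inverse (of_nat (card H)))
      (\<Sum>t\<in>H. scale (inverse (\<chi> t)) (A (g \<otimes> t \<otimes> h) e))"
    if gh: "g \<in> carrier G" "h \<in> carrier G" and e: "e \<in> E" for g h e
  proof -
    have eV: "e \<in> V" using e E_subset by blast
    have "\<rho> g (A h e) = scale (inverse (of_nat (card H)))
      (\<Sum>t\<in>H. scale (inverse (\<chi> t)) (\<rho> (g \<otimes> t \<otimes> h) e))"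
      unfolding A_def proj_def[of "\<rho> h e"] using gh eV
      by (simp add: rho_scale rho_sum rho_closed V_scale V_sum H_carrier rho_mult)
    then show ?thesis
      unfolding A_def using gh eV
      by (simp add: proj_scale proj_sum rho_closed V_scale V_sum H_carrier)
  qed
  \<comment> \<open>On \<open>H\<close> itself the double coset condition says that \<tau> preserves
    \<open>H\<close> and \<chi>; this permits reindexing the sum over \<open>H\<close> by
    \<tau>.\<close>
  have \<tau>H: "\<tau> t \<in> H" "\<chi> (\<tau> t) = \<chi> t" if t: "t \<in> H" for t
  proof -
    obtain s u where st: "s \<in> H" "u \<in> H" "\<tau> t = s \<otimes> t \<otimes> u" "\<chi> s * \<chi> u = 1"
      using coset[OF H_carrier[OF t]] by blast
    then show "\<tau> t \<in> H" using t subgroup_H by (auto intro: subgroup.m_closed)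
    have "\<chi> (\<tau> t) = \<chi> s * \<chi> t * \<chi> u"
      using st t subgroup_H by (simp add: chi_mult subgroup.m_closed)
    also have "\<dots> = (\<chi> s * \<chi> u) * \<chi> t" by (simp add: mult_ac)
    finally show "\<chi> (\<tau> t) = \<chi> t" using st by simp
  qed
  have inj: "inj_on \<tau> H" using \<tau>(3) H_carrier by (meson inj_on_subset subsetI)
  have bij: "bij_betw \<tau> H H"
    using endo_inj_surj[OF finite_H _ inj] inj \<tau>H(1) by (auto simp: bij_betw_def)
  fix g h e
  assume gh: "g \<in> carrier G" "h \<in> carrier G" and e: "e \<in> E"
  have AE: "A g e \<in> E" if "g \<in> carrier G" "e \<in> E" for g e
    unfolding A_def using that E_subset by (auto intro!: proj_in_E rho_closed)
  have "A g (A h e) = scale (inverse (of_nat (card H)))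
      (\<Sum>t\<in>H. scale (inverse (\<chi> (\<tau> t))) (A (\<tau> h \<otimes> \<tau> t \<otimes> \<tau> g) e))"
  proof -
    have "A (g \<otimes> t \<otimes> h) e = A (\<tau> h \<otimes> \<tau> t \<otimes> \<tau> g) e" if "t \<in> H" for t
    proof -
      have "\<tau> (g \<otimes> t \<otimes> h) = \<tau> h \<otimes> \<tau> t \<otimes> \<tau> g"
        using that gh H_carrier \<tau>(1) by (simp add: \<tau>(2) m_assoc)
      then show ?thesis using A\<tau>[of "g \<otimes> t \<otimes> h" e] that gh e H_carrier by simp
    qed
    then show ?thesis unfolding AA[OF gh e] by (simp add: \<tau>H cong: sum.cong)
  qed
  also have "\<dots> = scale (inverse (of_nat (card H)))
      (\<Sum>t\<in>H. scale (inverse (\<chi> t)) (A (\<tau> h \<otimes> t \<otimes> \<tau> g) e))"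
    by (subst sum.reindex_bij_betw[OF bij, symmetric]) simp
  also have "\<dots> = A (\<tau> h) (A (\<tau> g) e)" using gh e \<tau> by (simp add: AA)
  also have "\<dots> = A h (A g e)" using gh e AE by (simp add: A\<tau>)
  finally show "proj (\<rho> g (proj (\<rho> h e))) = proj (\<rho> h (proj (\<rho> g e)))"
    by (simp add: A_def)
qed

end

section \<open>Polynomials in a matrix\<close>

lemma mult_mat_zero_vec: "M \<in> carrier_mat n m \<Longrightarrow> M *\<^sub>v 0\<^sub>v m = (0\<^sub>v n :: 'a::semiring_0 vec)"
  by (auto simp: scalar_prod_def intro!: eq_vecI)

definition poly_mat :: "'a::comm_ring_1 mat \<Rightarrow> 'a poly \<Rightarrow> 'a mat" where
  "poly_mat A p = fold_coeffs (\<lambda>a M. a \<cdot>\<^sub>m 1\<^sub>m (dim_row A) + A * M) p (0\<^sub>m (dim_row A) (dim_row A))"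

context
  fixes A :: "'a::comm_ring_1 mat" and n
  assumes A [simp]: "A \<in> carrier_mat n n"
begin

lemma dim_A [simp]: "dim_row A = n" "dim_col A = n"
  using carrier_matD[OF A] by auto

lemma A_mult_closed [simp]: "M \<in> carrier_mat n n \<Longrightarrow> A * M \<in> carrier_mat n n"
  by (rule mult_carrier_mat[OF A])

lemma poly_mat_0 [simp]: "poly_mat A 0 = 0\<^sub>m n n"
  using A by (simp add: poly_mat_def)

lemma poly_mat_pCons [simp]: "poly_mat A (pCons a p) = a \<cdot>\<^sub>m 1\<^sub>m n + A * poly_mat A p"
proof -
  have "a \<cdot>\<^sub>m 1\<^sub>m n + A * 0\<^sub>m n n = 0\<^sub>m n n" if "a = 0"
    using that right_mult_zero_mat[OF A, of n] by (auto intro: eq_matI)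
  then show ?thesis
    using A by (cases "a = 0"; cases "p = 0") (auto simp: poly_mat_def)
qed

lemma poly_mat_closed [simp]: "poly_mat A p \<in> carrier_mat n n"
  by (induction p) (auto simp del: A_mult_closed intro!: add_carrier_mat A_mult_closed)

lemma poly_mat_dim [simp]: "dim_row (poly_mat A p) = n" "dim_col (poly_mat A p) = n"
  using carrier_matD[OF poly_mat_closed[of p]] by auto

lemma poly_mat_add: "poly_mat A (p + q) = poly_mat A p + poly_mat A q"
proof (induction p q rule: poly_induct2)
  case (pCons a p b q)
  have "A * (poly_mat A p + poly_mat A q) = A * poly_mat A p + A * poly_mat A q"
    by (rule mult_add_distrib_mat[of _ n n _ n]) auto
  then show ?case using pCons.IH by (simp add: pCons) (auto intro!: eq_matI simp: algebra_simps)
qed simp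

lemma poly_mat_smult: "poly_mat A (Polynomial.smult c p) = c \<cdot>\<^sub>m poly_mat A p"
proof (induction p)
  case (pCons a p)
  have "A * (c \<cdot>\<^sub>m poly_mat A p) = c \<cdot>\<^sub>m (A * poly_mat A p)"
    by (rule mult_smult_distrib[of _ n n _ n]) auto
  then show ?case using pCons.IH by simp (auto intro!: eq_matI simp: algebra_simps)
qed (auto intro: eq_matI)

lemma poly_mat_mult: "poly_mat A (p * q) = poly_mat A p * poly_mat A q"
proof (induction p)
  case 0
  show ?case by (simp add: left_mult_zero_mat[of _ n n])
next
  case (pCons a p)
  have 1: "poly_mat A (pCons a p) * poly_mat A q
      = (a \<cdot>\<^sub>m 1\<^sub>m n) * poly_mat A q + (A * poly_mat A p) * poly_mat A q"
    by (subst poly_mat_pCons, rule add_mult_distrib_mat[of _ n n _ _ n]) auto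
  have 2: "(a \<cdot>\<^sub>m 1\<^sub>m n) * poly_mat A q = a \<cdot>\<^sub>m poly_mat A q"
    by (subst mult_smult_assoc_mat[of _ n n _ n]) auto
  have 3: "(A * poly_mat A p) * poly_mat A q = A * (poly_mat A p * poly_mat A q)"
    by (rule assoc_mult_mat[OF A]) auto
  have 4: "0 \<cdot>\<^sub>m 1\<^sub>m n + A * M = A * M" if "M \<in> carrier_mat n n" for M
    using that by (auto intro: eq_matI)
  have 5: "poly_mat A p * poly_mat A q \<in> carrier_mat n n"
    by (rule mult_carrier_mat[of _ n n]) auto
  show ?case
    unfolding 1 2 3 using pCons.IH by (simp add: poly_mat_add poly_mat_smult 4[OF A_mult_closed[OF 5]] 4[OF 5])
qed

lemma poly_mat_sum_index:
  "r < n \<Longrightarrow> c < n \<Longrightarrow> poly_mat A (\<Sum>i\<in>I. f i) $$ (r, c) = (\<Sum>i\<in>I. poly_mat A (f i) $$ (r, c))"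
  by (induction I rule: infinite_finite_induct) (auto simp: poly_mat_add)

lemma poly_mat_const: "poly_mat A [:a:] = a \<cdot>\<^sub>m 1\<^sub>m n"
  using right_mult_zero_mat[OF A, of n] by simp

lemma poly_mat_X: "poly_mat A [:0, 1:] = A"
proof -
  have "poly_mat A [:0, 1:] = 0 \<cdot>\<^sub>m 1\<^sub>m n + A * poly_mat A [:1:]" by (rule poly_mat_pCons)
  also have "poly_mat A [:1:] = 1\<^sub>m n" unfolding poly_mat_const by (auto intro: eq_matI)
  finally show ?thesis by (auto intro: eq_matI simp: right_mult_one_mat[OF A])
qed

lemma poly_mat_commute: "poly_mat A p * poly_mat A q = poly_mat A q * poly_mat A p"
  by (metis poly_mat_mult mult.commute)

lemma char_poly_matrix_index:
  "k < n \<Longrightarrow> j < n \<Longrightarrow> char_poly_matrix A $$ (k, j) = (if k = j then [:0, 1:] else 0) - [:A $$ (k, j):]"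
  by (auto simp: char_poly_matrix_def)

text \<open>The determinant trick: the transpose of \<open>char_poly_matrix A\<close>, evaluated at
  \<open>A\<close>, kills the tuple of unit vectors, and multiplying by the adjugate leaves
  \<open>char_poly A\<close> evaluated at \<open>A\<close> on each unit vector.\<close>

lemma Cayley_Hamilton: "poly_mat A (char_poly A) = 0\<^sub>m n n"
proof (rule eq_matI)
  fix r c assume rc: "r < dim_row (0\<^sub>m n n :: 'a mat)" "c < dim_col (0\<^sub>m n n :: 'a mat)"
  then have r: "r < n" and c: "c < n" by auto
  let ?M = "char_poly_matrix A"
  let ?D = "adj_mat ?M"
  have M: "?M \<in> carrier_mat n n" by simp
  note adj = adj_mat[OF M]
  \<comment> \<open>This is entry \<open>l\<close> of \<open>A e_j - (\<Sum>k. A_kj e_k)\<close>,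
    which is zero since the sum is column \<open>j\<close> of \<open>A\<close>.\<close>
  have col: "(\<Sum>k<n. poly_mat A (?M $$ (k, j)) $$ (l, k)) = 0" if "j < n" "l < n" for j l
  proof -
    have "poly_mat A (?M $$ (k, j)) $$ (l, k) =
        (if k = j then A $$ (l, k) else 0) - (if k = l then A $$ (k, j) else 0)" if "k < n" for k
    proof -
      have "?M $$ (k, j) = (if k = j then [:0, 1:] else 0) + [:- A $$ (k, j):]"
        using that \<open>j < n\<close> by (simp add: char_poly_matrix_index)
      then have "poly_mat A (?M $$ (k, j)) =
          poly_mat A (if k = j then [:0, 1:] else 0) + poly_mat A [:- A $$ (k, j):]"
        by (simp only: poly_mat_add)
      moreover have "poly_mat A (if k = j then [:0, 1:] else 0) = (if k = j then A else 0\<^sub>m n n)"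
        using poly_mat_X by (simp del: poly_mat_pCons)
      ultimately show ?thesis
        using that \<open>l < n\<close> carrier_matD[OF A] by (simp add: poly_mat_const del: poly_mat_pCons)
    qed
    then have "(\<Sum>k<n. poly_mat A (?M $$ (k, j)) $$ (l, k)) =
        (\<Sum>k<n. if k = j then A $$ (l, k) else 0) - (\<Sum>k<n. if k = l then A $$ (k, j) else 0)"
      by (simp add: sum_subtractf)
    then show ?thesis using that by simp
  qed
  have e: "(if k = c then char_poly A else 0) = (\<Sum>j<n. ?D $$ (j, c) * ?M $$ (k, j))" if "k < n" for k
  proof -
    have "(?M * ?D) $$ (k, c) = (if k = c then char_poly A else 0)"
      using that c by (simp add: adj(2) char_poly_def)
    moreover have "(?M * ?D) $$ (k, c) = (\<Sum>j<n. ?M $$ (k, j) * ?D $$ (j, c))"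
      using that c carrier_matD[OF M] carrier_matD[OF adj(1)] by (auto simp: scalar_prod_def lessThan_atLeast0)
    ultimately show ?thesis by (simp add: mult.commute)
  qed
  have pm: "poly_mat A (p * q) $$ (r, k) = (\<Sum>l<n. poly_mat A p $$ (r, l) * poly_mat A q $$ (l, k))"
    if "k < n" for p q k
    using that r by (auto simp: poly_mat_mult scalar_prod_def lessThan_atLeast0)
  have "poly_mat A (char_poly A) $$ (r, c) =
      (\<Sum>k<n. poly_mat A (if k = c then char_poly A else 0) $$ (r, k))"
  proof -
    have "(\<Sum>k<n. poly_mat A (if k = c then char_poly A else 0) $$ (r, k)) =
        (\<Sum>k<n. if k = c then poly_mat A (char_poly A) $$ (r, c) else 0)"
      using r by (intro sum.cong) auto
    then show ?thesis using c by simp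
  qed
  also have "\<dots> = (\<Sum>k<n. \<Sum>j<n. \<Sum>l<n.
      poly_mat A (?D $$ (j, c)) $$ (r, l) * poly_mat A (?M $$ (k, j)) $$ (l, k))"
    using r by (intro sum.cong refl) (simp add: e poly_mat_sum_index pm)
  also have "\<dots> = (\<Sum>j<n. \<Sum>k<n. \<Sum>l<n.
      poly_mat A (?D $$ (j, c)) $$ (r, l) * poly_mat A (?M $$ (k, j)) $$ (l, k))"
    by (rule sum.swap)
  also have "\<dots> = (\<Sum>j<n. \<Sum>l<n. \<Sum>k<n.
      poly_mat A (?D $$ (j, c)) $$ (r, l) * poly_mat A (?M $$ (k, j)) $$ (l, k))"
    by (intro sum.cong refl sum.swap)
  also have "\<dots> = (\<Sum>j<n. \<Sum>l<n.
      poly_mat A (?D $$ (j, c)) $$ (r, l) * (\<Sum>k<n. poly_mat A (?M $$ (k, j)) $$ (l, k)))"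
    by (simp add: sum_distrib_left)
  also have "\<dots> = 0" by (simp add: col)
  finally show "poly_mat A (char_poly A) $$ (r, c) = 0\<^sub>m n n $$ (r, c)" using r c by simp
qed auto

end

text \<open>For a matrix with irreducible characteristic polynomial, the vector space is a one-dimensional
  vector space over the field of polynomials in the matrix.\<close>

lemma irreducible_char_poly_no_annihilator:
  fixes A :: "'a::field mat"
  assumes A: "A \<in> carrier_mat n n" and irr: "Factorial_Ring.irreducible (char_poly A)"
    and v: "v \<in> carrier_vec n" "v \<noteq> 0\<^sub>v n"
    and p: "p \<noteq> 0" "Polynomial.degree p < n"
  shows "poly_mat A p *\<^sub>v v \<noteq> 0\<^sub>v n"
proof
  assume pv: "poly_mat A p *\<^sub>v v = 0\<^sub>v n"
  note cl = poly_mat_closed[OF A] and dims = poly_mat_dim[OF A]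
  have mul: "poly_mat A (r * s) *\<^sub>v v = poly_mat A r *\<^sub>v (poly_mat A s *\<^sub>v v)" for r s
    unfolding poly_mat_mult[OF A] by (rule assoc_mult_mat_vec[OF cl cl v(1)])
  define Q where "Q q \<longleftrightarrow> q \<noteq> 0 \<and> poly_mat A q *\<^sub>v v = 0\<^sub>v n" for q
  define q where "q = arg_min Polynomial.degree Q"
  have Q: "Q q" and min: "\<And>r. Q r \<Longrightarrow> Polynomial.degree q \<le> Polynomial.degree r"
    unfolding q_def using arg_min_nat_lemma[of Q p Polynomial.degree] p pv by (auto simp: Q_def)
  let ?f = "char_poly A"
  \<comment> \<open>A remainder would annihilate \<open>v\<close> with smaller degree. So
    \<open>q\<close> divides the irreducible \<open>?f\<close>: either \<open>q\<close> is constant,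
    which forces \<open>v\<close> to vanish, or its degree is \<open>n\<close>, more than that of
    \<open>p\<close>.\<close>
  have "?f mod q = 0"
  proof (rule ccontr)
    assume nz: "?f mod q \<noteq> 0"
    have "poly_mat A ?f *\<^sub>v v = 0\<^sub>v n" using v by (auto simp: Cayley_Hamilton[OF A])
    moreover have "poly_mat A ?f *\<^sub>v v = poly_mat A (?f div q * q) *\<^sub>v v + poly_mat A (?f mod q) *\<^sub>v v"
      unfolding add_mult_distrib_mat_vec[OF cl cl v(1), symmetric] poly_mat_add[OF A, symmetric] by simp
    moreover have "poly_mat A (?f div q * q) *\<^sub>v v = 0\<^sub>v n"
      using Q by (simp add: mul Q_def mult_mat_zero_vec[OF cl])
    ultimately have "poly_mat A (?f mod q) *\<^sub>v v = 0\<^sub>v n"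
      using dims by (auto simp: vec_eq_iff)
    then have "Polynomial.degree q \<le> Polynomial.degree (?f mod q)" using nz by (intro min) (simp add: Q_def)
    moreover have "Polynomial.degree (?f mod q) < Polynomial.degree q"
      using degree_mod_less[of q ?f] Q nz by (auto simp: Q_def)
    ultimately show False by simp
  qed
  then obtain s where s: "?f = q * s" by (metis dvdE mod_0_imp_dvd)
  consider "q dvd 1" | "s dvd 1" using irreducibleD[OF irr s] by blast
  then show False
  proof cases
    case 1
    then have "Polynomial.degree q = 0" using Q by (auto simp: is_unit_iff_degree Q_def)
    then obtain a where "q = [:a:]" by (rule degree_eq_zeroE)
    then have a: "q = [:a:]" "a \<noteq> 0" using Q by (auto simp: Q_def)
    then have "poly_mat A q *\<^sub>v v = a \<cdot>\<^sub>v v"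
      using v by (auto simp: poly_mat_const[OF A] smult_scalar_prod_distrib[of _ n] intro!: eq_vecI
          simp del: poly_mat_pCons[OF A])
    with Q have "a \<cdot>\<^sub>v v = 0\<^sub>v n" by (simp add: Q_def)
    then have "v = 0\<^sub>v n" using v a by (auto simp: vec_eq_iff)
    then show False using v by simp
  next
    case 2
    then have "s \<noteq> 0" "Polynomial.degree s = 0" using is_unit_iff_degree[of s] by auto
    moreover have "Polynomial.degree ?f = n" using degree_monic_char_poly[OF A] by simp
    ultimately have "Polynomial.degree q = n" using Q unfolding s by (simp add: degree_mult_eq Q_def)
    moreover have "Polynomial.degree q \<le> Polynomial.degree p" using p pv by (intro min) (simp add: Q_def)
    ultimately show False using p by simp
  qed
qed

text \<open>The matrix on the right has columns \<open>A^i v\<close>; it turns the search for a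
  polynomial in \<open>A\<close> with prescribed value on \<open>v\<close> into a linear
  system.\<close>

lemma poly_mat_monom_sum_mult_vec:
  fixes A :: "'a::comm_ring_1 mat"
  assumes A: "A \<in> carrier_mat n n" and v: "v \<in> carrier_vec n" and w: "w \<in> carrier_vec m"
  shows "poly_mat A (\<Sum>i<m. Polynomial.monom (w $ i) i) *\<^sub>v v
      = mat n m (\<lambda>(r, i). ((A ^\<^sub>m i) *\<^sub>v v) $ r) *\<^sub>v w"
proof (rule eq_vecI)
  note cl = poly_mat_closed[OF A] and dims = poly_mat_dim[OF A]
  have mon: "poly_mat A (Polynomial.monom c i) = c \<cdot>\<^sub>m (A ^\<^sub>m i)" for c i
  proof (induction i)
    case 0
    then show ?case using A by (simp add: Polynomial.monom_0 poly_mat_const[OF A] del: poly_mat_pCons[OF A])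
  next
    case (Suc i)
    have "poly_mat A (Polynomial.monom c (Suc i)) = poly_mat A (Polynomial.monom c i * [:0, 1:])"
      by (simp add: Polynomial.monom_Suc)
    also have "\<dots> = (c \<cdot>\<^sub>m (A ^\<^sub>m i)) * A" unfolding poly_mat_mult[OF A] poly_mat_X[OF A] Suc ..
    also have "\<dots> = c \<cdot>\<^sub>m (A ^\<^sub>m Suc i)" using A by (simp add: mult_smult_assoc_mat[of _ n n])
    finally show ?case .
  qed
  fix r assume r: "r < dim_vec (mat n m (\<lambda>(r, i). ((A ^\<^sub>m i) *\<^sub>v v) $ r) *\<^sub>v w)"
  then have r: "r < n" by simp
  have "(poly_mat A (\<Sum>i<m. Polynomial.monom (w $ i) i) *\<^sub>v v) $ r =
      (\<Sum>k<n. (\<Sum>i<m. w $ i * (A ^\<^sub>m i) $$ (r, k)) * v $ k)"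
    using r v A by (simp add: scalar_prod_def dims lessThan_atLeast0 poly_mat_sum_index[OF A] mon)
  also have "\<dots> = (\<Sum>k<n. \<Sum>i<m. w $ i * (A ^\<^sub>m i) $$ (r, k) * v $ k)"
    by (simp add: sum_distrib_right)
  also have "\<dots> = (\<Sum>i<m. \<Sum>k<n. w $ i * (A ^\<^sub>m i) $$ (r, k) * v $ k)" by (rule sum.swap)
  also have "\<dots> = (\<Sum>i<m. (\<Sum>k<n. (A ^\<^sub>m i) $$ (r, k) * v $ k) * w $ i)"
    by (simp add: sum_distrib_left sum_distrib_right mult_ac)
  also have "\<dots> = (mat n m (\<lambda>(r, i). ((A ^\<^sub>m i) *\<^sub>v v) $ r) *\<^sub>v w) $ r"
    using r v w A by (simp add: scalar_prod_def lessThan_atLeast0)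
  finally show "(poly_mat A (\<Sum>i<m. Polynomial.monom (w $ i) i) *\<^sub>v v) $ r =
      (mat n m (\<lambda>(r, i). ((A ^\<^sub>m i) *\<^sub>v v) $ r) *\<^sub>v w) $ r" .
qed (use A in \<open>simp add: poly_mat_dim[OF A]\<close>)

text \<open>A nonzero vector \<open>e\<close> is cyclic, so \<open>g e = p(A) e\<close> for some
  \<open>p\<close>. As \<open>g\<close> commutes with \<open>A\<close> and every vector is a
  polynomial in \<open>A\<close> applied to \<open>e\<close>, the two sides agree
  everywhere.\<close>

lemma irreducible_char_poly_centralizer:
  fixes A :: "'a::field mat"
  assumes A: "A \<in> carrier_mat n n" and irr: "Factorial_Ring.irreducible (char_poly A)"
    and g: "g \<in> carrier_mat n n" "g * A = A * g"
  shows "\<exists>p. (p = 0 \<or> Polynomial.degree p < n) \<and> g = poly_mat A p"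
proof (cases "n = 0")
  case True
  then show ?thesis using g A by (intro exI[of _ 0]) (auto intro: eq_matI)
next
  case False
  note cl = poly_mat_closed[OF A] and dims = poly_mat_dim[OF A]
  define e :: "'a vec" where "e = unit_vec n 0"
  have e: "e \<in> carrier_vec n" "e \<noteq> 0\<^sub>v n" using False by (auto simp: e_def vec_eq_iff unit_vec_def)
  define C where "C = mat n n (\<lambda>(r, i). ((A ^\<^sub>m i) *\<^sub>v e) $ r)"
  have C: "C \<in> carrier_mat n n" by (simp add: C_def)
  define P where "P w = (\<Sum>i<n. Polynomial.monom (w $ i) i)" for w :: "'a vec"
  have Pe: "poly_mat A (P w) *\<^sub>v e = C *\<^sub>v w" if "w \<in> carrier_vec n" for w
    unfolding P_def C_def by (rule poly_mat_monom_sum_mult_vec[OF A e(1) that])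
  have Pdeg: "P w = 0 \<or> Polynomial.degree (P w) < n" for w
  proof -
    have "Polynomial.degree (P w) \<le> n - 1"
      unfolding P_def by (intro degree_sum_le) (auto intro: order.trans[OF degree_monom_le])
    then show ?thesis using False by auto
  qed
  \<comment> \<open>A kernel vector would be the coefficient vector of a nonzero polynomial of
    degree below \<open>n\<close> annihilating \<open>e\<close>.\<close>
  have "det C \<noteq> 0"
  proof
    assume "det C = 0"
    then obtain w where w: "w \<in> carrier_vec n" "w \<noteq> 0\<^sub>v n" "C *\<^sub>v w = 0\<^sub>v n"
      using det_0_iff_vec_prod_zero[OF C] by blast
    then obtain i where i: "i < n" "w $ i \<noteq> 0" by (auto simp: vec_eq_iff)
    have "Polynomial.coeff (P w) i = w $ i" using i by (simp add: P_def coeff_sum)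
    then have "P w \<noteq> 0" using i by auto
    with irreducible_char_poly_no_annihilator[OF A irr e, of "P w"] Pdeg[of w] Pe[OF w(1)] w
    show False by auto
  qed
  then obtain D where D: "D \<in> carrier_mat n n" "C * D = 1\<^sub>m n"
    using det_non_zero_imp_unit[OF C, of "()"] by (auto simp: Units_def ring_mat_simps)
  define w where "w = D *\<^sub>v (g *\<^sub>v e)"
  have w: "w \<in> carrier_vec n" unfolding w_def using D g e by (intro mult_mat_vec_carrier)
  have "C *\<^sub>v w = g *\<^sub>v e"
    unfolding w_def using assoc_mult_mat_vec[OF C D(1), of "g *\<^sub>v e"] D g e by simp
  then have ge: "g *\<^sub>v e = poly_mat A (P w) *\<^sub>v e" using Pe[OF w] by simp
  have "g *\<^sub>v u = poly_mat A (P w) *\<^sub>v u" if u: "u \<in> carrier_vec n" for u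
  proof -
    define c where "c = D *\<^sub>v u"
    have c: "c \<in> carrier_vec n" unfolding c_def using D u by (intro mult_mat_vec_carrier)
    have "C *\<^sub>v c = u" unfolding c_def using assoc_mult_mat_vec[OF C D(1) u] D u by simp
    then have u: "u = poly_mat A (P c) *\<^sub>v e" using Pe[OF c] by simp
    have gA: "g * poly_mat A p = poly_mat A p * g" for p
    proof (induction p)
      case 0
      then show ?case using g A by simp
    next
      case (pCons a p)
      have "g * (a \<cdot>\<^sub>m 1\<^sub>m n + A * poly_mat A p) = g * (a \<cdot>\<^sub>m 1\<^sub>m n) + g * (A * poly_mat A p)"
        by (rule mult_add_distrib_mat[of _ n n _ n]) (use g A cl in auto)
      also have "g * (A * poly_mat A p) = (A * g) * poly_mat A p"
        using assoc_mult_mat[OF g(1) A cl[of p]] g(2) by simp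
      also have "\<dots> = (A * poly_mat A p) * g"
        using assoc_mult_mat[OF A g(1) cl[of p]] assoc_mult_mat[OF A cl[of p] g(1)] pCons.IH by simp
      also have "g * (a \<cdot>\<^sub>m 1\<^sub>m n) = (a \<cdot>\<^sub>m 1\<^sub>m n) * g"
        using g mult_smult_distrib[OF g(1), of "1\<^sub>m n" n a] mult_smult_assoc_mat[of "1\<^sub>m n" n n g n a] by simp
      also have "(a \<cdot>\<^sub>m 1\<^sub>m n) * g + (A * poly_mat A p) * g = (a \<cdot>\<^sub>m 1\<^sub>m n + A * poly_mat A p) * g"
        by (rule add_mult_distrib_mat[of _ n n _ _ n, symmetric]) (use g A cl in auto)
      finally show ?case using A by simp
    qed
    have "g *\<^sub>v u = poly_mat A (P c) *\<^sub>v (g *\<^sub>v e)"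
      unfolding u using assoc_mult_mat_vec[OF g(1) cl e(1)] assoc_mult_mat_vec[OF cl g(1) e(1)] gA by simp
    also have "\<dots> = poly_mat A (P w) *\<^sub>v u"
      unfolding ge u
      using assoc_mult_mat_vec[OF cl cl e(1), of "P c" "P w"] assoc_mult_mat_vec[OF cl cl e(1), of "P w" "P c"]
        poly_mat_commute[OF A, of "P c" "P w"] by simp
    finally show ?thesis .
  qed
  note gu = this
  have "g = poly_mat A (P w)"
  proof (rule eq_matI)
    fix i j assume "i < dim_row (poly_mat A (P w))" "j < dim_col (poly_mat A (P w))"
    then have ij: "i < n" "j < n" by (auto simp: dims)
    have "(g *\<^sub>v unit_vec n j) $ i = (poly_mat A (P w) *\<^sub>v unit_vec n j) $ i"
      using gu[of "unit_vec n j"] by simp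
    then show "g $$ (i, j) = poly_mat A (P w) $$ (i, j)"
      using ij g cl[of "P w"] by (simp add: mult_mat_vec_def scalar_prod_right_unit dims)
  qed (use g dims in auto)
  then show ?thesis using Pdeg by blast
qed

lemma irreducible_char_poly_singular_centralizer:
  fixes A :: "'a::field mat"
  assumes A: "A \<in> carrier_mat n n" and irr: "Factorial_Ring.irreducible (char_poly A)"
    and g: "g \<in> carrier_mat n n" "g * A = A * g"
    and v: "v \<in> carrier_vec n" "v \<noteq> 0\<^sub>v n" "g *\<^sub>v v = 0\<^sub>v n"
  shows "g = 0\<^sub>m n n"
proof -
  obtain p where p: "p = 0 \<or> Polynomial.degree p < n" "g = poly_mat A p"
    using irreducible_char_poly_centralizer[OF A irr g] by blast
  then show ?thesis
    using irreducible_char_poly_no_annihilator[OF A irr v(1,2), of p] v(3) poly_mat_0[OF A] by auto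
qed

section \<open>Pairs of two by two matrices\<close>

lemma less_2_iff: "i < (2::nat) \<longleftrightarrow> i = 0 \<or> i = 1"
  by auto

lemma mat2_eq_iff:
  "A \<in> carrier_mat 2 2 \<Longrightarrow> B \<in> carrier_mat 2 2 \<Longrightarrow> A = B \<longleftrightarrow>
    A $$ (0,0) = B $$ (0,0) \<and> A $$ (0,1) = B $$ (0,1) \<and> A $$ (1,0) = B $$ (1,0) \<and> A $$ (1,1) = B $$ (1,1)"
  by (auto simp: mat_eq_iff less_2_iff)

lemma mat2_mult_index:
  fixes A :: "'a::semiring_0 mat"
  shows "A \<in> carrier_mat 2 2 \<Longrightarrow> B \<in> carrier_mat 2 2 \<Longrightarrow> i < 2 \<Longrightarrow> j < 2 \<Longrightarrow>
    (A * B) $$ (i, j) = A $$ (i,0) * B $$ (0,j) + A $$ (i,1) * B $$ (1,j)"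
  by (auto simp: scalar_prod_def numeral_2_eq_2)

lemma mat2_mult_vec_index:
  fixes A :: "'a::semiring_0 mat"
  shows "A \<in> carrier_mat 2 2 \<Longrightarrow> v \<in> carrier_vec 2 \<Longrightarrow> i < 2 \<Longrightarrow>
    (A *\<^sub>v v) $ i = A $$ (i,0) * v $ 0 + A $$ (i,1) * v $ 1"
  by (auto simp: scalar_prod_def numeral_2_eq_2)

lemma vec2_eq_iff: "v \<in> carrier_vec 2 \<Longrightarrow> w \<in> carrier_vec 2 \<Longrightarrow> v = w \<longleftrightarrow> v $ 0 = w $ 0 \<and> v $ 1 = w $ 1"
  by (auto simp: vec_eq_iff less_2_iff)

lemma mat_tr_2: "A \<in> carrier_mat 2 2 \<Longrightarrow> mat_tr A = A $$ (0,0) + A $$ (1,1)"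
  by (auto simp: mat_tr_def numeral_2_eq_2)

lemma det_mat2: "A \<in> carrier_mat 2 2 \<Longrightarrow> det A = A $$ (0,0) * A $$ (1,1) - A $$ (0,1) * A $$ (1,0)"
proof -
  assume A: "A \<in> carrier_mat 2 2"
  have 1: "det B = B $$ (0,0)" if "B \<in> carrier_mat 1 1" for B :: "'a mat"
    using that by (subst laplace_expansion_column[of _ 1 0]) (auto simp: cofactor_def mat_delete_def)
  show ?thesis
    using A by (subst laplace_expansion_column[of _ 2 0])
      (auto simp: cofactor_def mat_delete_def numeral_2_eq_2 1)
qed

lemma smult_one_mult_vec:
  "v \<in> carrier_vec n \<Longrightarrow> (a \<cdot>\<^sub>m 1\<^sub>m n) *\<^sub>v v = a \<cdot>\<^sub>v (v :: 'a::comm_ring_1 vec)"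
  by (intro eq_vecI) (auto simp: smult_scalar_prod_distrib[of _ n])

text \<open>In dimension two a proper nonzero subspace stable under \<open>b\<close> and
  \<open>d\<close> is a line of common eigenvectors, so this is irreducibility of the pair over the
  given field.\<close>

definition common_eigenvector_free :: "'a::field mat \<Rightarrow> 'a mat \<Rightarrow> bool" where
  "common_eigenvector_free b d \<longleftrightarrow>
    (\<forall>k\<in>carrier_vec 2. k \<noteq> 0\<^sub>v 2 \<longrightarrow> \<not> (\<exists>\<beta> \<delta>. b *\<^sub>v k = \<beta> \<cdot>\<^sub>v k \<and> d *\<^sub>v k = \<delta> \<cdot>\<^sub>v k))"

lemma kernel_line_2:
  fixes s :: "'a::field mat"
  assumes s: "s \<in> carrier_mat 2 2" "s \<noteq> 0\<^sub>m 2 2"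
    and k: "k \<in> carrier_vec 2" "k \<noteq> 0\<^sub>v 2" "s *\<^sub>v k = 0\<^sub>v 2"
    and m: "m \<in> carrier_vec 2" "s *\<^sub>v m = 0\<^sub>v 2"
  shows "\<exists>\<beta>. m = \<beta> \<cdot>\<^sub>v k"
proof -
  have ker: "s $$ (i,0) * k $ 0 + s $$ (i,1) * k $ 1 = 0" "s $$ (i,0) * m $ 0 + s $$ (i,1) * m $ 1 = 0"
    if "i < 2" for i
    using that mat2_mult_vec_index[OF s(1) k(1) that] mat2_mult_vec_index[OF s(1) m(1) that] k(3) m(2) by simp_all
  have "\<exists>i<2. s $$ (i,0) \<noteq> 0 \<or> s $$ (i,1) \<noteq> 0"
    using s by (rule_tac ccontr) (auto simp: mat2_eq_iff[OF s(1)])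
  then obtain i where i: "i < 2" "s $$ (i,0) \<noteq> 0 \<or> s $$ (i,1) \<noteq> 0" by blast
  have e: "s $$ (i,0) * (k $ 0 * m $ 1 - k $ 1 * m $ 0) = 0" "s $$ (i,1) * (k $ 0 * m $ 1 - k $ 1 * m $ 0) = 0"
    using ker[OF i(1)] by - (Groebner_Basis.algebra, Groebner_Basis.algebra)
  then have d: "k $ 0 * m $ 1 = k $ 1 * m $ 0" using i(2) by auto
  have "k $ 0 \<noteq> 0 \<or> k $ 1 \<noteq> 0" using k by (auto simp: vec2_eq_iff[OF k(1)])
  then show ?thesis
  proof
    assume "k $ 0 \<noteq> 0"
    then show ?thesis using d k m
      by (intro exI[of _ "m $ 0 / k $ 0"]) (auto simp: vec2_eq_iff field_simps)
  next
    assume "k $ 1 \<noteq> 0"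
    then show ?thesis using d k m
      by (intro exI[of _ "m $ 1 / k $ 1"]) (auto simp: vec2_eq_iff field_simps)
  qed
qed

text \<open>The kernel of an intertwiner is stable under \<open>b\<close> and \<open>d\<close>.\<close>

lemma intertwiner_det_nonzero:
  fixes s :: "'a::field mat"
  assumes c: "s \<in> carrier_mat 2 2" "b \<in> carrier_mat 2 2" "b' \<in> carrier_mat 2 2" "d \<in> carrier_mat 2 2"
    and nz: "s \<noteq> 0\<^sub>m 2 2" and b: "s * b = b' * s" and d: "s * d = d * s"
    and free: "common_eigenvector_free b d"
  shows "det s \<noteq> 0"
proof
  assume "det s = 0"
  then obtain k where k: "k \<in> carrier_vec 2" "k \<noteq> 0\<^sub>v 2" "s *\<^sub>v k = 0\<^sub>v 2"
    using det_0_iff_vec_prod_zero[OF c(1)] by blast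
  have "s *\<^sub>v (b *\<^sub>v k) = 0\<^sub>v 2"
    using assoc_mult_mat_vec[OF c(1,2) k(1)] assoc_mult_mat_vec[OF c(3,1) k(1)] b k(3)
      mult_mat_zero_vec[OF c(3)] by simp
  moreover have "s *\<^sub>v (d *\<^sub>v k) = 0\<^sub>v 2"
    using assoc_mult_mat_vec[OF c(1,4) k(1)] assoc_mult_mat_vec[OF c(4,1) k(1)] d k(3)
      mult_mat_zero_vec[OF c(4)] by simp
  ultimately have "\<exists>\<beta>. b *\<^sub>v k = \<beta> \<cdot>\<^sub>v k" "\<exists>\<delta>. d *\<^sub>v k = \<delta> \<cdot>\<^sub>v k"
    using kernel_line_2[OF c(1) nz k] mult_mat_vec_carrier[OF c(2) k(1)] mult_mat_vec_carrier[OF c(4) k(1)]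
    by blast+
  then show False using free k by (auto simp: common_eigenvector_free_def)
qed

definition nonscalar :: "'a::zero mat \<Rightarrow> bool" where
  "nonscalar d \<longleftrightarrow> d $$ (0,1) \<noteq> 0 \<or> d $$ (1,0) \<noteq> 0 \<or> d $$ (0,0) \<noteq> d $$ (1,1)"

lemma scalar_mat2: "d \<in> carrier_mat 2 2 \<Longrightarrow> \<not> nonscalar d \<Longrightarrow> d = d $$ (0,0) \<cdot>\<^sub>m (1\<^sub>m 2 :: 'a::comm_ring_1 mat)"
  by (auto simp: nonscalar_def mat2_eq_iff)

text \<open>In the notation of \<open>intertwiner_nonscalar\<close>, with \<open>a\<close> for the
  entries of \<open>b\<close> and \<open>b\<close> for those of \<open>b'\<close>, these are the six
  two by two minors of the array with rows \<open>e\<close> and \<open>M\<close>. Their vanishing is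
  a polynomial consequence of the three hypotheses.\<close>

lemma proportional_scalars:
  fixes d0 :: "'a::field"
  assumes "a0 + a3 = b0 + b3" "d0*a0 + d1*a2 + (d2*a1 + d3*a3) = d0*b0 + d1*b2 + (d2*b1 + d3*b3)"
    "a0*a3 - a1*a2 = b0*b3 - b1*b2"
  shows "(b0-a0) * (d0*a1+d1*a3 - (b0*d1+b1*d3)) = (d0*a0+d1*a2 - (b0*d0+b1*d2)) * (b1-a1)"
    "(b0-a0) * (d2*a0+d3*a2 - (b2*d0+b3*d2)) = (d0*a0+d1*a2 - (b0*d0+b1*d2)) * (b2-a2)"
    "(b0-a0) * (d2*a1+d3*a3 - (b2*d1+b3*d3)) = (d0*a0+d1*a2 - (b0*d0+b1*d2)) * (b3-a3)"
    "(b1-a1) * (d2*a0+d3*a2 - (b2*d0+b3*d2)) = (d0*a1+d1*a3 - (b0*d1+b1*d3)) * (b2-a2)"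
    "(b1-a1) * (d2*a1+d3*a3 - (b2*d1+b3*d3)) = (d0*a1+d1*a3 - (b0*d1+b1*d3)) * (b3-a3)"
    "(b2-a2) * (d2*a1+d3*a3 - (b2*d1+b3*d3)) = (d2*a0+d3*a2 - (b2*d0+b3*d2)) * (b3-a3)"
  using assms
  by - (Groebner_Basis.algebra, Groebner_Basis.algebra, Groebner_Basis.algebra, Groebner_Basis.algebra,
      Groebner_Basis.algebra, Groebner_Basis.algebra)

text \<open>With \<open>e = b' - b\<close> and \<open>M = d b - b' d\<close>, the element \<open>u + v d\<close> intertwines \<open>b\<close> and \<open>b'\<close> iff
  \<open>u e = v M\<close>. The hypotheses on traces and determinants say that \<open>e\<close> and \<open>M\<close> are proportional.\<close>

lemma intertwiner_nonscalar:
  fixes b :: "'a::field mat"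
  assumes c: "b \<in> carrier_mat 2 2" "b' \<in> carrier_mat 2 2" "d \<in> carrier_mat 2 2"
    and ns: "nonscalar d"
    and tr: "mat_tr b = mat_tr b'" "mat_tr (d * b) = mat_tr (d * b')" and det: "det b = det b'"
  shows "\<exists>u v. u \<cdot>\<^sub>m 1\<^sub>m 2 + v \<cdot>\<^sub>m d \<noteq> 0\<^sub>m 2 2 \<and>
     (u \<cdot>\<^sub>m 1\<^sub>m 2 + v \<cdot>\<^sub>m d) * b = b' * (u \<cdot>\<^sub>m 1\<^sub>m 2 + v \<cdot>\<^sub>m d)"
proof (cases "b = b'")
  case True
  have one: "1 \<cdot>\<^sub>m 1\<^sub>m 2 + 0 \<cdot>\<^sub>m d = 1\<^sub>m 2" using c by (auto simp: mat2_eq_iff)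
  have "1\<^sub>m 2 \<noteq> (0\<^sub>m 2 2 :: 'a mat)" by (auto simp: mat2_eq_iff)
  then have "1 \<cdot>\<^sub>m 1\<^sub>m 2 + 0 \<cdot>\<^sub>m d \<noteq> 0\<^sub>m 2 2 \<and> (1 \<cdot>\<^sub>m 1\<^sub>m 2 + 0 \<cdot>\<^sub>m d) * b = b' * (1 \<cdot>\<^sub>m 1\<^sub>m 2 + 0 \<cdot>\<^sub>m d)"
    unfolding one using c True by simp
  then show ?thesis by blast
next
  case False
  have dc: "d * b \<in> carrier_mat 2 2" "d * b' \<in> carrier_mat 2 2" using c by auto
  define M where "M i j = d $$ (i,0) * b $$ (0,j) + d $$ (i,1) * b $$ (1,j)
       - (b' $$ (i,0) * d $$ (0,j) + b' $$ (i,1) * d $$ (1,j))" for i j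
  define e where "e i j = b' $$ (i, j) - b $$ (i, j)" for i j
  have h: "b $$ (0,0) + b $$ (1,1) = b' $$ (0,0) + b' $$ (1,1)"
    "d $$ (0,0) * b $$ (0,0) + d $$ (0,1) * b $$ (1,0) + (d $$ (1,0) * b $$ (0,1) + d $$ (1,1) * b $$ (1,1)) =
     d $$ (0,0) * b' $$ (0,0) + d $$ (0,1) * b' $$ (1,0) + (d $$ (1,0) * b' $$ (0,1) + d $$ (1,1) * b' $$ (1,1))"
    "b $$ (0,0) * b $$ (1,1) - b $$ (0,1) * b $$ (1,0) = b' $$ (0,0) * b' $$ (1,1) - b' $$ (0,1) * b' $$ (1,0)"
    using tr det c dc by (simp_all add: mat_tr_2 det_mat2 mat2_mult_index del: index_mult_mat(1))
  have proportional: "e i j * M k l = M i j * e k l" if ij: "i < 2" "j < 2" "k < 2" "l < 2" for i j k l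
    using ij unfolding M_def e_def less_2_iff
    by - (elim disjE; hypsubst; (rule proportional_scalars[OF h] | rule mult.commute |
        (rule trans[OF mult.commute], rule trans[OF _ mult.commute], rule proportional_scalars[OF h, symmetric])))
  have "\<exists>i<2. \<exists>j<2. e i j \<noteq> 0"
    using False c by (rule_tac ccontr) (auto simp: mat2_eq_iff[OF c(1,2)] e_def)
  then obtain i j where ij: "i < 2" "j < 2" "e i j \<noteq> 0" by blast
  \<comment> \<open>A nonzero entry of \<open>e\<close> as pivot gives the ratio of \<open>M\<close>
    to \<open>e\<close>. Because \<open>?v\<close> is nonzero and \<open>d\<close> is not scalar,
    \<open>?s\<close> cannot vanish.\<close>
  let ?u = "M i j" and ?v = "e i j"
  let ?s = "?u \<cdot>\<^sub>m 1\<^sub>m 2 + ?v \<cdot>\<^sub>m d"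
  have s: "?s \<in> carrier_mat 2 2" using c by simp
  have "?s \<noteq> 0\<^sub>m 2 2"
  proof
    assume z: "?s = 0\<^sub>m 2 2"
    have "?v * d $$ (0,1) = 0" "?v * d $$ (1,0) = 0" "?u + ?v * d $$ (0,0) = 0" "?u + ?v * d $$ (1,1) = 0"
      using z c by (simp_all add: mat2_eq_iff[OF s zero_carrier_mat])
    moreover from this have "?v * (d $$ (0,0) - d $$ (1,1)) = 0" by - Groebner_Basis.algebra
    ultimately show False using ns ij(3) by (auto simp: nonscalar_def)
  qed
  moreover have "?s * b = b' * ?s"
  proof (rule eq_matI)
    fix k l assume "k < dim_row (b' * ?s)" "l < dim_col (b' * ?s)"
    then have kl: "k < 2" "l < 2" using c by auto
    have s4: "?s $$ (0,0) = ?u + ?v * d $$ (0,0)" "?s $$ (0,1) = ?v * d $$ (0,1)"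
        "?s $$ (1,0) = ?v * d $$ (1,0)" "?s $$ (1,1) = ?u + ?v * d $$ (1,1)"
      using c by simp_all
    have "(?s * b) $$ (k, l) - (b' * ?s) $$ (k, l) = ?v * M k l - ?u * e k l"
      unfolding mat2_mult_index[OF s c(1) kl] mat2_mult_index[OF c(2) s kl] M_def[of k l] e_def[of k l]
      using kl unfolding less_2_iff by (elim disjE; simp only: s4; simp add: algebra_simps)
    then show "(?s * b) $$ (k, l) = (b' * ?s) $$ (k, l)" using proportional[OF ij(1,2) kl] by simp
  qed (use c in auto)
  ultimately show ?thesis by blast
qed

text \<open>The entries of \<open>s b = b' s\<close> for the matrix
  \<open>s = b' h + h b - t h\<close> of \<open>intertwiner_scalar\<close>, with \<open>a\<close>
  for \<open>b\<close>, \<open>c\<close> for \<open>b'\<close> and \<open>t\<close> the common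
  trace.\<close>

lemma intertwiner_scalars:
  fixes a0 :: "'a::field"
  assumes "a0+a3 = c0+c3" "a0*a3-a1*a2 = c0*c3-c1*c2"
  shows "(c0*h0+c1*h2+(h0*a0+h1*a2)-(a0+a3)*h0)*a0+(c0*h1+c1*h3+(h0*a1+h1*a3)-(a0+a3)*h1)*a2 = c0*(c0*h0+c1*h2+(h0*a0+h1*a2)-(a0+a3)*h0)+c1*(c2*h0+c3*h2+(h2*a0+h3*a2)-(a0+a3)*h2)"
    "(c0*h0+c1*h2+(h0*a0+h1*a2)-(a0+a3)*h0)*a1+(c0*h1+c1*h3+(h0*a1+h1*a3)-(a0+a3)*h1)*a3 = c0*(c0*h1+c1*h3+(h0*a1+h1*a3)-(a0+a3)*h1)+c1*(c2*h1+c3*h3+(h2*a1+h3*a3)-(a0+a3)*h3)"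
    "(c2*h0+c3*h2+(h2*a0+h3*a2)-(a0+a3)*h2)*a0+(c2*h1+c3*h3+(h2*a1+h3*a3)-(a0+a3)*h3)*a2 = c2*(c0*h0+c1*h2+(h0*a0+h1*a2)-(a0+a3)*h0)+c3*(c2*h0+c3*h2+(h2*a0+h3*a2)-(a0+a3)*h2)"
    "(c2*h0+c3*h2+(h2*a0+h3*a2)-(a0+a3)*h2)*a1+(c2*h1+c3*h3+(h2*a1+h3*a3)-(a0+a3)*h3)*a3 = c2*(c0*h1+c1*h3+(h0*a1+h1*a3)-(a0+a3)*h1)+c3*(c2*h1+c3*h3+(h2*a1+h3*a3)-(a0+a3)*h3)"
  using assms
  by - (Groebner_Basis.algebra, Groebner_Basis.algebra, Groebner_Basis.algebra, Groebner_Basis.algebra)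

text \<open>By Cayley-Hamilton \<open>b\<close> and \<open>b'\<close> satisfy the same quadratic
  equation, so \<open>b' h + h b - t h\<close> is an intertwiner for every \<open>h\<close>. If all
  of these vanished, taking \<open>h\<close> elementary would make \<open>b\<close> scalar.\<close>

lemma intertwiner_scalar:
  fixes b :: "'a::field mat"
  assumes c: "b \<in> carrier_mat 2 2" "b' \<in> carrier_mat 2 2"
    and ns: "nonscalar b"
    and tr: "mat_tr b = mat_tr b'" and det: "det b = det b'"
  shows "\<exists>s\<in>carrier_mat 2 2. s \<noteq> 0\<^sub>m 2 2 \<and> s * b = b' * s"
proof (rule ccontr)
  assume contr: "\<not> ?thesis"
  let ?t = "mat_tr b"
  have one_less_2: "1 < (2::nat)" by simp
  have h: "b $$ (0,0) + b $$ (1,1) = b' $$ (0,0) + b' $$ (1,1)"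
    "b $$ (0,0) * b $$ (1,1) - b $$ (0,1) * b $$ (1,0) = b' $$ (0,0) * b' $$ (1,1) - b' $$ (0,1) * b' $$ (1,0)"
    using tr det c by (simp_all add: mat_tr_2 det_mat2)
  have z: "b' * h + h * b - ?t \<cdot>\<^sub>m h = 0\<^sub>m 2 2" if hc: "h \<in> carrier_mat 2 2" for h
  proof -
    let ?s = "b' * h + h * b - ?t \<cdot>\<^sub>m h"
    have s: "?s \<in> carrier_mat 2 2" using c hc by auto
    have si: "?s $$ (k, l) = b' $$ (k,0) * h $$ (0,l) + b' $$ (k,1) * h $$ (1,l) +
        (h $$ (k,0) * b $$ (0,l) + h $$ (k,1) * b $$ (1,l)) - (b $$ (0,0) + b $$ (1,1)) * h $$ (k,l)"
      if "k < 2" "l < 2" for k l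
      using that c hc by (simp add: mat2_mult_index mat_tr_2 del: index_mult_mat(1))
    note s4 = si[OF pos2 pos2] si[OF pos2 one_less_2] si[OF one_less_2 pos2] si[OF one_less_2 one_less_2]
    have "?s * b = b' * ?s"
    proof (rule eq_matI)
      fix k l assume "k < dim_row (b' * ?s)" "l < dim_col (b' * ?s)"
      then have kl: "k < 2" "l < 2" using c hc by auto
      show "(?s * b) $$ (k, l) = (b' * ?s) $$ (k, l)"
        unfolding mat2_mult_index[OF s c(1) kl] mat2_mult_index[OF c(2) s kl]
        using kl unfolding less_2_iff by - (elim disjE; hypsubst; unfold s4; rule intertwiner_scalars[OF h])
    qed (use c hc in auto)
    then show ?thesis using contr s by blast
  qed
  define E where "E i j = mat 2 2 (\<lambda>p. if p = (i, j) then 1 else 0 :: 'a)" for i j :: nat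
  have E: "E i j \<in> carrier_mat 2 2" for i j by (simp add: E_def)
  have "(b' * h + h * b - ?t \<cdot>\<^sub>m h) $$ (k, l) = 0" if "h \<in> carrier_mat 2 2" "k < 2" "l < 2" for h k l
    using z[OF that(1)] that by simp
  then have zi: "b' $$ (k,0) * h $$ (0,l) + b' $$ (k,1) * h $$ (1,l) +
      (h $$ (k,0) * b $$ (0,l) + h $$ (k,1) * b $$ (1,l)) - (b $$ (0,0) + b $$ (1,1)) * h $$ (k,l) = 0"
    if "h \<in> carrier_mat 2 2" "k < 2" "l < 2" for h k l
    using that c by (simp add: mat2_mult_index mat_tr_2 del: index_mult_mat(1))
  have "b $$ (1,0) = 0" "b $$ (0,1) = 0"
    using zi[OF E[of 0 1], of 0 0] zi[OF E[of 1 0], of 1 1] by (simp_all add: E_def)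
  moreover have "b' $$ (0,0) = b $$ (0,0)" "b' $$ (0,0) = b $$ (1,1)"
    using zi[OF E[of 0 1], of 0 1] zi[OF E[of 0 0], of 0 0] by (simp_all add: E_def)
  ultimately show False using ns by (auto simp: nonscalar_def)
qed

section \<open>Block companion matrices\<close>

text \<open>The companion matrix of the matrix polynomial \<open>X^2 - d X - b\<close>. A matrix
  with lower left block 1 has exactly one conjugate under \<open>N\<close> of this shape.\<close>

definition block_companion :: "'a::comm_ring_1 mat \<Rightarrow> 'a mat \<Rightarrow> 'a mat" where
  "block_companion b d = four_block_mat (0\<^sub>m 2 2) b (1\<^sub>m 2) d"

lemma block_companion_closed [simp]:
  "b \<in> carrier_mat 2 2 \<Longrightarrow> d \<in> carrier_mat 2 2 \<Longrightarrow> block_companion b d \<in> carrier_mat 4 4"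
  using four_block_carrier_mat[of "0\<^sub>m 2 2" 2 2 d 2 2 b "1\<^sub>m 2"] by (simp add: block_companion_def)

text \<open>The two lower blocks of the characteristic matrix commute, so its determinant is that of
  \<open>X^2 - d X - b\<close>. For given \<open>d\<close>, the coefficients yield
  \<open>tr b\<close>, \<open>tr (d b)\<close> and \<open>det b\<close>.\<close>

lemma char_poly_block_companion:
  fixes b d :: "'a::idom mat"
  assumes b: "b \<in> carrier_mat 2 2" and d: "d \<in> carrier_mat 2 2"
  shows "char_poly (block_companion b d) =
    [:det b, mat_tr b * mat_tr d - mat_tr (d * b), det d - mat_tr b, - mat_tr d, 1:]"
proof -
  let ?l = "[:0, 1:] :: 'a poly"
  let ?A = "?l \<cdot>\<^sub>m 1\<^sub>m 2 :: 'a poly mat" and ?B = "map_mat (\<lambda>a. [:-a:]) b"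
  let ?C = "[:-1:] \<cdot>\<^sub>m 1\<^sub>m 2 :: 'a poly mat" and ?D = "char_poly_matrix d"
  have D: "?D \<in> carrier_mat 2 2" using d by simp
  have CD: "?C * ?D = ?D * ?C"
    using mult_smult_assoc_mat[of "1\<^sub>m 2" 2 2 ?D 2 "[:-1:]"] mult_smult_distrib[OF D, of "1\<^sub>m 2" 2 "[:-1:]"] D
    by simp
  have "char_poly_matrix (block_companion b d) = four_block_mat ?A ?B ?C ?D"
    using b d by (intro eq_matI) (auto simp: char_poly_matrix_def block_companion_def one_pCons)
  then have "char_poly (block_companion b d) = det (?A * ?D - ?B * ?C)"
    unfolding char_poly_def using b D CD by (simp add: det_four_block_mat[of _ 2])
  also have "?A * ?D - ?B * ?C = mat 2 2 (\<lambda>(i, j). [:- (b $$ (i,j)), - (d $$ (i,j)), if i = j then 1 else 0:])"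
    (is "_ = ?P")
  proof -
    have AD: "?A * ?D \<in> carrier_mat 2 2" and BC: "?B * ?C \<in> carrier_mat 2 2"
      using b D by (auto intro!: mult_carrier_mat[of _ 2 2])
    have ABC: "?A \<in> carrier_mat 2 2" "?B \<in> carrier_mat 2 2" "?C \<in> carrier_mat 2 2" using b by auto
    have "(?A * ?D - ?B * ?C) $$ (i, j) = ?P $$ (i, j)" if "i < 2" "j < 2" for i j
    proof -
      have "(?A * ?D - ?B * ?C) $$ (i, j) = (?A * ?D) $$ (i, j) - (?B * ?C) $$ (i, j)"
        using that carrier_matD[OF BC] by (intro index_minus_mat) auto
      also have "\<dots> = ?P $$ (i, j)"
        unfolding mat2_mult_index[OF ABC(1) D that] mat2_mult_index[OF ABC(2,3) that]
        using that b d by (auto simp: less_2_iff char_poly_matrix_index[OF d])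
      finally show ?thesis .
    qed
    then show ?thesis using carrier_matD[OF BC] by (intro eq_matI) auto
  qed
  also have "det ?P = ?P $$ (0,0) * ?P $$ (1,1) - ?P $$ (0,1) * ?P $$ (1,0)" by (rule det_mat2) simp
  also have "\<dots> = [:det b, mat_tr b * mat_tr d - mat_tr (d * b), det d - mat_tr b, - mat_tr d, 1:]"
    using b d by (simp add: det_mat2 mat_tr_2[OF b] mat_tr_2[OF d] mat_tr_2[of "d * b"] mat2_mult_index
        algebra_simps del: index_mult_mat(1))
  finally show ?thesis .
qed

text \<open>A common eigenvector \<open>k\<close> gives
  \<open>(k, 0) \<mapsto> (0, k) \<mapsto> (\<beta> k, \<delta> k)\<close>, so
  \<open>X^2 - \<delta> X - \<beta>\<close> annihilates \<open>(k, 0)\<close> although its degree is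
  below four.\<close>

lemma block_companion_common_eigenvector_free:
  fixes b d :: "'a::field mat"
  assumes b: "b \<in> carrier_mat 2 2" and d: "d \<in> carrier_mat 2 2"
    and irr: "Factorial_Ring.irreducible (char_poly (block_companion b d))"
  shows "common_eigenvector_free b d"
  unfolding common_eigenvector_free_def
proof (intro ballI impI notI)
  fix k :: "'a vec"
  assume k: "k \<in> carrier_vec 2" "k \<noteq> 0\<^sub>v 2"
    and "\<exists>\<beta> \<delta>. b *\<^sub>v k = \<beta> \<cdot>\<^sub>v k \<and> d *\<^sub>v k = \<delta> \<cdot>\<^sub>v k"
  then obtain \<beta> \<delta> where e: "b *\<^sub>v k = \<beta> \<cdot>\<^sub>v k" "d *\<^sub>v k = \<delta> \<cdot>\<^sub>v k" by blast
  let ?y = "block_companion b d"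
  have y: "?y \<in> carrier_mat 4 4" using b d by simp
  let ?v = "k @\<^sub>v 0\<^sub>v 2"
  have v: "?v \<in> carrier_vec 4" using k append_carrier_vec[of k 2 "0\<^sub>v 2" 2] by simp
  have v0: "?v \<noteq> 0\<^sub>v 4"
  proof
    assume "?v = 0\<^sub>v 4"
    then have "?v $ i = 0" if "i < 2" for i using that by simp
    then show False using k by (auto simp: vec2_eq_iff)
  qed
  let ?p = "[:- \<beta>, - \<delta>, 1:]"
  have y1: "?y *\<^sub>v ?v = 0\<^sub>v 2 @\<^sub>v k"
    unfolding block_companion_def using b d k
    by (subst four_block_mat_mult_vec[of _ 2 2 _ 2 _ 2]) (auto simp: mult_mat_zero_vec)
  have y2: "?y *\<^sub>v (0\<^sub>v 2 @\<^sub>v k) = (\<beta> \<cdot>\<^sub>v k) @\<^sub>v (\<delta> \<cdot>\<^sub>v k)"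
    unfolding block_companion_def using b d k e
    by (subst four_block_mat_mult_vec[of _ 2 2 _ 2 _ 2]) (auto simp: mult_mat_zero_vec)
  note cl = poly_mat_closed[OF y]
  have step: "poly_mat ?y (pCons a p) *\<^sub>v ?v = a \<cdot>\<^sub>v ?v + ?y *\<^sub>v (poly_mat ?y p *\<^sub>v ?v)" for a p
  proof -
    have "poly_mat ?y (pCons a p) *\<^sub>v ?v = (a \<cdot>\<^sub>m 1\<^sub>m 4) *\<^sub>v ?v + (?y * poly_mat ?y p) *\<^sub>v ?v"
      unfolding poly_mat_pCons[OF y] using A_mult_closed[OF y cl] v
      by (intro add_mult_distrib_mat_vec) auto
    moreover have "(a \<cdot>\<^sub>m 1\<^sub>m 4) *\<^sub>v ?v = a \<cdot>\<^sub>v ?v"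
      using v by (rule smult_one_mult_vec)
    moreover have "(?y * poly_mat ?y p) *\<^sub>v ?v = ?y *\<^sub>v (poly_mat ?y p *\<^sub>v ?v)"
      by (rule assoc_mult_mat_vec[OF y cl v])
    ultimately show ?thesis by simp
  qed
  have p0: "poly_mat ?y [:1:] *\<^sub>v ?v = ?v"
    unfolding poly_mat_const[OF y] using v by (simp add: smult_one_mult_vec)
  have "poly_mat ?y [:- \<delta>, 1:] *\<^sub>v ?v = - \<delta> \<cdot>\<^sub>v ?v + (0\<^sub>v 2 @\<^sub>v k)"
    unfolding step[of "- \<delta>"] p0 y1 ..
  then have "poly_mat ?y ?p *\<^sub>v ?v = - \<beta> \<cdot>\<^sub>v ?v + ?y *\<^sub>v (- \<delta> \<cdot>\<^sub>v ?v + (0\<^sub>v 2 @\<^sub>v k))"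
    unfolding step[of "- \<beta>"] by simp
  also have "?y *\<^sub>v (- \<delta> \<cdot>\<^sub>v ?v + (0\<^sub>v 2 @\<^sub>v k)) = - \<delta> \<cdot>\<^sub>v (?y *\<^sub>v ?v) + ?y *\<^sub>v (0\<^sub>v 2 @\<^sub>v k)"
    using y v k append_carrier_vec[of "0\<^sub>v 2" 2 k 2]
    by (simp add: mult_add_distrib_mat_vec[OF y] mult_mat_vec[OF y])
  also have "- \<beta> \<cdot>\<^sub>v ?v + (- \<delta> \<cdot>\<^sub>v (?y *\<^sub>v ?v) + ?y *\<^sub>v (0\<^sub>v 2 @\<^sub>v k)) = 0\<^sub>v 4"
    unfolding y1 y2 using k by (intro eq_vecI) auto
  finally show False
    using irreducible_char_poly_no_annihilator[OF y irr v v0, of ?p] by simp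
qed

text \<open>Equal characteristic polynomials supply the trace and determinant conditions for a
  nonzero intertwiner; it is invertible because \<open>b\<close> and \<open>d\<close> have no common
  eigenvector.\<close>

lemma block_companion_conj:
  fixes b b' d :: "'a::field mat"
  assumes c: "b \<in> carrier_mat 2 2" "b' \<in> carrier_mat 2 2" "d \<in> carrier_mat 2 2"
    and irr: "Factorial_Ring.irreducible (char_poly (block_companion b d))"
    and eq: "char_poly (block_companion b d) = char_poly (block_companion b' d)"
  shows "\<exists>s\<in>carrier_mat 2 2. det s \<noteq> 0 \<and> s * b = b' * s \<and> s * d = d * s"
proof -
  note free = block_companion_common_eigenvector_free[OF c(1,3) irr]
  have h: "det b = det b'" "mat_tr b = mat_tr b'" "mat_tr (d * b) = mat_tr (d * b')"
    using eq unfolding char_poly_block_companion[OF c(1,3)] char_poly_block_companion[OF c(2,3)] by auto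
  have "\<exists>s\<in>carrier_mat 2 2. s \<noteq> 0\<^sub>m 2 2 \<and> s * b = b' * s \<and> s * d = d * s"
  proof (cases "nonscalar d")
    case True
    then obtain u v where uv: "u \<cdot>\<^sub>m 1\<^sub>m 2 + v \<cdot>\<^sub>m d \<noteq> 0\<^sub>m 2 2"
      "(u \<cdot>\<^sub>m 1\<^sub>m 2 + v \<cdot>\<^sub>m d) * b = b' * (u \<cdot>\<^sub>m 1\<^sub>m 2 + v \<cdot>\<^sub>m d)"
      using intertwiner_nonscalar[OF c True h(2,3,1)] by blast
    have "(u \<cdot>\<^sub>m 1\<^sub>m 2 + v \<cdot>\<^sub>m d) * d = d * (u \<cdot>\<^sub>m 1\<^sub>m 2 + v \<cdot>\<^sub>m d)"
      using c by (auto simp: mat2_eq_iff mat2_mult_index algebra_simps simp del: index_mult_mat(1))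
    then show ?thesis using uv c by (intro bexI[of _ "u \<cdot>\<^sub>m 1\<^sub>m 2 + v \<cdot>\<^sub>m d"]) auto
  next
    case False
    note d = scalar_mat2[OF c(3) False]
    \<comment> \<open>With \<open>d\<close> scalar every vector is an eigenvector of
      \<open>d\<close>, so \<open>b\<close> can have none and in particular is not scalar.\<close>
    have "nonscalar b"
    proof (rule ccontr)
      assume "\<not> nonscalar b"
      note b = scalar_mat2[OF c(1) this]
      have "b *\<^sub>v unit_vec 2 0 = b $$ (0,0) \<cdot>\<^sub>v unit_vec 2 0" "d *\<^sub>v unit_vec 2 0 = d $$ (0,0) \<cdot>\<^sub>v unit_vec 2 0"
        using c \<open>\<not> nonscalar b\<close> False by (auto simp: vec2_eq_iff mat2_mult_vec_index nonscalar_def)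
      moreover have "unit_vec 2 0 \<noteq> (0\<^sub>v 2 :: 'a vec)" by (auto simp: vec2_eq_iff)
      ultimately show False
        using free[unfolded common_eigenvector_free_def, rule_format, of "unit_vec 2 0"] by auto
    qed
    then obtain s where s: "s \<in> carrier_mat 2 2" "s \<noteq> 0\<^sub>m 2 2" "s * b = b' * s"
      using intertwiner_scalar[OF c(1,2) _ h(2,1)] by blast
    have "s * d = d * s"
      by (subst (1 2) d) (use s in \<open>auto simp: mat2_eq_iff mat2_mult_index algebra_simps simp del: index_mult_mat(1)\<close>)
    then show ?thesis using s by blast
  qed
  then obtain s where s: "s \<in> carrier_mat 2 2" "s \<noteq> 0\<^sub>m 2 2" "s * b = b' * s" "s * d = d * s" by blast
  then have "det s \<noteq> 0" using intertwiner_det_nonzero[OF s(1) c s(2-4) free] by simp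
  then show ?thesis using s by blast
qed

section \<open>Linear independence of isotypic vectors\<close>

context fd_representation
begin

text \<open>Letting \<open>h\<close> act and subtracting \<open>\<chi> a h\<close> times the
  relation removes the term \<open>a\<close> and rescales the others. The separating
  \<open>h\<close> depends on \<open>i\<close>, so the induction hypothesis is used once for each
  \<open>i\<close>.\<close>

lemma distinct_eigenspaces_sum_zero:
  assumes H: "H \<subseteq> carrier G" and fin: "finite I"
    and v: "\<And>i. i \<in> I \<Longrightarrow> v i \<in> eigenspace scale V \<rho> H (\<chi> i)"
    and d: "\<And>i j. i \<in> I \<Longrightarrow> j \<in> I \<Longrightarrow> i \<noteq> j \<Longrightarrow> \<exists>h\<in>H. \<chi> i h \<noteq> \<chi> j h"
    and sum: "(\<Sum>i\<in>I. v i) = 0"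
  shows "\<forall>i\<in>I. v i = 0"
  using fin v d sum
proof (induction I arbitrary: v rule: finite_induct)
  case (insert a I)
  note v = insert.prems(1) and d = insert.prems(2)
  have vV: "v i \<in> V" if "i \<in> insert a I" for i using v[OF that] by (simp add: eigenspace_def)
  have zero: "v i = 0" if i: "i \<in> I" for i
  proof -
    have "a \<noteq> i" using insert.hyps i by blast
    then obtain h where h: "h \<in> H" "\<chi> i h \<noteq> \<chi> a h" using d[of i a] i by blast
    let ?u = "\<lambda>j. scale (\<chi> j h - \<chi> a h) (v j)"
    have "\<forall>j\<in>I. ?u j = 0"
    proof (rule insert.IH)
      show "?u j \<in> eigenspace scale V \<rho> H (\<chi> j)" if "j \<in> I" for j
        by (rule subspace_scale[OF eigenspace_subspace[OF H]]) (use v that in auto)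
      show "\<exists>h\<in>H. \<chi> j h \<noteq> \<chi> k h" if "j \<in> I" "k \<in> I" "j \<noteq> k" for j k using d that by blast
      have act: "\<rho> h (v j) = scale (\<chi> j h) (v j)" if "j \<in> insert a I" for j
        using v[OF that] h by (auto simp: eigenspace_def)
      have "0 = \<rho> h (\<Sum>j\<in>insert a I. v j)"
        using insert.prems(3) h H by (simp add: rho_zero subsetD)
      also have "\<dots> = (\<Sum>j\<in>insert a I. scale (\<chi> j h) (v j))"
        using h H vV act by (subst rho_sum) (auto intro!: sum.cong)
      finally have "(\<Sum>j\<in>insert a I. scale (\<chi> j h) (v j)) - scale (\<chi> a h) (\<Sum>j\<in>insert a I. v j) = 0"
        using insert.prems(3) by simp
      then show "(\<Sum>j\<in>I. ?u j) = 0"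
        using insert.hyps by (simp add: scale_right_distrib scale_left_diff_distrib scale_sum_right sum_subtractf)
    qed
    then have "scale (\<chi> i h - \<chi> a h) (v i) = 0" using i by blast
    then show ?thesis using h(2) by simp
  qed
  then have "(\<Sum>j\<in>I. v j) = 0" by simp
  then show ?case using zero insert by simp
qed simp

end

section \<open>Matrices over a local ring of length two\<close>

lemma finite_carrier_mat:
  assumes "finite (UNIV :: 'a set)"
  shows "finite (carrier_mat n m :: 'a mat set)"
proof -
  have "carrier_mat n m \<subseteq> (\<lambda>f. mat n m f) ` (({..<n} \<times> {..<m}) \<rightarrow>\<^sub>E (UNIV :: 'a set))"
  proof
    fix A :: "'a mat" assume A: "A \<in> carrier_mat n m"
    have "A = mat n m (restrict (\<lambda>p. A $$ p) ({..<n} \<times> {..<m}))"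
      using A by (intro eq_matI) auto
    then show "A \<in> (\<lambda>f. mat n m f) ` (({..<n} \<times> {..<m}) \<rightarrow>\<^sub>E UNIV)"
      by (intro image_eqI[where x = "restrict (\<lambda>p. A $$ p) ({..<n} \<times> {..<m})"]) auto
  qed
  moreover have "finite (({..<n} \<times> {..<m}) \<rightarrow>\<^sub>E (UNIV :: 'a set))"
    using assms by (intro finite_PiE) auto
  ultimately show ?thesis by (meson finite_imageI finite_subset)
qed

lemma carrier_GL:
  "A \<in> carrier (GL n) \<longleftrightarrow> A \<in> carrier_mat n n \<and> (\<exists>B\<in>carrier_mat n n. A * B = 1\<^sub>m n \<and> B * A = 1\<^sub>m n)"
  by (auto simp: GL_def units_of_def Units_def ring_mat_simps)

lemma mult_GL [simp]: "A \<otimes>\<^bsub>GL n\<^esub> B = A * B"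
  and one_GL [simp]: "\<one>\<^bsub>GL n\<^esub> = 1\<^sub>m n"
  by (auto simp: GL_def units_of_def ring_mat_simps)

lemma GL_carrier_mat: "A \<in> carrier (GL n) \<Longrightarrow> A \<in> carrier_mat n n"
  by (simp add: carrier_GL)

lemma GL_inv:
  assumes "A \<in> carrier (GL n)"
  shows "inv\<^bsub>GL n\<^esub> A \<in> carrier (GL n)" "A * inv\<^bsub>GL n\<^esub> A = 1\<^sub>m n" "inv\<^bsub>GL n\<^esub> A * A = 1\<^sub>m n"
proof -
  interpret group "GL n" by (rule group_GL)
  show "inv\<^bsub>GL n\<^esub> A \<in> carrier (GL n)" using assms by simp
  show "A * inv\<^bsub>GL n\<^esub> A = 1\<^sub>m n" "inv\<^bsub>GL n\<^esub> A * A = 1\<^sub>m n"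
    using r_inv[OF assms] l_inv[OF assms] by simp_all
qed

lemma mat_tr_add: "A \<in> carrier_mat n n \<Longrightarrow> B \<in> carrier_mat n n \<Longrightarrow> mat_tr (A + B) = mat_tr A + mat_tr B"
  by (auto simp: mat_tr_def sum.distrib)

lemma mat_tr_comm:
  fixes A :: "'a::comm_semiring_0 mat"
  assumes "A \<in> carrier_mat n m" "B \<in> carrier_mat m n"
  shows "mat_tr (A * B) = mat_tr (B * A)"
proof -
  have "mat_tr (A * B) = (\<Sum>i<n. \<Sum>j<m. A $$ (i,j) * B $$ (j,i))"
    using assms by (auto simp: mat_tr_def scalar_prod_def lessThan_atLeast0)
  also have "\<dots> = (\<Sum>j<m. \<Sum>i<n. B $$ (j,i) * A $$ (i,j))"
    by (subst sum.swap) (simp add: mult.commute)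
  also have "\<dots> = mat_tr (B * A)"
    using assms by (auto simp: mat_tr_def scalar_prod_def lessThan_atLeast0)
  finally show ?thesis .
qed

text \<open>The axioms make the kernel of \<open>res\<close>, the ideal generated by
  \<open>w\<close> and the annihilator of \<open>w\<close> coincide, as they do for
  \<open>o2\<close> with \<open>w\<close> the class of a uniformizer.\<close>

locale length_two_ring =
  fixes res :: "'r::comm_ring_1 \<Rightarrow> 'k::field" and w :: 'r
  assumes res_add: "res (x + y) = res x + res y"
    and res_mult: "res (x * y) = res x * res y"
    and res_surj: "surj res"
    and w_mult_eq_iff: "w * x = w * y \<longleftrightarrow> res x = res y"
    and res_w: "res w = 0"
    and res_eq_0_imp: "res x = 0 \<Longrightarrow> \<exists>z. x = w * z"
begin

lemma res_0: "res 0 = 0"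
  by (metis add.right_neutral add_left_cancel res_add)

lemma res_1: "res 1 = 1"
proof -
  obtain x where "res x = 1" using res_surj by (metis surjD)
  then show ?thesis using res_mult[of 1 x] by simp
qed

end

sublocale length_two_ring \<subseteq> res: comm_ring_hom res
  by standard (auto simp: res_add res_mult res_0 res_1)

context length_two_ring
begin

lemma w_w: "w * w = 0"
  using w_mult_eq_iff[of w 0] by (simp add: res_w res_0)

lemma res_eq_imp: "res x = res y \<Longrightarrow> \<exists>z. x = y + w * z"
  using res_eq_0_imp[of "x - y"] by (auto simp: res.hom_minus algebra_simps)

lemma unit_of_res:
  assumes "res x \<noteq> 0"
  shows "\<exists>y. x * y = 1"
proof -
  obtain y where y: "res y = inverse (res x)" using res_surj by (metis surjD)
  then have "res (x * y) = res 1" using assms by (simp add: res_mult res_1)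
  then obtain z where z: "x * y = 1 + w * z" using res_eq_imp by blast
  have "x * (y * (1 - w * z)) = (1 + w * z) * (1 - w * z)" by (simp add: z mult.assoc[symmetric])
  also have "\<dots> = 1 - (w * w) * (z * z)" by (simp add: algebra_simps)
  finally show ?thesis by (auto simp: w_w)
qed

text \<open>Two digits: every element is \<open>a + w b\<close> with \<open>a\<close> and
  \<open>b\<close> from a fixed set of lifts of the residue field.\<close>

lemma finite_ring:
  assumes "finite (UNIV :: 'k set)"
  shows "finite (UNIV :: 'r set)"
proof -
  have "x \<in> (\<lambda>(a, b). inv_into UNIV res a + w * inv_into UNIV res b) ` (UNIV \<times> UNIV)" for x
  proof -
    have "res x = res (inv_into UNIV res (res x))" using res_surj by (simp add: surj_f_inv_f)
    then obtain z where z: "x = inv_into UNIV res (res x) + w * z" using res_eq_imp by blast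
    have "w * z = w * inv_into UNIV res (res z)" using res_surj by (simp add: w_mult_eq_iff surj_f_inv_f)
    then show ?thesis using z by (intro image_eqI[of _ _ "(res x, res z)"]) auto
  qed
  then have "UNIV \<subseteq> (\<lambda>(a, b). inv_into UNIV res a + w * inv_into UNIV res b) ` (UNIV \<times> UNIV)" by blast
  moreover have "finite ((\<lambda>(a, b). inv_into UNIV res a + w * inv_into UNIV res b) ` (UNIV \<times> UNIV))"
    using assms by (intro finite_imageI) (simp add: finite_prod)
  ultimately show ?thesis using finite_subset by blast
qed

abbreviation red :: "'r mat \<Rightarrow> 'k mat" where "red \<equiv> map_mat res"

lemma red_mult: "A \<in> carrier_mat n m \<Longrightarrow> B \<in> carrier_mat m l \<Longrightarrow> red (A * B) = red A * red B"
  by (rule res.mat_hom_mult)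

lemma red_mult3:
  "A \<in> carrier_mat n n \<Longrightarrow> B \<in> carrier_mat n n \<Longrightarrow> C \<in> carrier_mat n n \<Longrightarrow>
    red (A * B * C) = red A * red B * red C"
  using red_mult[of "A * B" n n C n] red_mult[of A n n B n] by simp

lemma red_one: "red (1\<^sub>m n) = 1\<^sub>m n"
  by (rule res.mat_hom_one)

lemma red_lift: "A \<in> carrier_mat n m \<Longrightarrow> \<exists>B\<in>carrier_mat n m. red B = A"
  by (rule bexI[of _ "map_mat (inv_into UNIV res) A"]) (auto simp: surj_f_inv_f[OF res_surj] intro!: eq_matI)

lemma red_eq_imp:
  assumes A: "A \<in> carrier_mat n m" and B: "B \<in> carrier_mat n m" and e: "red A = red B"
  shows "\<exists>C\<in>carrier_mat n m. A = B + w \<cdot>\<^sub>m C"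
proof -
  have "\<exists>z. A $$ (i, j) = B $$ (i, j) + w * z" if "i < n" "j < m" for i j
  proof (rule res_eq_imp)
    have "red A $$ (i, j) = red B $$ (i, j)" by (simp add: e)
    then show "res (A $$ (i, j)) = res (B $$ (i, j))" using that A B by simp
  qed
  then obtain f where f: "\<And>i j. i < n \<Longrightarrow> j < m \<Longrightarrow> A $$ (i, j) = B $$ (i, j) + w * f i j" by metis
  then have "A = B + w \<cdot>\<^sub>m mat n m (\<lambda>(i, j). f i j)" using A B by (intro eq_matI) auto
  then show ?thesis by (metis mat_carrier)
qed

lemma red_add_w: "A \<in> carrier_mat n m \<Longrightarrow> C \<in> carrier_mat n m \<Longrightarrow> red (A + w \<cdot>\<^sub>m C) = red A"
  by (intro eq_matI) (auto simp: res_add res_mult res_w)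

lemma GL_of_red:
  assumes A: "A \<in> carrier_mat n n" and d: "det (red A) \<noteq> 0"
  shows "A \<in> carrier (GL n)"
proof -
  have "res (det A) \<noteq> 0" using d by (simp add: res.hom_det)
  then obtain y where y: "det A * y = 1" using unit_of_res by blast
  note adj = adj_mat[OF A]
  have "A * (y \<cdot>\<^sub>m adj_mat A) = y \<cdot>\<^sub>m (det A \<cdot>\<^sub>m 1\<^sub>m n)"
    using mult_smult_distrib[OF A adj(1), of y] adj(2) by simp
  moreover have "(y \<cdot>\<^sub>m adj_mat A) * A = y \<cdot>\<^sub>m (det A \<cdot>\<^sub>m 1\<^sub>m n)"
    using mult_smult_assoc_mat[OF adj(1) A, of y] adj(3) by simp
  moreover have "y \<cdot>\<^sub>m (det A \<cdot>\<^sub>m 1\<^sub>m n) = 1\<^sub>m n"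
    using y by (intro eq_matI) (auto simp: mult.commute)
  ultimately show ?thesis unfolding carrier_GL using A adj(1) by (intro conjI bexI[of _ "y \<cdot>\<^sub>m adj_mat A"]) auto
qed

lemma det_red_GL:
  assumes "A \<in> carrier (GL n)"
  shows "det (red A) \<noteq> 0"
proof
  assume z: "det (red A) = 0"
  obtain B where B: "B \<in> carrier_mat n n" "A * B = 1\<^sub>m n" and A: "A \<in> carrier_mat n n"
    using assms by (auto simp: carrier_GL)
  have "red A * red B = 1\<^sub>m n" using B A by (simp flip: red_mult add: red_one)
  then have "det (red A) * det (red B) = 1" using det_mult[of "red A" n "red B"] A B by simp
  then show False using z by simp
qed

section \<open>The first congruence subgroup\<close>

definition kmat :: "nat \<Rightarrow> 'r mat \<Rightarrow> 'r mat" where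
  "kmat n A = 1\<^sub>m n + w \<cdot>\<^sub>m A"

definition K :: "nat \<Rightarrow> 'r mat set" where
  "K n = kmat n ` carrier_mat n n"

lemma kmat_closed [simp]: "A \<in> carrier_mat n n \<Longrightarrow> kmat n A \<in> carrier_mat n n"
  by (simp add: kmat_def)

lemma kmat_mult:
  assumes A: "A \<in> carrier_mat n n" and B: "B \<in> carrier_mat n n"
  shows "kmat n A * kmat n B = kmat n (A + B)"
proof -
  have wA: "w \<cdot>\<^sub>m A \<in> carrier_mat n n" "w \<cdot>\<^sub>m B \<in> carrier_mat n n" using A B by auto
  have "kmat n A * kmat n B = 1\<^sub>m n * kmat n B + (w \<cdot>\<^sub>m A) * kmat n B"
    unfolding kmat_def[of n A] using wA B by (intro add_mult_distrib_mat[of _ n n _ _ n]) auto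
  also have "(w \<cdot>\<^sub>m A) * kmat n B = (w \<cdot>\<^sub>m A) * 1\<^sub>m n + (w \<cdot>\<^sub>m A) * (w \<cdot>\<^sub>m B)"
    unfolding kmat_def using wA by (intro mult_add_distrib_mat[of _ n n _ n]) auto
  also have "(w \<cdot>\<^sub>m A) * (w \<cdot>\<^sub>m B) = (w * w) \<cdot>\<^sub>m (A * B)"
    using A B wA by (simp add: mult_smult_assoc_mat[of _ n n] mult_smult_distrib[of _ n n])
      (auto intro!: eq_matI simp: mult.assoc)
  also have "1\<^sub>m n * kmat n B + ((w \<cdot>\<^sub>m A) * 1\<^sub>m n + (w * w) \<cdot>\<^sub>m (A * B)) = kmat n (A + B)"
    unfolding w_w using A B by (intro eq_matI) (auto simp: kmat_def algebra_simps)
  finally show ?thesis .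
qed

lemma kmat_0: "kmat n (0\<^sub>m n n) = 1\<^sub>m n"
  by (auto simp: kmat_def)

lemma kmat_uminus:
  assumes A: "A \<in> carrier_mat n n"
  shows "kmat n A * kmat n (- A) = 1\<^sub>m n" "kmat n (- A) * kmat n A = 1\<^sub>m n"
  using A comm_add_mat[OF A, of "- A"] by (simp_all add: kmat_mult kmat_0 uminus_l_inv_mat[OF A])

lemma kmat_GL [simp]: "A \<in> carrier_mat n n \<Longrightarrow> kmat n A \<in> carrier (GL n)"
  unfolding carrier_GL using kmat_uminus by (intro conjI bexI[of _ "kmat n (- A)"]) auto

lemma kmat_eq_iff:
  assumes A: "A \<in> carrier_mat n n" and B: "B \<in> carrier_mat n n"
  shows "kmat n A = kmat n B \<longleftrightarrow> red A = red B"
proof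
  assume e: "kmat n A = kmat n B"
  show "red A = red B"
  proof (rule eq_matI)
    fix i j assume "i < dim_row (red B)" "j < dim_col (red B)"
    then have ij: "i < n" "j < n" using B by auto
    have "kmat n A $$ (i, j) = kmat n B $$ (i, j)" by (simp add: e)
    then have "w * A $$ (i, j) = w * B $$ (i, j)" using ij A B by (simp add: kmat_def)
    then show "red A $$ (i, j) = red B $$ (i, j)" using ij A B by (simp add: w_mult_eq_iff)
  qed (use A B in auto)
next
  assume e: "red A = red B"
  show "kmat n A = kmat n B"
  proof (rule eq_matI)
    fix i j assume "i < dim_row (kmat n B)" "j < dim_col (kmat n B)"
    then have ij: "i < n" "j < n" using B by (auto simp: kmat_def)
    have "red A $$ (i, j) = red B $$ (i, j)" by (simp add: e)
    then have "w * A $$ (i, j) = w * B $$ (i, j)" using ij A B by (simp add: w_mult_eq_iff)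
    then show "kmat n A $$ (i, j) = kmat n B $$ (i, j)" using ij A B by (simp add: kmat_def)
  qed (use A B in \<open>auto simp: kmat_def\<close>)
qed

lemma kmat_of_red_one:
  assumes "A \<in> carrier_mat n n" "red A = 1\<^sub>m n"
  shows "\<exists>C\<in>carrier_mat n n. A = kmat n C"
  using red_eq_imp[OF assms(1) one_carrier_mat] assms(2) red_one by (auto simp: kmat_def)

lemma red_kmat: "A \<in> carrier_mat n n \<Longrightarrow> red (kmat n A) = 1\<^sub>m n"
  unfolding kmat_def by (subst red_add_w) (auto simp: red_one)

lemma kmat_conj:
  assumes g: "g \<in> carrier_mat n n" "h \<in> carrier_mat n n" "g * h = 1\<^sub>m n" and A: "A \<in> carrier_mat n n"
  shows "g * kmat n A * h = kmat n (g * A * h)"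
proof -
  have gA: "g * A \<in> carrier_mat n n" using g A by auto
  have "g * kmat n A = g * 1\<^sub>m n + g * (w \<cdot>\<^sub>m A)"
    unfolding kmat_def using g A by (intro mult_add_distrib_mat[of _ n n _ n]) auto
  also have "\<dots> = g + w \<cdot>\<^sub>m (g * A)" using g A by (simp add: mult_smult_distrib)
  finally have "g * kmat n A * h = g * h + (w \<cdot>\<^sub>m (g * A)) * h"
    using g gA by (simp add: add_mult_distrib_mat[of g n n])
  then show ?thesis using g gA by (simp add: kmat_def mult_smult_assoc_mat[of "g * A" n n h])
qed

lemma subgroup_K: "subgroup (K n) (GL n)"
proof (rule group.subgroupI[OF group_GL])
  show "K n \<subseteq> carrier (GL n)" by (auto simp: K_def)
  show "K n \<noteq> {}" by (auto simp: K_def intro: zero_carrier_mat)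
  fix a assume "a \<in> K n"
  then obtain A where A: "A \<in> carrier_mat n n" "a = kmat n A" by (auto simp: K_def)
  have "inv\<^bsub>GL n\<^esub> a = kmat n (- A)"
    using A kmat_uminus by (intro group.inv_equality[OF group_GL]) auto
  then show "inv\<^bsub>GL n\<^esub> a \<in> K n" using A by (auto simp: K_def)
  fix b assume "b \<in> K n"
  then show "a \<otimes>\<^bsub>GL n\<^esub> b \<in> K n" using A by (auto simp: K_def kmat_mult intro!: imageI)
qed

end

section \<open>Characters of the congruence subgroup and the trace pairing\<close>

locale length_two_char = length_two_ring res w
  for res :: "'r::comm_ring_1 \<Rightarrow> 'k::field" and w :: 'r +
  fixes \<psi>0 :: "'r \<Rightarrow> complex"
  assumes \<psi>0: "additive_character \<psi>0"
    and \<psi>0_nontrivial: "\<exists>x. \<psi>0 (w * x) \<noteq> 1"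
begin

lemma \<psi>0_nonzero: "\<psi>0 x \<noteq> 0" and \<psi>0_add: "\<psi>0 (x + y) = \<psi>0 x * \<psi>0 y"
  using \<psi>0 by (auto simp: additive_character_def)

lemma \<psi>0_0: "\<psi>0 0 = 1"
  using \<psi>0_add[of 0 0] \<psi>0_nonzero[of 0] by simp

lemma \<psi>0_trivial_imp:
  assumes "\<And>x. \<psi>0 (w * (r * x)) = 1"
  shows "res r = 0"
proof (rule ccontr)
  assume "res r \<noteq> 0"
  then obtain s where "r * s = 1" using unit_of_res by blast
  then have "\<psi>0 (w * x) = 1" for x using assms[of "s * x"] by (simp add: mult.assoc[symmetric])
  then show False using \<psi>0_nontrivial by blast
qed

lemma trace_pairing_cong:
  assumes "A \<in> carrier_mat n n" "B \<in> carrier_mat n n" "y \<in> carrier_mat n n" "z \<in> carrier_mat n n"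
    and "red A = red B" "red y = red z"
  shows "w * mat_tr (y * A) = w * mat_tr (z * B)"
proof -
  have "res (mat_tr (y * A)) = mat_tr (red y * red A)"
    if "y \<in> carrier_mat n n" "A \<in> carrier_mat n n" for y A
    using that by (simp flip: red_mult) (simp add: mat_tr_def res.hom_sum)
  then show ?thesis using assms by (simp add: w_mult_eq_iff)
qed

text \<open>Testing on multiples of one elementary matrix isolates one entry of
  \<open>y - z\<close>; with nonzero residue it would be a unit and make \<psi>0 trivial on the
  ideal generated by \<open>w\<close>.\<close>

lemma trace_pairing_nondegenerate:
  assumes y: "y \<in> carrier_mat n m" and z: "z \<in> carrier_mat n m"
    and e: "\<And>A. A \<in> carrier_mat m n \<Longrightarrow> \<psi>0 (w * mat_tr (y * A)) = \<psi>0 (w * mat_tr (z * A))"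
  shows "red y = red z"
proof (rule eq_matI)
  fix i j assume "i < dim_row (red z)" "j < dim_col (red z)"
  then have ij: "i < n" "j < m" using z by auto
  have tr: "mat_tr (u * mat m n (\<lambda>p. if p = (j, i) then x else 0)) = u $$ (i, j) * x"
    if u: "u \<in> carrier_mat n m" for u and x :: 'r
  proof -
    have "mat_tr (u * mat m n (\<lambda>p. if p = (j, i) then x else 0))
        = (\<Sum>k<n. \<Sum>l<m. u $$ (k, l) * (if l = j \<and> k = i then x else 0))"
      using u by (auto simp: mat_tr_def scalar_prod_def lessThan_atLeast0 intro!: sum.cong)
    also have "\<dots> = (\<Sum>k<n. if k = i then u $$ (k, j) * x else 0)"
      using ij by (intro sum.cong) (auto simp: if_distrib cong: if_cong)
    finally show ?thesis using ij by simp
  qed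
  have "res (y $$ (i, j) - z $$ (i, j)) = 0"
  proof (rule \<psi>0_trivial_imp)
    fix x :: 'r
    let ?A = "mat m n (\<lambda>p. if p = (j, i) then x else 0)"
    have "\<psi>0 (w * (y $$ (i, j) * x)) = \<psi>0 (w * (z $$ (i, j) * x))"
      using e[of ?A] tr[OF y] tr[OF z] by simp
    moreover have "w * (y $$ (i, j) * x) = w * ((y $$ (i, j) - z $$ (i, j)) * x) + w * (z $$ (i, j) * x)"
      by (simp add: algebra_simps)
    ultimately show "\<psi>0 (w * ((y $$ (i, j) - z $$ (i, j)) * x)) = 1"
      using \<psi>0_nonzero by (simp add: \<psi>0_add)
  qed
  then show "red y $$ (i, j) = red z $$ (i, j)" using ij y z by (simp add: res.hom_minus)
qed (use y z in auto)

text \<open>The element \<open>k\<close> determines \<open>A\<close> only modulo \<open>w\<close>,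
  and the factor \<open>w\<close> makes the choice immaterial. The parameter is a lift
  \<open>y\<close>, so matrices with equal residues give equal characters on
  \<open>K n\<close>.\<close>

definition kchar :: "nat \<Rightarrow> 'r mat \<Rightarrow> 'r mat \<Rightarrow> complex" where
  "kchar n y k = \<psi>0 (w * mat_tr (y * (SOME A. A \<in> carrier_mat n n \<and> k = kmat n A)))"

lemma kchar_kmat:
  assumes y: "y \<in> carrier_mat n n" and A: "A \<in> carrier_mat n n"
  shows "kchar n y (kmat n A) = \<psi>0 (w * mat_tr (y * A))"
proof -
  let ?B = "SOME B. B \<in> carrier_mat n n \<and> kmat n A = kmat n B"
  have "?B \<in> carrier_mat n n \<and> kmat n A = kmat n ?B"
    by (rule someI[of _ A]) (use A in auto)
  then have B: "?B \<in> carrier_mat n n" "kmat n A = kmat n ?B" by auto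
  have "red ?B = red A" using B(2) kmat_eq_iff[OF A B(1)] by simp
  then show ?thesis unfolding kchar_def using B y A by (simp add: trace_pairing_cong[of ?B n A y y])
qed

lemma kchar_mult:
  assumes y: "y \<in> carrier_mat n n" and "h \<in> K n" "k \<in> K n"
  shows "kchar n y (h * k) = kchar n y h * kchar n y k"
proof -
  obtain A B where AB: "A \<in> carrier_mat n n" "B \<in> carrier_mat n n" "h = kmat n A" "k = kmat n B"
    using assms by (auto simp: K_def)
  have "mat_tr (y * (A + B)) = mat_tr (y * A) + mat_tr (y * B)"
    using y AB by (simp add: mult_add_distrib_mat[of y n n] mat_tr_add[of _ n])
  then show ?thesis
    using AB y by (simp add: kmat_mult kchar_kmat \<psi>0_add distrib_left)
qed

lemma kchar_nonzero: "kchar n y k \<noteq> 0"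
  by (simp add: kchar_def \<psi>0_nonzero)

lemma kchar_cong:
  assumes "y \<in> carrier_mat n n" "z \<in> carrier_mat n n" "red y = red z" "k \<in> K n"
  shows "kchar n y k = kchar n z k"
  using assms by (auto simp: K_def kchar_kmat trace_pairing_cong[of _ n _ y z])

lemma kchar_distinct:
  assumes "y \<in> carrier_mat n n" "z \<in> carrier_mat n n" "red y \<noteq> red z"
  shows "\<exists>k\<in>K n. kchar n y k \<noteq> kchar n z k"
  using trace_pairing_nondegenerate[OF assms(1,2)] assms by (auto simp: K_def kchar_kmat)

end

section \<open>Representations restricted to the first congruence subgroup\<close>

lemma add_mat_left_cancel:
  fixes A :: "'a::ab_group_add mat"
  assumes A: "A \<in> carrier_mat n m" and B: "B \<in> carrier_mat n m" and C: "C \<in> carrier_mat n m"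
    and e: "A + B = A + C"
  shows "B = C"
proof (rule eq_matI)
  fix i j assume "i < dim_row C" "j < dim_col C"
  then show "B $$ (i, j) = C $$ (i, j)"
    using arg_cong[OF e, of "\<lambda>M. M $$ (i, j)"] A B C by simp
qed (use B C in auto)

locale length_two_rep = length_two_char res w \<psi>0 + fd_representation "GL n" scale V \<rho>
  for res :: "'r::comm_ring_1 \<Rightarrow> 'k::field" and w :: 'r and \<psi>0 :: "'r \<Rightarrow> complex" and n :: nat
    and scale :: "complex \<Rightarrow> 'v::ab_group_add \<Rightarrow> 'v" and V :: "'v set" and \<rho> :: "'r mat \<Rightarrow> 'v \<Rightarrow> 'v"
begin

abbreviation V\<^sub>K :: "'r mat \<Rightarrow> 'v set" where
  "V\<^sub>K y \<equiv> eigenspace scale V \<rho> (K n) (kchar n y)"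

lemma VK_iff:
  assumes "y \<in> carrier_mat n n"
  shows "v \<in> V\<^sub>K y \<longleftrightarrow> v \<in> V \<and>
    (\<forall>A\<in>carrier_mat n n. \<rho> (kmat n A) v = scale (\<psi>0 (w * mat_tr (y * A))) v)"
  using assms by (auto simp: eigenspace_def K_def kchar_kmat)

lemma VK_cong:
  assumes "y \<in> carrier_mat n n" "z \<in> carrier_mat n n" "red y = red z"
  shows "V\<^sub>K y = V\<^sub>K z"
  using kchar_cong[OF assms] by (auto simp: eigenspace_def)

lemma rho_mult_GL:
  "g \<in> carrier (GL n) \<Longrightarrow> h \<in> carrier (GL n) \<Longrightarrow> v \<in> V \<Longrightarrow> \<rho> (g * h) v = \<rho> g (\<rho> h v)"
  using rho_mult[of g h v] by simp

lemma rho_inverse: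
  assumes "g \<in> carrier (GL n)" "h \<in> carrier (GL n)" "g * h = 1\<^sub>m n" "v \<in> V"
  shows "\<rho> g (\<rho> h v) = v"
  using rho_mult_GL[OF assms(1,2,4)] rho_one[OF assms(4)] assms(3) by simp

lemma rho_eq_0:
  assumes "g \<in> carrier (GL n)" "v \<in> V" "\<rho> g v = 0"
  shows "v = 0"
proof -
  have "v = \<rho> (inv\<^bsub>GL n\<^esub> g) (\<rho> g v)"
    using rho_inverse[of "inv\<^bsub>GL n\<^esub> g" g v] GL_inv[OF assms(1)] assms by simp
  then show ?thesis using assms GL_inv(1)[OF assms(1)] by (simp add: rho_zero)
qed

text \<open>The argument \<open>h\<close> stands for the inverse of \<open>g\<close>. Conjugation by
  \<open>g\<close> moves the character of \<open>y\<close> to that of \<open>g y h\<close> by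
  cyclicity of the trace.\<close>

lemma VK_rho:
  assumes y: "y \<in> carrier_mat n n" and g: "g \<in> carrier (GL n)" "h \<in> carrier (GL n)"
    and gh: "g * h = 1\<^sub>m n" "h * g = 1\<^sub>m n" and v: "v \<in> V\<^sub>K y"
  shows "\<rho> g v \<in> V\<^sub>K (g * y * h)"
proof -
  note gc = GL_carrier_mat[OF g(1)] GL_carrier_mat[OF g(2)]
  have gyh: "g * y * h \<in> carrier_mat n n" using gc y by simp
  have vV: "v \<in> V" using v by (simp add: eigenspace_def)
  have "\<rho> (kmat n A) (\<rho> g v) = scale (\<psi>0 (w * mat_tr (g * y * h * A))) (\<rho> g v)"
    if A: "A \<in> carrier_mat n n" for A
  proof -
    have hAg: "h * A * g \<in> carrier_mat n n" using gc A by simp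
    have "g * (h * A * g) = A * g"
      using assoc_mult_mat[OF gc mult_carrier_mat[OF A gc(1)]] assoc_mult_mat[OF gc(2) A gc(1)] gh A gc
      by simp
    then have 1: "g * kmat n (h * A * g) = kmat n A * g"
      using kmat_conj[OF gc(2,1) gh(2) A, symmetric] assoc_mult_mat[OF gc mult_carrier_mat[OF kmat_closed[OF A] gc(1)]]
        assoc_mult_mat[OF gc(2) kmat_closed[OF A] gc(1)] gh A gc by simp
    have "mat_tr (g * y * h * A) = mat_tr (g * (y * (h * A)))"
      using assoc_mult_mat[OF mult_carrier_mat[OF gc(1) y] gc(2) A]
        assoc_mult_mat[OF gc(1) y mult_carrier_mat[OF gc(2) A]] by simp
    also have "\<dots> = mat_tr (y * (h * A) * g)"
      using y gc A by (intro mat_tr_comm) auto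
    also have "\<dots> = mat_tr (y * (h * A * g))"
      using assoc_mult_mat[OF y mult_carrier_mat[OF gc(2) A] gc(1)] by simp
    finally have tr: "mat_tr (g * y * h * A) = mat_tr (y * (h * A * g))" .
    have "\<rho> (kmat n A) (\<rho> g v) = \<rho> g (\<rho> (kmat n (h * A * g)) v)"
      using rho_mult_GL[OF kmat_GL[OF A] g(1) vV] rho_mult_GL[OF g(1) kmat_GL[OF hAg] vV] 1 by simp
    also have "\<rho> (kmat n (h * A * g)) v = scale (\<psi>0 (w * mat_tr (y * (h * A * g)))) v"
      using v hAg by (simp add: VK_iff[OF y])
    finally show ?thesis using g vV by (simp add: tr rho_scale)
  qed
  then show ?thesis using rho_closed[OF g(1) vV] by (simp add: VK_iff[OF gyh])
qed

lemma finite_GL: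
  assumes "finite (UNIV :: 'k set)"
  shows "finite (carrier (GL n :: 'r mat monoid))"
  using finite_subset[OF _ finite_carrier_mat[OF finite_ring[OF assms]]] GL_carrier_mat by blast

lemma isotypic_K:
  assumes "finite (UNIV :: 'k set)" and y: "y \<in> carrier_mat n n"
  shows "isotypic (GL n) scale V \<rho> (K n) (kchar n y)"
proof (intro isotypic.intro isotypic_axioms.intro)
  show "finite (K n)"
    using finite_subset[OF _ finite_GL[OF assms(1)]] subgroup.subset[OF subgroup_K] by blast
qed (use y in \<open>auto simp: kchar_nonzero kchar_mult intro: fd_representation_axioms subgroup_K\<close>)

text \<open>If the residue field were infinite, the conjugates of \<open>V\<^sub>K x\<close> under the elementary matrices
  \<open>1 + s E\<^sub>0\<^sub>1\<close> would span an infinite-dimensional space.\<close>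

lemma finite_residue_field:
  assumes x: "x \<in> carrier_mat n n" and irr: "Factorial_Ring.irreducible (char_poly (red x))"
    and n: "2 \<le> n" and u: "u \<in> V\<^sub>K x" "u \<noteq> 0"
  shows "finite (UNIV :: 'k set)"
proof -
  define E :: "'r \<Rightarrow> 'r mat" where "E s = mat n n (\<lambda>p. if p = (0, 1) then s else 0)" for s
  define F :: "'k \<Rightarrow> 'k mat" where "F s = mat n n (\<lambda>p. if p = (0, 1) then s else 0)" for s
  define g where "g s = 1\<^sub>m n + E s" for s
  have Ec: "E s \<in> carrier_mat n n" and Fc: "F t \<in> carrier_mat n n" and gc: "g s \<in> carrier_mat n n" for s t
    by (simp_all add: E_def F_def g_def)
  have EE: "E s * E t = 0\<^sub>m n n" for s t
    using n by (intro eq_matI) (auto simp: E_def scalar_prod_def intro!: sum.neutral)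
  have gg: "g s * g t = g (s + t)" for s t
  proof -
    have "g s * g t = 1\<^sub>m n * g t + E s * g t"
      unfolding g_def[of s] using Ec gc by (intro add_mult_distrib_mat[of _ n n _ _ n]) auto
    also have "E s * g t = E s * 1\<^sub>m n + E s * E t"
      unfolding g_def[of t] using Ec by (intro mult_add_distrib_mat[of _ n n _ n]) auto
    also have "1\<^sub>m n * g t + (E s * 1\<^sub>m n + E s * E t) = g (s + t)"
      unfolding EE left_mult_one_mat[OF gc] right_mult_one_mat[OF Ec]
      by (intro eq_matI) (auto simp: g_def E_def)
    finally show ?thesis .
  qed
  have g0: "g 0 = 1\<^sub>m n" by (intro eq_matI) (auto simp: g_def E_def)
  have gGL: "g s \<in> carrier (GL n)" for s
    unfolding carrier_GL using gg[of s "- s"] gg[of "- s" s] g0 gc by (intro conjI bexI[of _ "g (- s)"]) auto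
  have redg: "red (g s) = 1\<^sub>m n + F (res s)" for s
    by (intro eq_matI) (auto simp: g_def E_def F_def res_add res_1 res_0)
  define lift where "lift = inv_into UNIV res"
  have lift: "res (lift s) = s" for s unfolding lift_def by (rule surj_f_inv_f[OF res_surj])
  define z where "z s = g (lift s) * x * g (- lift s)" for s
  have zc: "z s \<in> carrier_mat n n" for s using gc x by (simp add: z_def)
  have distinct: "red (z s) \<noteq> red (z t)" if "s \<noteq> t" for s t
  proof
    assume e: "red (z s) = red (z t)"
    let ?a = "red (g (lift s))" and ?a' = "red (g (- lift s))" and ?b = "red (g (lift t))"
      and ?b' = "red (g (- lift t))" and ?x = "red x"
    have c: "?a \<in> carrier_mat n n" "?a' \<in> carrier_mat n n" "?b \<in> carrier_mat n n" "?b' \<in> carrier_mat n n"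
      "?x \<in> carrier_mat n n" using gc x by auto
    have prods: "red (g p) * red (g q) = 1\<^sub>m n + F (res p + res q)" for p q
      using redg[of "p + q"] red_mult[OF gc gc, of p q] by (simp add: gg res_add)
    have F0: "1\<^sub>m n + F 0 = 1\<^sub>m n" by (intro eq_matI) (auto simp: F_def)
    have aa: "?a' * ?a = 1\<^sub>m n" "?b' * ?b = 1\<^sub>m n" using F0 by (simp_all add: prods res.hom_uminus)
    have eq: "?a * ?x * ?a' = ?b * ?x * ?b'"
      using e by (simp add: z_def red_mult3[OF gc x gc])
    let ?d = "?b' * ?a"
    have d: "?d = 1\<^sub>m n + F (s - t)" by (simp add: prods res.hom_uminus lift)
    have "?d * ?x = ?b' * (?a * ?x * ?a') * ?a"
    proof -
      have "?a * ?x * ?a' * ?a = ?a * ?x"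
        using assoc_mult_mat[OF mult_carrier_mat[OF c(1,5)] c(2,1)] aa c by simp
      then show ?thesis
        using assoc_mult_mat[OF c(4,1,5)]
          assoc_mult_mat[OF c(4) mult_carrier_mat[OF mult_carrier_mat[OF c(1,5)] c(2)] c(1)] by simp
    qed
    also have "\<dots> = ?x * ?d"
    proof -
      have "?b' * (?b * ?x * ?b') = ?x * ?b'"
        using assoc_mult_mat[OF c(4,3) mult_carrier_mat[OF c(5,4)]] assoc_mult_mat[OF c(3,5,4)] aa c by simp
      then show ?thesis unfolding eq using assoc_mult_mat[OF c(5,4,1)] by simp
    qed
    finally have "?d * ?x = ?x * ?d" .
    moreover have "?d * ?x = ?x + F (s - t) * ?x"
      unfolding d using add_mult_distrib_mat[OF one_carrier_mat Fc c(5), of "s - t"] c by simp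
    moreover have "?x * ?d = ?x + ?x * F (s - t)"
      unfolding d using mult_add_distrib_mat[OF c(5) one_carrier_mat Fc, of "s - t"] c by simp
    ultimately have "?x + F (s - t) * ?x = ?x + ?x * F (s - t)" by simp
    then have comm: "F (s - t) * ?x = ?x * F (s - t)"
      using add_mat_left_cancel[OF c(5) mult_carrier_mat[OF Fc c(5)] mult_carrier_mat[OF c(5) Fc]] by blast
    \<comment> \<open>\<open>F (s - t)\<close> is nilpotent but commutes with \<open>red x\<close>,
      whose centralizer is a field; hence it is zero and \<open>s = t\<close>.\<close>
    have "F (s - t) *\<^sub>v unit_vec n 0 = 0\<^sub>v n"
      using n by (intro eq_vecI) (auto simp: F_def scalar_prod_def intro!: sum.neutral)
    then have "F (s - t) = 0\<^sub>m n n"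
      using irreducible_char_poly_singular_centralizer[OF c(5) irr Fc comm, of "unit_vec n 0"] n
      by auto
    then have "F (s - t) $$ (0, 1) = 0" using n by simp
    then show False using n that by (simp add: F_def)
  qed
  define v where "v s = \<rho> (g (lift s)) u" for s
  have uV: "u \<in> V" using u by (simp add: eigenspace_def)
  have v: "v s \<in> V\<^sub>K (z s)" for s
    unfolding v_def z_def using VK_rho[OF x gGL gGL _ _ u(1), of "lift s" "- lift s"] gg g0 by simp
  have v0: "v s \<noteq> 0" for s using rho_eq_0[OF gGL uV] u by (auto simp: v_def)
  have dist: "\<exists>h\<in>K n. kchar n (z s) h \<noteq> kchar n (z t) h" if "s \<noteq> t" for s t
    using kchar_distinct[OF zc zc distinct[OF that]] .
  have Ksub: "K n \<subseteq> carrier (GL n)" using subgroup.subset[OF subgroup_K] .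
  have inj: "inj v"
  proof (rule injI, rule ccontr)
    fix s t assume e: "v s = v t" and st: "s \<noteq> t"
    obtain h where h: "h \<in> K n" "kchar n (z s) h \<noteq> kchar n (z t) h" using dist[OF st] by blast
    have "\<rho> h (v s) = scale (kchar n (z s) h) (v s)" "\<rho> h (v t) = scale (kchar n (z t) h) (v t)"
      using v[of s] v[of t] h(1) by (auto simp: eigenspace_def)
    then have "scale (kchar n (z s) h) (v s) = scale (kchar n (z t) h) (v s)" using e by metis
    then show False using h(2) v0[of s] by (simp only: scale_cancel_right) blast
  qed
  have "\<not> dependent (range v)"
  proof
    assume "dependent (range v)"
    then obtain T c where T: "finite T" "T \<subseteq> range v" "(\<Sum>a\<in>T. scale (c a) a) = 0" "\<exists>a\<in>T. c a \<noteq> 0"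
      unfolding dependent_explicit by blast
    define I where "I = v -` T"
    have I: "finite I" "T = v ` I" using T inj by (auto simp: I_def intro: finite_vimageI)
    have "(\<Sum>s\<in>I. scale (c (v s)) (v s)) = 0"
      using T(3) inj unfolding I(2) by (simp add: sum.reindex inj_on_subset)
    then have "\<forall>s\<in>I. scale (c (v s)) (v s) = 0"
      using I(1) v dist subspace_scale[OF eigenspace_subspace[OF Ksub] v]
      by (intro distinct_eigenspaces_sum_zero[OF Ksub, where \<chi> = "\<lambda>s. kchar n (z s)"]) auto
    then show False using T(4) v0 unfolding I(2) by auto
  qed
  moreover obtain B where "finite B" "span B = V" using finite_dim by blast
  moreover have "range v \<subseteq> V" using v by (auto simp: eigenspace_def)
  ultimately have "finite (range v)" using independent_span_bound by blast
  then show ?thesis using inj finite_imageD by blast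
qed

end

section \<open>Isotypic subspaces of an irreducible representation\<close>

locale length_two_irrep = length_two_rep res w \<psi>0 n scale V \<rho> + irreducible_representation "GL n" scale V \<rho>
  for res :: "'r::comm_ring_1 \<Rightarrow> 'k::field" and w :: 'r and \<psi>0 :: "'r \<Rightarrow> complex" and n :: nat
    and scale :: "complex \<Rightarrow> 'v::ab_group_add \<Rightarrow> 'v" and V :: "'v set" and \<rho> :: "'r mat \<Rightarrow> 'v \<Rightarrow> 'v" +
  assumes finite_residue: "finite (UNIV :: 'k set)"
begin

lemma irreducible_isotypic_K:
  "y \<in> carrier_mat n n \<Longrightarrow> irreducible_isotypic (GL n) scale V \<rho> (K n) (kchar n y)"
  using isotypic_K[OF finite_residue] finite_GL[OF finite_residue] irreducible_representation_axioms
  by (simp add: irreducible_isotypic_def irreducible_isotypic_axioms_def)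

lemma red_conj_eq_iff:
  assumes y: "y \<in> carrier_mat n n" and z: "z \<in> carrier_mat n n"
    and g: "g \<in> carrier_mat n n" "h \<in> carrier_mat n n" "g * h = 1\<^sub>m n" "h * g = 1\<^sub>m n"
  shows "red (g * y * h) = red z \<longleftrightarrow> red g * red y = red z * red g"
proof -
  have c: "red g \<in> carrier_mat n n" "red h \<in> carrier_mat n n" "red y \<in> carrier_mat n n" "red z \<in> carrier_mat n n"
    using assms by auto
  have gh: "red g * red h = 1\<^sub>m n" "red h * red g = 1\<^sub>m n"
    using g by (simp_all flip: red_mult add: red_one)
  have e: "red (g * y * h) = red g * red y * red h" by (rule red_mult3[OF g(1) y g(2)])
  show ?thesis unfolding e
  proof
    assume "red g * red y * red h = red z"
    then have "red g * red y * red h * red g = red z * red g" by simp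
    then show "red g * red y = red z * red g"
      using assoc_mult_mat[OF mult_carrier_mat[OF c(1,3)] c(2,1)] gh c by simp
  next
    assume "red g * red y = red z * red g"
    then have "red g * red y * red h = red z * red g * red h" by simp
    then show "red g * red y * red h = red z"
      using assoc_mult_mat[OF c(4,1,2)] gh c by simp
  qed
qed

text \<open>Otherwise the projection onto \<open>V\<^sub>K z\<close> would kill every translate of
  \<open>u\<close>, hence all of \<open>V\<close> by irreducibility, and in particular
  \<open>v\<close>.\<close>

lemma VK_conjugate:
  assumes y: "y \<in> carrier_mat n n" and z: "z \<in> carrier_mat n n"
    and u: "u \<in> V\<^sub>K y" "u \<noteq> 0" and v: "v \<in> V\<^sub>K z" "v \<noteq> 0"
  shows "\<exists>g\<in>carrier (GL n). red g * red y = red z * red g"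
proof (rule ccontr)
  assume no: "\<not> ?thesis"
  interpret Z: irreducible_isotypic "GL n" scale V \<rho> "K n" "kchar n z"
    by (rule irreducible_isotypic_K[OF z])
  have uV: "u \<in> V" using u by (simp add: eigenspace_def)
  have zero: "Z.proj (\<rho> g u) = 0" if g: "g \<in> carrier (GL n)" for g
  proof -
    let ?h = "inv\<^bsub>GL n\<^esub> g"
    note h = GL_inv[OF g]
    have c: "g * y * ?h \<in> carrier_mat n n" using y GL_carrier_mat[OF g] GL_carrier_mat[OF h(1)] by simp
    have "red (g * y * ?h) \<noteq> red z"
      using red_conj_eq_iff[OF y z GL_carrier_mat[OF g] GL_carrier_mat[OF h(1)] h(2,3)] no g by blast
    then obtain k where "k \<in> K n" "kchar n (g * y * ?h) k \<noteq> kchar n z k"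
      using kchar_distinct[OF c z] by blast
    then show ?thesis by (rule Z.proj_other_eigenspace[OF VK_rho[OF y g h u(1)]])
  qed
  have sp: "span (\<Union>g\<in>carrier (GL n). \<rho> g ` {u}) = V"
    by (rule span_orbits[OF _ _ u(2)]) (use uV in auto)
  have "x \<in> V \<and> Z.proj x = 0" if "x \<in> span (\<Union>g\<in>carrier (GL n). \<rho> g ` {u})" for x
    using that
  proof (induction rule: span_induct_alt)
    case base
    then show ?case by (simp add: V_0 Z.proj_zero)
  next
    case (step c x y)
    then obtain g where x: "x = \<rho> g u" "g \<in> carrier (GL n)" by auto
    then have "x \<in> V" using uV rho_closed by blast
    then show ?case
      using step x zero by (simp add: Z.proj_add Z.proj_scale V_scale V_add)
  qed
  then have "Z.proj v = 0" using v sp by (auto simp: eigenspace_def)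
  then show False using Z.proj_id[OF v(1)] v(2) by simp
qed

text \<open>An element outside the stabilizer of the character carries \<open>V\<^sub>K y\<close> to
  another isotypic subspace and contributes the zero operator. An element of the stabilizer differs
  from some member of \<open>C\<close> by an element of \<open>K n\<close>, hence acts as a multiple
  of it. Thus the operators commute, which is the criterion for a line.\<close>

lemma VK_line:
  assumes y: "y \<in> carrier_mat n n"
    and C: "\<And>s t. s \<in> C \<Longrightarrow> t \<in> C \<Longrightarrow> s * t = t * s" "C \<subseteq> carrier_mat n n"
    and centralizer: "\<And>g. g \<in> carrier (GL n) \<Longrightarrow> red g * red y = red y * red g \<Longrightarrow> \<exists>t\<in>C. red t = red g"
    and ab: "a \<in> V\<^sub>K y" "b \<in> V\<^sub>K y" "a \<noteq> 0"
  shows "\<exists>c. b = scale c a"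
proof -
  interpret Y: irreducible_isotypic "GL n" scale V \<rho> "K n" "kchar n y"
    by (rule irreducible_isotypic_K[OF y])
  define S where "S = {g \<in> carrier (GL n). red g * red y = red y * red g}"
  have outside: "Y.proj (\<rho> g e) = 0" if g: "g \<in> carrier (GL n)" "g \<notin> S" and e: "e \<in> V\<^sub>K y" for g e
  proof -
    let ?h = "inv\<^bsub>GL n\<^esub> g"
    note h = GL_inv[OF g(1)]
    have c: "g * y * ?h \<in> carrier_mat n n" using y GL_carrier_mat[OF g(1)] GL_carrier_mat[OF h(1)] by simp
    have "red (g * y * ?h) \<noteq> red y"
      using red_conj_eq_iff[OF y y GL_carrier_mat[OF g(1)] GL_carrier_mat[OF h(1)] h(2,3)] g by (auto simp: S_def)
    then obtain k where "k \<in> K n" "kchar n (g * y * ?h) k \<noteq> kchar n y k"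
      using kchar_distinct[OF c y] by blast
    then show ?thesis by (rule Y.proj_other_eigenspace[OF VK_rho[OF y g(1) h e]])
  qed
  have stable: "\<rho> g e \<in> V\<^sub>K y" if g: "g \<in> S" and e: "e \<in> V\<^sub>K y" for g e
  proof -
    have g': "g \<in> carrier (GL n)" using g by (simp add: S_def)
    let ?h = "inv\<^bsub>GL n\<^esub> g"
    note h = GL_inv[OF g']
    have c: "g * y * ?h \<in> carrier_mat n n" using y GL_carrier_mat[OF g'] GL_carrier_mat[OF h(1)] by simp
    have "red (g * y * ?h) = red y"
      using red_conj_eq_iff[OF y y GL_carrier_mat[OF g'] GL_carrier_mat[OF h(1)] h(2,3)] g by (auto simp: S_def)
    then show ?thesis using VK_rho[OF y g' h e] VK_cong[OF c y] by simp
  qed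
  have scalar: "\<exists>t\<in>C. t \<in> carrier (GL n) \<and> t \<in> S \<and> (\<exists>l. \<forall>e\<in>V\<^sub>K y. \<rho> g e = scale l (\<rho> t e))" if g: "g \<in> S" for g
  proof -
    have g': "g \<in> carrier (GL n)" "red g * red y = red y * red g" using g by (auto simp: S_def)
    obtain t where t: "t \<in> C" "red t = red g" using centralizer[OF g'] by blast
    have tc: "t \<in> carrier_mat n n" using t C by blast
    have tGL: "t \<in> carrier (GL n)" using GL_of_red[OF tc] det_red_GL[OF g'(1)] t by simp
    note t' = GL_inv[OF tGL]
    let ?t' = "inv\<^bsub>GL n\<^esub> t"
    have t'c: "?t' \<in> carrier_mat n n" by (rule GL_carrier_mat[OF t'(1)])
    have gc: "g \<in> carrier_mat n n" by (rule GL_carrier_mat[OF g'(1)])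
    have "red (?t' * g) = red (?t' * t)" using t t'c tc gc by (simp add: red_mult[of _ n n])
    then have "red (?t' * g) = 1\<^sub>m n" using t'(3) red_one by simp
    then obtain A where A: "A \<in> carrier_mat n n" "?t' * g = kmat n A"
      using kmat_of_red_one[of "?t' * g" n] t'c gc by auto
    have "t * kmat n A = g"
      unfolding A(2)[symmetric] using assoc_mult_mat[OF tc t'c gc] t'(2) gc by simp
    then have "\<rho> g e = scale (\<psi>0 (w * mat_tr (y * A))) (\<rho> t e)" if "e \<in> V\<^sub>K y" for e
      using that rho_mult_GL[OF tGL kmat_GL[OF A(1)], of e] A(1) tGL
      by (auto simp: VK_iff[OF y] rho_scale)
    moreover have "t \<in> S" using tGL t g'(2) by (simp add: S_def)
    ultimately show ?thesis using t tGL by blast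
  qed
  show ?thesis
  proof (rule Y.multiplicity_one[OF _ ab])
    fix g h :: "'r mat" and e assume gh: "g \<in> carrier (GL n)" "h \<in> carrier (GL n)" and e: "e \<in> V\<^sub>K y"
    have pE: "Y.proj (\<rho> g e) \<in> V\<^sub>K y" if "g \<in> carrier (GL n)" for g :: "'r mat"
      using e that Y.E_subset rho_closed by (blast intro: Y.proj_in_E)
    show "Y.proj (\<rho> g (Y.proj (\<rho> h e))) = Y.proj (\<rho> h (Y.proj (\<rho> g e)))"
    proof (cases "g \<in> S \<and> h \<in> S")
      case True
      then have gS: "g \<in> S" and hS: "h \<in> S" by auto
      obtain t l where t: "t \<in> C" "t \<in> carrier (GL n)" "t \<in> S" "\<And>e. e \<in> V\<^sub>K y \<Longrightarrow> \<rho> g e = scale l (\<rho> t e)"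
        using scalar[OF gS] by blast
      obtain s m where s: "s \<in> C" "s \<in> carrier (GL n)" "s \<in> S" "\<And>e. e \<in> V\<^sub>K y \<Longrightarrow> \<rho> h e = scale m (\<rho> s e)"
        using scalar[OF hS] by blast
      have eV: "e \<in> V" using e Y.E_subset by blast
      have "\<rho> g (\<rho> h e) = scale l (\<rho> t (scale m (\<rho> s e)))" using t(4)[OF stable[OF hS e]] s(4)[OF e] by simp
      also have "\<dots> = scale (l * m) (\<rho> (t * s) e)"
        using t s eV by (simp add: rho_scale rho_closed rho_mult_GL)
      also have "\<dots> = scale m (\<rho> s (scale l (\<rho> t e)))"
        using t s eV C(1)[of t s] by (simp add: rho_scale rho_closed rho_mult_GL mult.commute)
      also have "\<dots> = \<rho> h (\<rho> g e)" using s(4)[OF stable[OF gS e]] t(4)[OF e] by simp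
      finally show ?thesis
        using Y.proj_id[OF stable[OF gS e]] Y.proj_id[OF stable[OF hS e]] by simp
    next
      case False
      have "Y.proj (\<rho> g (Y.proj (\<rho> h e))) = 0" if "g \<notin> S \<or> h \<notin> S" "g \<in> carrier (GL n)" "h \<in> carrier (GL n)" for g h :: "'r mat"
        using that(1)
      proof
        assume "g \<notin> S"
        then show ?thesis using outside[OF that(2) _ pE[OF that(3)]] by blast
      next
        assume "h \<notin> S"
        then show ?thesis using outside[OF that(3) _ e] that(2) by (simp add: rho_zero Y.proj_zero)
      qed
      then show ?thesis using False gh by metis
    qed
  qed
qed

end

section \<open>Equivariant functionals\<close>

lemma four_block_2_closed [simp]:
  "A \<in> carrier_mat 2 2 \<Longrightarrow> D \<in> carrier_mat 2 2 \<Longrightarrow> four_block_mat A B C D \<in> carrier_mat 4 4"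
  using four_block_carrier_mat[of A 2 2 D 2 2 B C] by simp

lemma four_block_2_mult:
  fixes A :: "'a::semiring_0 mat"
  assumes "A \<in> carrier_mat 2 2" "B \<in> carrier_mat 2 2" "C \<in> carrier_mat 2 2" "D \<in> carrier_mat 2 2"
    "A' \<in> carrier_mat 2 2" "B' \<in> carrier_mat 2 2" "C' \<in> carrier_mat 2 2" "D' \<in> carrier_mat 2 2"
  shows "four_block_mat A B C D * four_block_mat A' B' C' D' =
    four_block_mat (A * A' + B * C') (A * B' + B * D') (C * A' + D * C') (C * B' + D * D')"
  by (rule mult_four_block_mat[of _ 2 2 _ 2 _ 2 _ _ 2 _ 2]) (use assms in auto)

lemma mat_tr_four_block_2:
  assumes "A \<in> carrier_mat 2 2" "D \<in> carrier_mat 2 2"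
  shows "mat_tr (four_block_mat A B C D) = mat_tr A + mat_tr D"
proof -
  have "{..<4} = {0, 1, 2, 3::nat}" by auto
  then show ?thesis using assms by (simp add: mat_tr_def numeral_2_eq_2 add.assoc)
qed

lemma unip_closed [simp]: "X \<in> carrier_mat 2 2 \<Longrightarrow> unip X \<in> carrier_mat 4 4"
  by (simp add: unip_def)

lemma unip_mult:
  assumes "X \<in> carrier_mat 2 2" "Y \<in> carrier_mat 2 2"
  shows "unip X * unip Y = unip (X + Y)"
  unfolding unip_def using assms comm_add_mat[OF assms] by (simp add: four_block_2_mult)

lemma unip_0: "unip (0\<^sub>m 2 2) = 1\<^sub>m 4"
  by (simp add: unip_def)

lemma unip_uminus:
  assumes "X \<in> carrier_mat 2 2"
  shows "unip X * unip (- X) = 1\<^sub>m 4" "unip (- X) * unip X = 1\<^sub>m 4"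
  using assms comm_add_mat[of X 2 2 "- X"] by (simp_all add: unip_mult unip_0 uminus_l_inv_mat)

lemma unip_GL: "X \<in> carrier_mat 2 2 \<Longrightarrow> unip X \<in> carrier (GL 4)"
  unfolding carrier_GL using unip_uminus[of X] by (intro conjI bexI[of _ "unip (- X)"]) auto

lemma diag_embed_closed [simp]: "g \<in> carrier_mat 2 2 \<Longrightarrow> diag_embed g \<in> carrier_mat 4 4"
  by (simp add: diag_embed_def)

lemma diag_embed_mult:
  "g \<in> carrier_mat 2 2 \<Longrightarrow> h \<in> carrier_mat 2 2 \<Longrightarrow> diag_embed g * diag_embed h = diag_embed (g * h)"
  by (simp add: diag_embed_def four_block_2_mult)

lemma diag_embed_1: "diag_embed (1\<^sub>m 2) = 1\<^sub>m 4"
  by (simp add: diag_embed_def)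

lemma diag_embed_GL: "g \<in> carrier (GL 2) \<Longrightarrow> diag_embed g \<in> carrier (GL 4)"
  unfolding carrier_GL using diag_embed_1
  by (metis diag_embed_closed diag_embed_mult)

lemma diag_embed_block_companion:
  assumes g: "g \<in> carrier_mat 2 2" "h \<in> carrier_mat 2 2" "g * h = 1\<^sub>m 2"
    and bd: "b \<in> carrier_mat 2 2" "d \<in> carrier_mat 2 2"
  shows "diag_embed g * block_companion b d * diag_embed h = block_companion (g * b * h) (g * d * h)"
  using g bd by (simp add: diag_embed_def block_companion_def four_block_2_mult)

lemma poly_mat_hom_lift:
  assumes A: "A \<in> carrier_mat n n"
  shows "length_two_ring res w \<Longrightarrow> \<exists>q. map_mat res (poly_mat A q) = poly_mat (map_mat res A) p"
proof (induction p)
  case 0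
  interpret length_two_ring res w by fact
  have "red A \<in> carrier_mat n n" using A by simp
  then have "red (poly_mat A 0) = poly_mat (red A) 0"
    by (simp add: poly_mat_0[OF A] poly_mat_0) (auto intro: eq_matI simp: res_0)
  then show ?case by blast
next
  case (pCons a p)
  interpret length_two_ring res w by fact
  have rA: "red A \<in> carrier_mat n n" using A by simp
  obtain q where q: "red (poly_mat A q) = poly_mat (red A) p" using pCons by blast
  obtain c where c: "res c = a" using res_surj by (metis surjD)
  have "red (A * poly_mat A q) = red A * poly_mat (red A) p"
    using red_mult[OF A poly_mat_closed[OF A]] q by simp
  moreover have "red (c \<cdot>\<^sub>m 1\<^sub>m n + A * poly_mat A q) = a \<cdot>\<^sub>m 1\<^sub>m n + red (A * poly_mat A q)"
    using A poly_mat_dim[OF A] by (intro eq_matI) (auto simp: res_add res_mult res_0 res_1 c)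
  ultimately have "red (poly_mat A (pCons c q)) = poly_mat (red A) (pCons a p)"
    by (simp only: poly_mat_pCons[OF A] poly_mat_pCons[OF rA])
  then show ?case by blast
qed

text \<open>A nonscalar two by two matrix is cyclic, so its centralizer is spanned by 1 and
  \<open>d\<close>. The characteristic polynomial of \<open>d\<close> may be reducible here, unlike
  that of \<open>y\<close>.\<close>

lemma centralizer_nonscalar:
  fixes d :: "'a::field mat"
  assumes c: "d \<in> carrier_mat 2 2" "g \<in> carrier_mat 2 2" and ns: "nonscalar d" and comm: "g * d = d * g"
  shows "\<exists>a b. g = a \<cdot>\<^sub>m 1\<^sub>m 2 + b \<cdot>\<^sub>m d"
proof -
  have e: "(g * d) $$ (i, j) = (d * g) $$ (i, j)" for i j using comm by simp
  have E: "g $$ (0,1) * d $$ (1,0) = d $$ (0,1) * g $$ (1,0)"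
    "g $$ (0,0) * d $$ (0,1) + g $$ (0,1) * d $$ (1,1) = d $$ (0,0) * g $$ (0,1) + d $$ (0,1) * g $$ (1,1)"
    "g $$ (1,0) * d $$ (0,0) + g $$ (1,1) * d $$ (1,0) = d $$ (1,0) * g $$ (0,0) + d $$ (1,1) * g $$ (1,0)"
    using e[of 0 0] e[of 0 1] e[of 1 0] c by (simp_all add: mat2_mult_index mult.commute del: index_mult_mat(1))
  have *: "\<exists>a b. g = a \<cdot>\<^sub>m 1\<^sub>m 2 + b \<cdot>\<^sub>m d" if "g $$ (0,1) = b * d $$ (0,1)" "g $$ (1,0) = b * d $$ (1,0)"
      "g $$ (0,0) - g $$ (1,1) = b * (d $$ (0,0) - d $$ (1,1))" for b
  proof -
    have "g = (g $$ (0,0) - b * d $$ (0,0)) \<cdot>\<^sub>m 1\<^sub>m 2 + b \<cdot>\<^sub>m d"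
      using c that by (simp add: mat2_eq_iff) (simp add: algebra_simps)
    then show ?thesis by blast
  qed
  consider "d $$ (0,1) \<noteq> 0" | "d $$ (1,0) \<noteq> 0" | "d $$ (0,0) \<noteq> d $$ (1,1)" "d $$ (0,1) = 0" "d $$ (1,0) = 0"
    using ns by (auto simp: nonscalar_def)
  then show ?thesis
  proof cases
    case 1
    then show ?thesis using E by (intro *[of "g $$ (0,1) / d $$ (0,1)"]) (auto simp: field_simps)
  next
    case 2
    then show ?thesis using E by (intro *[of "g $$ (1,0) / d $$ (1,0)"]) (auto simp: field_simps)
  next
    case 3
    then have "g $$ (0,1) = 0" "g $$ (1,0) = 0" using E by (auto simp: mult.commute)
    then show ?thesis using 3
      by (intro *[of "(g $$ (0,0) - g $$ (1,1)) / (d $$ (0,0) - d $$ (1,1))"]) auto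
  qed
qed

section \<open>Linear maps equivariant under N and GL_2\<close>

locale cuspidal_pair = length_two_char res w \<psi>0 +
    P: length_two_irrep res w \<psi>0 4 scaleV V \<pi> + S: length_two_irrep res w \<psi>0 2 scaleU U \<sigma>
  for res :: "'r::comm_ring_1 \<Rightarrow> 'k::field" and w :: 'r and \<psi>0 :: "'r \<Rightarrow> complex"
    and scaleV :: "complex \<Rightarrow> 'v::ab_group_add \<Rightarrow> 'v" and V :: "'v set" and \<pi> :: "'r mat \<Rightarrow> 'v \<Rightarrow> 'v"
    and scaleU :: "complex \<Rightarrow> 'u::ab_group_add \<Rightarrow> 'u" and U :: "'u set" and \<sigma> :: "'r mat \<Rightarrow> 'u \<Rightarrow> 'u" +
  fixes x :: "'r mat" and v\<^sub>x :: 'v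
  assumes x: "x \<in> carrier_mat 4 4" and irr: "Factorial_Ring.irreducible (char_poly (red x))"
    and vx: "v\<^sub>x \<in> eigenspace scaleV V \<pi> (K 4) (kchar 4 x)" "v\<^sub>x \<noteq> 0"
begin

text \<open>Such maps are the homomorphisms to \<sigma> from the twisted coinvariants, the largest
  quotient of \<open>V\<close> on which \<open>N\<close> acts through \<psi>; isotypic vectors of
  \<open>K 4\<close> have images there, while they need not be twisted invariants.\<close>

definition equivariant :: "('v \<Rightarrow> 'u) \<Rightarrow> bool" where
  "equivariant F \<longleftrightarrow> (\<forall>v\<in>V. F v \<in> U) \<and> (\<forall>v\<in>V. \<forall>v'\<in>V. F (v + v') = F v + F v') \<and>
     (\<forall>c. \<forall>v\<in>V. F (scaleV c v) = scaleU c (F v)) \<and>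
     (\<forall>X\<in>carrier_mat 2 2. \<forall>v\<in>V. F (\<pi> (unip X) v) = scaleU (\<psi>0 (mat_tr X)) (F v)) \<and>
     (\<forall>g\<in>carrier (GL 2). \<forall>v\<in>V. F (\<pi> (diag_embed g) v) = \<sigma> g (F v))"

lemma VK_subset: "v \<in> P.V\<^sub>K y \<Longrightarrow> v \<in> V"
  by (simp add: eigenspace_def)

lemma equivariant_zero:
  assumes "equivariant F"
  shows "F 0 = 0"
proof -
  have "F (scaleV 0 0) = scaleU 0 (F 0)" using assms P.V_0 unfolding equivariant_def by blast
  then show ?thesis by simp
qed

lemma red_block_companion:
  "b \<in> carrier_mat 2 2 \<Longrightarrow> d \<in> carrier_mat 2 2 \<Longrightarrow> red (block_companion b d) = block_companion (red b) (red d)"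
  unfolding block_companion_def by (subst map_four_block_mat) (auto simp: red_one res_0 intro!: cong_four_block_mat eq_matI)

lemma char_poly_red_conj:
  assumes "y \<in> carrier_mat n n" "g \<in> carrier_mat n n" "h \<in> carrier_mat n n" "g * h = 1\<^sub>m n" "h * g = 1\<^sub>m n"
  shows "char_poly (red (g * y * h)) = char_poly (red y)"
proof (rule char_poly_similar)
  have "red g * red h = 1\<^sub>m n" "red h * red g = 1\<^sub>m n"
    using red_mult[OF assms(2,3)] red_mult[OF assms(3,2)] assms(4,5) red_one by simp_all
  then have "similar_mat_wit (red (g * y * h)) (red y) (red g) (red h)"
    by (rule similar_mat_witI) (use assms red_mult3[OF assms(2,1,3)] in auto)
  then show "similar_mat (red (g * y * h)) (red y)" unfolding similar_mat_def by blast
qed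

lemma mat_tr_red: "A \<in> carrier_mat n n \<Longrightarrow> mat_tr (red A) = res (mat_tr A)"
  by (simp add: mat_tr_def res.hom_sum)

text \<open>The orbit of \<open>v\<^sub>x\<close> spans \<open>V\<close>, so \<open>F\<close> is
  nonzero on some isotypic vector, with parameter \<open>y\<close>. The subgroup
  \<open>N \<inter> K 4\<close> then forces the lower left block of \<open>y\<close> to reduce to 1,
  and conjugation inside \<open>N\<close> clears the upper left block.\<close>

lemma nonzero_at_block_companion:
  assumes F: "equivariant F" and nz: "v0 \<in> V" "F v0 \<noteq> 0"
  shows "\<exists>b\<in>carrier_mat 2 2. \<exists>d\<in>carrier_mat 2 2. \<exists>v\<in>P.V\<^sub>K (block_companion b d).
    F v \<noteq> 0 \<and> char_poly (red (block_companion b d)) = char_poly (red x)"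
proof -
  have vxV: "v\<^sub>x \<in> V" using vx by (simp add: eigenspace_def)
  have "\<exists>g\<in>carrier (GL 4). F (\<pi> g v\<^sub>x) \<noteq> 0"
  proof (rule ccontr)
    assume "\<not> ?thesis"
    then have z: "F (\<pi> g v\<^sub>x) = 0" if "g \<in> carrier (GL 4)" for g using that by blast
    have sp: "P.span (\<Union>g\<in>carrier (GL 4). \<pi> g ` {v\<^sub>x}) = V"
      by (rule P.span_orbits[OF _ _ vx(2)]) (use vxV in auto)
    have "v \<in> V \<and> F v = 0" if "v \<in> P.span (\<Union>g\<in>carrier (GL 4). \<pi> g ` {v\<^sub>x})" for v
      using that
    proof (induction rule: P.span_induct_alt)
      case base
      then show ?case using P.V_0 equivariant_zero[OF F] by simp
    next
      case (step c a b)
      then obtain g where a: "a = \<pi> g v\<^sub>x" "g \<in> carrier (GL 4)" by auto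
      have aV: "a \<in> V" using a vxV P.rho_closed by blast
      have "F (scaleV c a + b) = scaleU c (F a) + F b"
        using F aV step P.V_scale unfolding equivariant_def by metis
      then show ?case using step a z aV by (simp add: P.V_add P.V_scale)
    qed
    then show False using nz sp by blast
  qed
  then obtain g where g: "g \<in> carrier (GL 4)" "F (\<pi> g v\<^sub>x) \<noteq> 0" by blast
  define h where "h = inv\<^bsub>GL 4\<^esub> g"
  note h = GL_inv[OF g(1), folded h_def]
  define v where "v = \<pi> g v\<^sub>x"
  define y where "y = g * x * h"
  have v: "v \<in> P.V\<^sub>K y" unfolding v_def y_def by (rule P.VK_rho[OF x g(1) h vx(1)])
  have y: "y \<in> carrier_mat 4 4" using x GL_carrier_mat[OF g(1)] GL_carrier_mat[OF h(1)] by (simp add: y_def)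
  have cy: "char_poly (red y) = char_poly (red x)"
    unfolding y_def by (rule char_poly_red_conj[OF x GL_carrier_mat[OF g(1)] GL_carrier_mat[OF h(1)] h(2,3)])
  obtain A B C D where s: "split_block y 2 2 = (A, B, C, D)" by (metis prod_cases4)
  have dims: "dim_row y = 2 + 2" "dim_col y = 2 + 2" using y by auto
  note blk = split_block[OF s dims]
  have ABCD: "A \<in> carrier_mat 2 2" "B \<in> carrier_mat 2 2" "C \<in> carrier_mat 2 2" "D \<in> carrier_mat 2 2"
    and yb: "y = four_block_mat A B C D"
    using blk by auto
  \<comment> \<open>\<open>unip (w X)\<close> lies both in \<open>N\<close> and in
    \<open>K 4\<close>. It acts on \<open>v\<close> through the character of \<open>y\<close>, and
    \<open>F\<close> turns it into \<psi>; since \<open>F v\<close> is nonzero, the two values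
    agree.\<close>
  have "\<psi>0 (w * mat_tr (C * X)) = \<psi>0 (w * mat_tr (1\<^sub>m 2 * X))" if X: "X \<in> carrier_mat 2 2" for X
  proof -
    let ?X = "four_block_mat (0\<^sub>m 2 2) X (0\<^sub>m 2 2) (0\<^sub>m 2 2)"
    have u: "unip (w \<cdot>\<^sub>m X) = kmat 4 ?X"
      using X by (intro eq_matI) (auto simp: unip_def kmat_def)
    have "y * ?X = four_block_mat (0\<^sub>m 2 2) (A * X) (0\<^sub>m 2 2) (C * X)"
      unfolding yb using ABCD X by (simp add: four_block_2_mult)
    then have t: "mat_tr (y * ?X) = mat_tr (C * X)"
      using ABCD X by (simp add: mat_tr_four_block_2) (simp add: mat_tr_def)
    have "\<pi> (unip (w \<cdot>\<^sub>m X)) v = scaleV (\<psi>0 (w * mat_tr (C * X))) v"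
      using v X unfolding u by (simp add: P.VK_iff[OF y] t)
    then have "F (\<pi> (unip (w \<cdot>\<^sub>m X)) v) = scaleU (\<psi>0 (w * mat_tr (C * X))) (F v)"
      using F VK_subset[OF v] by (simp add: equivariant_def)
    moreover have "F (\<pi> (unip (w \<cdot>\<^sub>m X)) v) = scaleU (\<psi>0 (mat_tr (w \<cdot>\<^sub>m X))) (F v)"
      using F VK_subset[OF v] X by (simp add: equivariant_def)
    moreover have "mat_tr (w \<cdot>\<^sub>m X) = w * mat_tr X" using X by (simp add: mat_tr_def sum_distrib_left)
    ultimately show ?thesis using g(2) X by (simp add: v_def)
  qed
  then have "red C = red (1\<^sub>m 2)" by (intro trace_pairing_nondegenerate[OF ABCD(3) one_carrier_mat])
  then have C1: "red C = 1\<^sub>m 2" by (simp add: red_one)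
  \<comment> \<open>The isotypic subspace depends only on the residue of \<open>y\<close>, so the
    block may be replaced by 1 itself.\<close>
  define y' where "y' = four_block_mat A B (1\<^sub>m 2) D"
  have y': "y' \<in> carrier_mat 4 4" using ABCD by (simp add: y'_def)
  have ry': "red y = red y'"
    unfolding yb y'_def using ABCD by (simp add: map_four_block_mat[of _ 2 2 _ 2 _ 2] C1 red_one)
  then have v': "v \<in> P.V\<^sub>K y'" using v P.VK_cong[OF y y'] by simp
  have mA: "- A \<in> carrier_mat 2 2" using ABCD by simp
  \<comment> \<open>The blocks left after conjugating \<open>y'\<close> by
    \<open>unip (- A)\<close>.\<close>
  define b where "b = B - A * D"
  define d where "d = A + D"
  have bd: "b \<in> carrier_mat 2 2" "d \<in> carrier_mat 2 2" using ABCD by (auto simp: b_def d_def)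
  have "unip (- A) * y' = four_block_mat (0\<^sub>m 2 2) b (1\<^sub>m 2) D"
  proof -
    have "A + - A * 1\<^sub>m 2 = 0\<^sub>m 2 2" "B + - A * D = b" using ABCD by (auto simp: b_def intro!: eq_matI)
    then show ?thesis unfolding unip_def y'_def using ABCD mA by (simp add: four_block_2_mult)
  qed
  then have conj: "unip (- A) * y' * unip A = block_companion b d"
    using ABCD bd unfolding unip_def block_companion_def
    by (simp add: four_block_2_mult d_def)
  have uu: "unip (- A) * unip A = 1\<^sub>m 4" "unip A * unip (- A) = 1\<^sub>m 4"
    using unip_uminus[OF ABCD(1)] by auto
  have "\<pi> (unip (- A)) v \<in> P.V\<^sub>K (block_companion b d)"
    using P.VK_rho[OF y' unip_GL[OF mA] unip_GL[OF ABCD(1)] uu v'] by (simp add: conj)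
  moreover have "F (\<pi> (unip (- A)) v) = scaleU (\<psi>0 (mat_tr (- A))) (F v)"
    using F VK_subset[OF v] mA unfolding equivariant_def by blast
  then have "F (\<pi> (unip (- A)) v) \<noteq> 0" using g(2) \<psi>0_nonzero by (simp add: v_def)
  moreover have "char_poly (red (block_companion b d)) = char_poly (red x)"
    using char_poly_red_conj[OF y' unip_closed[OF mA] unip_closed[OF ABCD(1)] uu] cy ry' by (simp add: conj)
  ultimately show ?thesis using bd by blast
qed

text \<open>\<open>diag_embed\<close> sends \<open>kmat 2 A\<close> into \<open>K 4\<close>, where
  the trace pairing with \<open>block_companion b d\<close> sees only
  \<open>tr (d A)\<close>.\<close>

lemma equivariant_VK:
  assumes F: "equivariant F" and bd: "b \<in> carrier_mat 2 2" "d \<in> carrier_mat 2 2"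
    and v: "v \<in> P.V\<^sub>K (block_companion b d)"
  shows "F v \<in> S.V\<^sub>K d"
proof -
  have vV: "v \<in> V" by (rule VK_subset[OF v])
  have "\<sigma> (kmat 2 A) (F v) = scaleU (\<psi>0 (w * mat_tr (d * A))) (F v)" if A: "A \<in> carrier_mat 2 2" for A
  proof -
    let ?A = "four_block_mat A (0\<^sub>m 2 2) (0\<^sub>m 2 2) A"
    have k: "diag_embed (kmat 2 A) = kmat 4 ?A"
      using A by (intro eq_matI) (auto simp: diag_embed_def kmat_def)
    have "block_companion b d * ?A = four_block_mat (0\<^sub>m 2 2) (b * A) A (d * A)"
      unfolding block_companion_def using bd A by (simp add: four_block_2_mult)
    then have "mat_tr (block_companion b d * ?A) = mat_tr (d * A)"
      using bd A by (simp add: mat_tr_four_block_2) (simp add: mat_tr_def)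
    then have "\<pi> (diag_embed (kmat 2 A)) v = scaleV (\<psi>0 (w * mat_tr (d * A))) v"
      using v A bd unfolding k by (simp add: P.VK_iff)
    moreover have "F (\<pi> (diag_embed (kmat 2 A)) v) = \<sigma> (kmat 2 A) (F v)"
      using F vV kmat_GL[OF A] unfolding equivariant_def by blast
    ultimately show ?thesis using F vV by (simp add: equivariant_def)
  qed
  moreover have "F v \<in> U" using F vV by (simp add: equivariant_def)
  ultimately show ?thesis by (simp add: S.VK_iff[OF bd(2)])
qed

lemma VK_diag_embed:
  assumes g: "g \<in> carrier (GL 2)" and bd: "b \<in> carrier_mat 2 2" "d \<in> carrier_mat 2 2"
    and bd': "b' \<in> carrier_mat 2 2" "d' \<in> carrier_mat 2 2"
    and conj: "red g * red b = red b' * red g" "red g * red d = red d' * red g"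
    and v: "v \<in> P.V\<^sub>K (block_companion b d)"
  shows "\<pi> (diag_embed g) v \<in> P.V\<^sub>K (block_companion b' d')"
proof -
  define h where "h = inv\<^bsub>GL 2\<^esub> g"
  note h = GL_inv[OF g, folded h_def]
  note c = GL_carrier_mat[OF g] GL_carrier_mat[OF h(1)]
  have m: "diag_embed g * diag_embed h = 1\<^sub>m 4" "diag_embed h * diag_embed g = 1\<^sub>m 4"
    using c h by (simp_all add: diag_embed_mult diag_embed_1)
  have cc: "g * b * h \<in> carrier_mat 2 2" "g * d * h \<in> carrier_mat 2 2" using c bd by auto
  have "\<pi> (diag_embed g) v \<in> P.V\<^sub>K (block_companion (g * b * h) (g * d * h))"
    using P.VK_rho[OF block_companion_closed[OF bd] diag_embed_GL[OF g] diag_embed_GL[OF h(1)] m v]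
    by (simp add: diag_embed_block_companion[OF c h(2) bd])
  moreover have "red (block_companion (g * b * h) (g * d * h)) = red (block_companion b' d')"
    using S.red_conj_eq_iff[OF bd(1) bd'(1) c h(2,3)] S.red_conj_eq_iff[OF bd(2) bd'(2) c h(2,3)] conj
    by (simp add: red_block_companion cc bd')
  ultimately show ?thesis using P.VK_cong cc bd' block_companion_closed by metis
qed

text \<open>Modulo \<open>w\<close> every matrix commuting with the block companion matrix is a
  polynomial in it; lifting the coefficients gives a commuting family over the ring.\<close>

lemma VK_block_companion_line:
  assumes bd: "b \<in> carrier_mat 2 2" "d \<in> carrier_mat 2 2"
    and irr: "Factorial_Ring.irreducible (char_poly (red (block_companion b d)))"
    and ab: "v \<in> P.V\<^sub>K (block_companion b d)" "v' \<in> P.V\<^sub>K (block_companion b d)" "v \<noteq> 0"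
  shows "\<exists>c. v' = scaleV c v"
proof (rule P.VK_line[OF block_companion_closed[OF bd] _ _ _ ab, where C = "range (poly_mat (block_companion b d))"])
  let ?y = "block_companion b d"
  have y: "?y \<in> carrier_mat 4 4" using bd by simp
  then have ry: "red ?y \<in> carrier_mat 4 4" by simp
  show "s * t = t * s" if "s \<in> range (poly_mat ?y)" "t \<in> range (poly_mat ?y)" for s t
    using that poly_mat_commute[OF y] by auto
  show "range (poly_mat ?y) \<subseteq> carrier_mat 4 4" using poly_mat_closed[OF y] by auto
  fix g assume g: "g \<in> carrier (GL 4)" "red g * red ?y = red ?y * red g"
  have "red g \<in> carrier_mat 4 4" using GL_carrier_mat[OF g(1)] by simp
  then obtain p where "red g = poly_mat (red ?y) p"
    using irreducible_char_poly_centralizer[OF ry irr] g(2) by blast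
  then show "\<exists>t\<in>range (poly_mat ?y). red t = red g"
    using poly_mat_hom_lift[OF y length_two_ring_axioms, of p] by auto
qed

text \<open>Any isotypic vector of block companion type where \<open>F\<close> is nonzero can be
  moved by \<open>GL 2\<close> to a multiple of \<open>v\<close>. The nonzero value
  \<open>F1 v\<close> shows that the character of \<open>d\<close> occurs in \<sigma>.\<close>

lemma equivariant_determined:
  assumes F1: "equivariant F1" and F: "equivariant F"
    and bd: "b \<in> carrier_mat 2 2" "d \<in> carrier_mat 2 2"
    and cp: "char_poly (red (block_companion b d)) = char_poly (red x)"
    and v: "v \<in> P.V\<^sub>K (block_companion b d)" "F1 v \<noteq> 0"
    and zero: "F v = 0"
  shows "\<forall>u\<in>V. F u = 0"
proof (rule ccontr)
  assume "\<not> ?thesis"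
  then obtain b' d' v' where bd': "b' \<in> carrier_mat 2 2" "d' \<in> carrier_mat 2 2"
    and v': "v' \<in> P.V\<^sub>K (block_companion b' d')" "F v' \<noteq> 0"
    and cp': "char_poly (red (block_companion b' d')) = char_poly (red x)"
    using nonzero_at_block_companion[OF F] by blast
  have v0: "v \<noteq> 0" using v equivariant_zero[OF F1] by auto
  \<comment> \<open>The characters of \<open>d\<close> and \<open>d'\<close> both occur in the
    irreducible \<sigma>, hence are conjugate.\<close>
  obtain g where g: "g \<in> carrier (GL 2)" "red g * red d' = red d * red g"
    using S.VK_conjugate[OF bd'(2) bd(2) equivariant_VK[OF F bd' v'(1)] v'(2) equivariant_VK[OF F1 bd v(1)] v(2)]
    by blast
  define h where "h = inv\<^bsub>GL 2\<^esub> g"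
  note h = GL_inv[OF g(1), folded h_def]
  note c = GL_carrier_mat[OF g(1)] GL_carrier_mat[OF h(1)]
  define b'' where "b'' = g * b' * h"
  have b'': "b'' \<in> carrier_mat 2 2" using c bd' by (simp add: b''_def)
  have gb: "red g * red b' = red b'' * red g"
    using S.red_conj_eq_iff[OF bd'(1) b'' c h(2,3)] by (simp add: b''_def)
  define v'' where "v'' = \<pi> (diag_embed g) v'"
  have v'': "v'' \<in> P.V\<^sub>K (block_companion b'' d)"
    unfolding v''_def by (rule VK_diag_embed[OF g(1) bd' b'' bd(2) gb g(2) v'(1)])
  have Fg: "F (\<pi> (diag_embed k) u) \<noteq> 0" if "k \<in> carrier (GL 2)" "u \<in> V" "F u \<noteq> 0" for k u
  proof
    assume "F (\<pi> (diag_embed k) u) = 0"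
    then have "\<sigma> k (F u) = 0" using F that by (simp add: equivariant_def)
    then show False using S.rho_eq_0[OF that(1)] F that by (simp add: equivariant_def)
  qed
  have Fv'': "F v'' \<noteq> 0" unfolding v''_def by (rule Fg[OF g(1) VK_subset[OF v'(1)] v'(2)])
  have m: "diag_embed g * diag_embed h = 1\<^sub>m 4" "diag_embed h * diag_embed g = 1\<^sub>m 4"
    using c h by (simp_all add: diag_embed_mult diag_embed_1)
  have gd: "red (g * d' * h) = red d" using S.red_conj_eq_iff[OF bd'(2) bd(2) c h(2,3)] g(2) by simp
  have gdc: "g * d' * h \<in> carrier_mat 2 2" using c bd' by simp
  have "char_poly (red (block_companion b'' d)) = char_poly (red (diag_embed g * block_companion b' d' * diag_embed h))"
    unfolding diag_embed_block_companion[OF c h(2) bd'] b''_def[symmetric]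
    by (simp add: red_block_companion b'' gdc bd gd)
  then have cp'': "char_poly (red (block_companion b'' d)) = char_poly (red x)"
    using char_poly_red_conj[OF block_companion_closed[OF bd'] diag_embed_closed[OF c(1)] diag_embed_closed[OF c(2)] m] cp'
    by simp
  have rc: "red b \<in> carrier_mat 2 2" "red b'' \<in> carrier_mat 2 2" "red d \<in> carrier_mat 2 2" using bd b'' by auto
  \<comment> \<open>With a common \<open>d\<close>, the remaining freedom is the centralizer of
    \<open>d\<close>, which is enough to carry \<open>b''\<close> to \<open>b\<close>.\<close>
  obtain s where s: "s \<in> carrier_mat 2 2" "det s \<noteq> 0" "s * red b'' = red b * s" "s * red d = red d * s"
    using block_companion_conj[OF rc(2,1,3)] cp cp'' irr
    by (auto simp: red_block_companion bd b'')
  obtain k where k: "k \<in> carrier_mat 2 2" "red k = s" using red_lift[OF s(1)] by blast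
  have kGL: "k \<in> carrier (GL 2)" using GL_of_red[OF k(1)] k(2) s(2) by simp
  have "\<pi> (diag_embed k) v'' \<in> P.V\<^sub>K (block_companion b d)"
    by (rule VK_diag_embed[OF kGL b'' bd(2) bd _ _ v'']) (use s k in auto)
  then obtain l where "\<pi> (diag_embed k) v'' = scaleV l v"
    using VK_block_companion_line[OF bd _ v(1) _ v0] irr cp by auto
  moreover have "F (\<pi> (diag_embed k) v'') \<noteq> 0" by (rule Fg[OF kGL VK_subset[OF v''] Fv''])
  moreover have "F (scaleV l v) = scaleU l (F v)" using F VK_subset[OF v(1)] by (simp add: equivariant_def)
  ultimately show False using zero by simp
qed

end

section \<open>Proportionality at a single isotypic vector\<close>

context cuspidal_pair
begin

lemma proportional_nonscalar:
  assumes d: "d \<in> carrier_mat 2 2" and ns: "nonscalar (red d)"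
    and uv: "u \<in> S.V\<^sub>K d" "u' \<in> S.V\<^sub>K d" "u \<noteq> 0"
  shows "\<exists>c. u' = scaleU c u"
proof (rule S.VK_line[OF d _ _ _ uv])
  \<comment> \<open>The centralizer of the nonscalar \<open>red d\<close> is spanned by 1 and
    \<open>red d\<close>; these combinations lift to a commuting family.\<close>
  let ?C = "{a \<cdot>\<^sub>m 1\<^sub>m 2 + b \<cdot>\<^sub>m d | a b. True}"
  show "s * t = t * s" if st: "s \<in> ?C" "t \<in> ?C" for s t
  proof -
    obtain a b a' b' where "s = a \<cdot>\<^sub>m 1\<^sub>m 2 + b \<cdot>\<^sub>m d" "t = a' \<cdot>\<^sub>m 1\<^sub>m 2 + b' \<cdot>\<^sub>m d" using st by blast
    moreover have "poly_mat d [:a, b:] = a \<cdot>\<^sub>m 1\<^sub>m 2 + b \<cdot>\<^sub>m d" for a b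
    proof -
      have "d * poly_mat d [:b:] = b \<cdot>\<^sub>m d"
        unfolding poly_mat_const[OF d] using mult_smult_distrib[OF d one_carrier_mat, of b] d by simp
      then show ?thesis by (simp only: poly_mat_pCons[OF d, of a])
    qed
    ultimately show ?thesis using poly_mat_commute[OF d] by metis
  qed
  show "?C \<subseteq> carrier_mat 2 2" using d by auto
  fix g assume g: "g \<in> carrier (GL 2)" "red g * red d = red d * red g"
  have rc: "red d \<in> carrier_mat 2 2" "red g \<in> carrier_mat 2 2" using d GL_carrier_mat[OF g(1)] by auto
  obtain a b where ab: "red g = a \<cdot>\<^sub>m 1\<^sub>m 2 + b \<cdot>\<^sub>m red d"
    using centralizer_nonscalar[OF rc ns g(2)] by blast
  obtain a' b' where ab': "res a' = a" "res b' = b" using res_surj by (metis surjD)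
  have "red (a' \<cdot>\<^sub>m 1\<^sub>m 2 + b' \<cdot>\<^sub>m d) = red g"
    unfolding ab using d by (intro eq_matI) (auto simp: ab' res_add res_mult res_0 res_1)
  then show "\<exists>t\<in>?C. red t = red g" by blast
qed

lemma det_kmat_2: "A \<in> carrier_mat 2 2 \<Longrightarrow> det (kmat 2 A) = 1 + w * mat_tr A"
proof -
  assume A: "A \<in> carrier_mat 2 2"
  have "det (kmat 2 A) = 1 + w * mat_tr A + (w * w) * det A"
    using A det_mat2[OF kmat_closed[OF A]] by (simp add: kmat_def det_mat2 mat_tr_2 algebra_simps)
  then show ?thesis by (simp add: w_w)
qed

text \<open>For \<open>d\<close> scalar modulo \<open>w\<close>, the character of \<open>d\<close>
  is trivial on the elements \<open>1 + w A\<close> of determinant one, \<open>1 + w tr A\<close>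
  being that determinant.\<close>

lemma scalar_trace:
  assumes d: "d \<in> carrier_mat 2 2" and sc: "\<not> nonscalar (red d)"
    and A: "A \<in> carrier_mat 2 2" and tr: "w * mat_tr A = 0"
  shows "w * mat_tr (d * A) = 0"
proof -
  let ?d = "d $$ (0,0) \<cdot>\<^sub>m 1\<^sub>m 2"
  have "red d = red d $$ (0,0) \<cdot>\<^sub>m 1\<^sub>m 2" using scalar_mat2[OF _ sc] d by simp
  then have "red d = red ?d"
    using d by (auto simp: res_mult res_0 res_1 mat2_eq_iff)
  then have "w * mat_tr (d * A) = w * mat_tr (?d * A)"
    using trace_pairing_cong[OF A A d] by simp
  also have "?d * A = d $$ (0,0) \<cdot>\<^sub>m A" using mult_smult_assoc_mat[OF one_carrier_mat A] A by simp
  also have "w * mat_tr (d $$ (0,0) \<cdot>\<^sub>m A) = d $$ (0,0) * (w * mat_tr A)"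
    using A by (simp add: mat_tr_2 algebra_simps)
  finally show ?thesis using tr by simp
qed

text \<open>Modulo \<open>w\<close>, every \<open>g\<close> is conjugate, by a matrix commuting with \<open>b\<close>, to its image under the
  anti-automorphism \<open>\<tau> g = m g\<^sup>T m\<^sup>-\<^sup>1\<close>, where \<open>m\<close> is symmetric and \<open>m b\<^sup>T = b m\<close>.\<close>

lemma proportional_scalar:
  assumes F: "equivariant F" "equivariant F'" and bd: "b \<in> carrier_mat 2 2" "d \<in> carrier_mat 2 2"
    and irr: "Factorial_Ring.irreducible (char_poly (red (block_companion b d)))"
    and sc: "\<not> nonscalar (red d)"
    and v: "v \<in> P.V\<^sub>K (block_companion b d)" "F v \<noteq> 0"
  shows "\<exists>c. F' v = scaleU c (F v)"
proof -
  have vV: "v \<in> V" by (rule VK_subset[OF v(1)])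
  have v0: "v \<noteq> 0" using v equivariant_zero[OF F(1)] by auto
  have rc: "red b \<in> carrier_mat 2 2" "red d \<in> carrier_mat 2 2" using bd by auto
  have red_d: "red d = red d $$ (0,0) \<cdot>\<^sub>m 1\<^sub>m 2" by (rule scalar_mat2[OF rc(2) sc])
  have comm_d: "s * red d = red d * s" if s: "s \<in> carrier_mat 2 2" for s
  proof -
    have "s * (red d $$ (0,0) \<cdot>\<^sub>m 1\<^sub>m 2) = (red d $$ (0,0) \<cdot>\<^sub>m 1\<^sub>m 2) * s"
      using mult_smult_distrib[OF s one_carrier_mat] mult_smult_assoc_mat[OF one_carrier_mat s] s by simp
    then show ?thesis by (subst (1 2) red_d)
  qed
  have free: "common_eigenvector_free (red b) (red d)"
    using block_companion_common_eigenvector_free[OF rc] irr bd by (simp add: red_block_companion)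
  \<comment> \<open>Otherwise the first unit vector would be a common eigenvector of
    \<open>b\<close> and \<open>d\<close> modulo \<open>w\<close>. That this entry is a unit makes
    \<open>m\<close> below invertible.\<close>
  have b10: "res (b $$ (1,0)) \<noteq> 0"
  proof
    assume z: "res (b $$ (1,0)) = 0"
    let ?e = "unit_vec 2 0 :: 'k vec"
    have "red b *\<^sub>v ?e = red b $$ (0,0) \<cdot>\<^sub>v ?e" "red d *\<^sub>v ?e = red d $$ (0,0) \<cdot>\<^sub>v ?e"
      using rc z bd sc by (auto simp: vec2_eq_iff mat2_mult_vec_index nonscalar_def simp del: index_mult_mat_vec)
    moreover have "?e \<noteq> 0\<^sub>v 2" by (auto simp: vec2_eq_iff)
    ultimately show False using free[unfolded common_eigenvector_free_def, rule_format, of ?e] by auto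
  qed
  \<comment> \<open>The elements of \<open>GL 2\<close> that fix the pair \<open>b\<close>,
    \<open>d\<close> modulo \<open>w\<close>, where the scalar \<open>d\<close> imposes no
    condition. This group contains \<open>K 2\<close> and acts on the line of \<open>v\<close> by a
    character \<chi>.\<close>
  define T where "T = {s \<in> carrier (GL 2). red s * red b = red b * red s}"
  have TGL: "s \<in> carrier (GL 2)" and Tc: "s \<in> carrier_mat 2 2" if "s \<in> T" for s
    using that GL_carrier_mat by (auto simp: T_def)
  have "\<exists>c. \<pi> (diag_embed s) v = scaleV c v" if s: "s \<in> T" for s
  proof -
    have "\<pi> (diag_embed s) v \<in> P.V\<^sub>K (block_companion b d)"
      by (rule VK_diag_embed[OF TGL[OF s] bd bd _ _ v(1)]) (use s Tc comm_d in \<open>auto simp: T_def\<close>)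
    then show ?thesis using VK_block_companion_line[OF bd irr v(1) _ v0] by blast
  qed
  then obtain \<chi> where \<chi>: "\<And>s. s \<in> T \<Longrightarrow> \<pi> (diag_embed s) v = scaleV (\<chi> s) v" by metis
  have T1: "1\<^sub>m 2 \<in> T"
    using rc group.is_monoid[OF group_GL] monoid.one_closed[of "GL 2 :: 'r mat monoid"]
    by (auto simp: T_def red_one)
  have Tmult: "s * t \<in> T" if st: "s \<in> T" "t \<in> T" for s t
  proof -
    have "s * t \<in> carrier (GL 2)"
      using monoid.m_closed[OF group.is_monoid[OF group_GL] TGL[OF st(1)] TGL[OF st(2)]] by simp
    moreover have "red s * red t * red b = red b * (red s * red t)"
    proof -
      have c: "red s \<in> carrier_mat 2 2" "red t \<in> carrier_mat 2 2" using Tc st by auto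
      have "red s * red t * red b = red s * (red b * red t)"
        using assoc_mult_mat[OF c rc(1)] st by (simp add: T_def)
      also have "\<dots> = red b * red s * red t"
        using assoc_mult_mat[OF c(1) rc(1) c(2)] st by (simp add: T_def)
      also have "\<dots> = red b * (red s * red t)" using assoc_mult_mat[OF rc(1) c] by simp
      finally show ?thesis .
    qed
    ultimately show ?thesis by (simp add: T_def red_mult[OF Tc[OF st(1)] Tc[OF st(2)]])
  qed
  have Tinv: "inv\<^bsub>GL 2\<^esub> s \<in> T" if s: "s \<in> T" for s
  proof -
    let ?h = "inv\<^bsub>GL 2\<^esub> s"
    note h = GL_inv[OF TGL[OF s]]
    note c = Tc[OF s] GL_carrier_mat[OF h(1)]
    have e: "red (?h * s) = 1\<^sub>m 2" using h red_one by simp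
    have rr: "red ?h * red s = 1\<^sub>m 2" using e red_mult[OF c(2,1)] by simp
    have rs: "red s \<in> carrier_mat 2 2" "red ?h \<in> carrier_mat 2 2" using c by auto
    have "red ?h * red b = red ?h * (red b * red s) * red ?h"
    proof -
      have "red s * red ?h = 1\<^sub>m 2" using h red_one red_mult[OF c] by simp
      then show ?thesis
        using assoc_mult_mat[OF rs(2) mult_carrier_mat[OF rc(1) rs(1)] rs(2)] assoc_mult_mat[OF rc(1) rs] rc(1)
        by simp
    qed
    also have "\<dots> = red b * red ?h"
      using s assoc_mult_mat[OF rs(2,1) rc(1)] rr rc(1) by (simp add: T_def)
    finally show ?thesis using h by (simp add: T_def)
  qed
  have subT: "subgroup T (GL 2)"
  proof (rule group.subgroupI[OF group_GL])
    show "T \<subseteq> carrier (GL 2)" by (auto simp: T_def)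
    show "T \<noteq> {}" using T1 by blast
  qed (use Tinv Tmult in auto)
  have \<pi>mult: "\<pi> (diag_embed (s * t)) u = \<pi> (diag_embed s) (\<pi> (diag_embed t) u)"
    if "s \<in> T" "t \<in> T" "u \<in> V" for s t u
    using that P.rho_mult_GL[OF diag_embed_GL[OF TGL] diag_embed_GL[OF TGL], of s t u]
    by (simp add: diag_embed_mult Tc)
  have \<chi>mult: "\<chi> (s * t) = \<chi> s * \<chi> t" if st: "s \<in> T" "t \<in> T" for s t
  proof -
    have "scaleV (\<chi> (s * t)) v = \<pi> (diag_embed s) (\<pi> (diag_embed t) v)"
      using \<chi>[OF Tmult[OF st]] \<pi>mult[OF st vV] by metis
    also have "\<dots> = scaleV (\<chi> t * \<chi> s) v"
      unfolding \<chi>[OF st(2)] P.rho_scale[OF diag_embed_GL[OF TGL[OF st(1)]] vV] \<chi>[OF st(1)] by simp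
    finally have "\<chi> (s * t) = \<chi> t * \<chi> s" using v0 by (simp only: P.scale_cancel_right) blast
    then show ?thesis by (simp only: mult.commute)
  qed
  have \<chi>1: "\<chi> (1\<^sub>m 2) = 1"
  proof -
    have "scaleV (\<chi> (1\<^sub>m 2)) v = scaleV 1 v"
      using \<chi>[OF T1] P.rho_one[OF vV] by (simp add: diag_embed_1)
    then show ?thesis using v0 by (simp only: P.scale_cancel_right) simp
  qed
  have \<chi>inv: "\<chi> s * \<chi> (inv\<^bsub>GL 2\<^esub> s) = 1" if s: "s \<in> T" for s
    using \<chi>mult[OF s Tinv[OF s]] GL_inv(2)[OF TGL[OF s]] \<chi>1 by simp
  interpret I: irreducible_isotypic "GL 2" scaleU U \<sigma> T \<chi>
  proof (intro irreducible_isotypic.intro isotypic.intro isotypic_axioms.intro irreducible_isotypic_axioms.intro)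
    show "finite T" using finite_subset[OF subgroup.subset[OF subT] S.finite_GL[OF S.finite_residue]] .
    show "\<chi> h \<noteq> 0" if "h \<in> T" for h using \<chi>inv[OF that] by auto
    show "\<chi> (h \<otimes>\<^bsub>GL 2\<^esub> k) = \<chi> h * \<chi> k" if "h \<in> T" "k \<in> T" for h k using \<chi>mult[OF that] by simp
    show "finite (carrier (GL 2 :: 'r mat monoid))" by (rule S.finite_GL[OF S.finite_residue])
  qed (use subT S.fd_representation_axioms S.irreducible_representation_axioms in auto)
  \<comment> \<open>Both \<open>F v\<close> and \<open>F' v\<close> thus lie in the
    \<chi>-eigenspace of \<open>T\<close> in \<open>U\<close>; it remains to see that this is a
    line.\<close>
  have FE: "G v \<in> I.E" if G: "equivariant G" for G
  proof -
    have "\<sigma> s (G v) = scaleU (\<chi> s) (G v)" if s: "s \<in> T" for s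
    proof -
      have "\<sigma> s (G v) = G (\<pi> (diag_embed s) v)" using G TGL[OF s] vV by (simp add: equivariant_def)
      then show ?thesis using \<chi>[OF s] G vV by (simp add: equivariant_def)
    qed
    then show ?thesis using G vV by (simp add: eigenspace_def equivariant_def)
  qed
  let ?c = "b $$ (1,0)"
  \<comment> \<open>The symmetric solution of \<open>b m = m b^T\<close> with lower right entry 0
    and off-diagonal entry \<open>?c\<close>. Its determinant is \<open>- ?c^2\<close>, a unit since
    \<open>?c\<close> is. This choice of \<open>m\<close> gives \<open>\<tau> b = b\<close>.\<close>
  define m where "m = mat 2 2 (\<lambda>(i, j). if i = 1 \<and> j = 1 then 0
      else if i = 0 \<and> j = 0 then b $$ (0,0) - b $$ (1,1) else ?c)"
  have mc: "m \<in> carrier_mat 2 2" by (simp add: m_def)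
  have "det (red m) = - (res ?c * res ?c)"
    by (subst det_mat2) (auto simp: m_def res_0)
  then have mGL: "m \<in> carrier (GL 2)" using GL_of_red[OF mc] b10 by simp
  define m' where "m' = inv\<^bsub>GL 2\<^esub> m"
  note m' = GL_inv[OF mGL, folded m'_def]
  note m'c = GL_carrier_mat[OF m'(1)]
  have bm: "b * m = m * transpose_mat b"
    using bd(1) mc by (auto simp: mat2_eq_iff mat2_mult_index m_def algebra_simps simp del: index_mult_mat(1))
  define \<tau> where "\<tau> g = m * transpose_mat g * m'" for g
  have \<tau>c: "\<tau> g \<in> carrier_mat 2 2" if "g \<in> carrier_mat 2 2" for g
    using that mc m'c by (simp add: \<tau>_def)
  have \<tau>mult: "\<tau> (g * h) = \<tau> h * \<tau> g" if g: "g \<in> carrier_mat 2 2" and h: "h \<in> carrier_mat 2 2" for g h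
  proof -
    let ?g = "transpose_mat g" and ?h = "transpose_mat h"
    have gh: "?g \<in> carrier_mat 2 2" "?h \<in> carrier_mat 2 2" using g h by auto
    have "\<tau> h * \<tau> g = m * ?h * (m' * (m * ?g * m'))"
      unfolding \<tau>_def using mc m'c gh by (intro assoc_mult_mat[of _ 2 2 _ 2 _ 2]) auto
    also have "m' * (m * ?g * m') = ?g * m'"
    proof -
      have "m' * (m * ?g * m') = m' * (m * (?g * m'))"
        using assoc_mult_mat[OF mc gh(1) m'c] by simp
      also have "\<dots> = ?g * m'"
        using assoc_mult_mat[OF m'c mc mult_carrier_mat[OF gh(1) m'c]] m'(3) gh(1) m'c by simp
      finally show ?thesis .
    qed
    also have "m * ?h * (?g * m') = m * (?h * ?g) * m'"
      using assoc_mult_mat[OF mult_carrier_mat[OF mc gh(2)] gh(1) m'c] assoc_mult_mat[OF mc gh(2,1)] by simp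
    finally show ?thesis using transpose_mult[OF g h] by (simp add: \<tau>_def)
  qed
  have \<tau>1: "\<tau> (1\<^sub>m 2) = 1\<^sub>m 2" using mc m'(2) by (simp add: \<tau>_def)
  have \<tau>GL: "\<tau> g \<in> carrier (GL 2)" if g: "g \<in> carrier (GL 2)" for g
  proof -
    obtain h where h: "h \<in> carrier_mat 2 2" "g * h = 1\<^sub>m 2" "h * g = 1\<^sub>m 2" using g by (auto simp: carrier_GL)
    note gc = GL_carrier_mat[OF g]
    show ?thesis unfolding carrier_GL
      using \<tau>mult[OF gc h(1)] \<tau>mult[OF h(1) gc] h \<tau>1 \<tau>c[OF gc] \<tau>c[OF h(1)] by metis
  qed
  have \<tau>inj: "inj_on \<tau> (carrier (GL 2))"
  proof (rule inj_onI)
    fix g h assume g: "g \<in> carrier (GL 2)" and h: "h \<in> carrier (GL 2)" and e: "\<tau> g = \<tau> h"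
    have "m' * \<tau> k * m = transpose_mat k" if k: "k \<in> carrier_mat 2 2" for k
    proof -
      have kt: "transpose_mat k \<in> carrier_mat 2 2" using k by simp
      have "m' * \<tau> k = transpose_mat k * m'"
        unfolding \<tau>_def using assoc_mult_mat[OF mc kt m'c]
          assoc_mult_mat[OF m'c mc mult_carrier_mat[OF kt m'c]] m'(3) kt m'c by simp
      then show ?thesis using assoc_mult_mat[OF kt m'c mc] m'(3) kt by simp
    qed
    then have "transpose_mat g = transpose_mat h" using e GL_carrier_mat g h by metis
    then show "g = h" by (metis transpose_transpose)
  qed
  have coset: "\<exists>s\<in>T. \<exists>t\<in>T. \<tau> g = s * g * t \<and> \<chi> s * \<chi> t = 1" if g: "g \<in> carrier (GL 2)" for g
  proof -
    note gc = GL_carrier_mat[OF g]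
    let ?g = "transpose_mat g"
    have gt: "?g \<in> carrier_mat 2 2" using gc by simp
    note \<tau>gc = \<tau>c[OF gc]
    \<comment> \<open>\<tau> preserves \<open>tr g\<close>, \<open>tr (b g)\<close> and
      \<open>det g\<close>. By \<open>intertwiner_nonscalar\<close>, with \<open>b\<close> now in
      the role of \<open>d\<close>, these yield an intertwiner of the form \<open>p + q b\<close>
      between the residues of \<open>g\<close> and \<open>\<tau> g\<close>.\<close>
    have "mat_tr (\<tau> g) = mat_tr (m' * (m * ?g))"
      unfolding \<tau>_def using mc gt m'c by (intro mat_tr_comm[of _ 2 2]) auto
    also have "m' * (m * ?g) = ?g" using assoc_mult_mat[OF m'c mc gt] m'(3) gt by simp
    finally have tr1: "mat_tr (\<tau> g) = mat_tr g" using gc by (simp add: mat_tr_2)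
    have "b * \<tau> g = b * m * ?g * m'"
      unfolding \<tau>_def using assoc_mult_mat[OF bd(1) mult_carrier_mat[OF mc gt] m'c] assoc_mult_mat[OF bd(1) mc gt] by simp
    also have "b * m * ?g = m * (transpose_mat b * ?g)"
      unfolding bm using assoc_mult_mat[OF mc _ gt, of "transpose_mat b"] bd(1) by simp
    also have "transpose_mat b * ?g = transpose_mat (g * b)" using transpose_mult[OF gc bd(1)] by simp
    finally have "b * \<tau> g = \<tau> (g * b)" by (simp add: \<tau>_def)
    then have "mat_tr (b * \<tau> g) = mat_tr (m * transpose_mat (g * b) * m')" by (simp add: \<tau>_def)
    also have "\<dots> = mat_tr (m' * (m * transpose_mat (g * b)))"
      using mc gc bd m'c by (intro mat_tr_comm[of _ 2 2]) auto
    also have "m' * (m * transpose_mat (g * b)) = transpose_mat (g * b)"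
      using assoc_mult_mat[OF m'c mc, of "transpose_mat (g * b)" 2] m'(3) gc bd(1) by simp
    also have "mat_tr (transpose_mat (g * b)) = mat_tr (g * b)"
      using gc bd(1) by (simp add: mat_tr_2 del: index_mult_mat(1))
    also have "\<dots> = mat_tr (b * g)" using gc bd(1) by (intro mat_tr_comm)
    finally have tr2: "mat_tr (b * \<tau> g) = mat_tr (b * g)" .
    have dm: "det m * det m' = 1" using det_mult[OF mc m'c] m'(2) by simp
    have "det (\<tau> g) = det m * det g * det m'"
      unfolding \<tau>_def using det_mult[OF mult_carrier_mat[OF mc gt] m'c] det_mult[OF mc gt] det_transpose[OF gc] by simp
    also have "\<dots> = det g * (det m * det m')" by (simp add: mult_ac)
    finally have det\<tau>: "det (\<tau> g) = det g" using dm by simp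
    have rgc: "red g \<in> carrier_mat 2 2" "red (\<tau> g) \<in> carrier_mat 2 2" using gc \<tau>gc by auto
    have nsb: "nonscalar (red b)" using b10 bd(1) by (simp add: nonscalar_def)
    have "\<exists>p q. p \<cdot>\<^sub>m 1\<^sub>m 2 + q \<cdot>\<^sub>m red b \<noteq> 0\<^sub>m 2 2 \<and>
        (p \<cdot>\<^sub>m 1\<^sub>m 2 + q \<cdot>\<^sub>m red b) * red g = red (\<tau> g) * (p \<cdot>\<^sub>m 1\<^sub>m 2 + q \<cdot>\<^sub>m red b)"
    proof (rule intertwiner_nonscalar[OF rgc rc(1) nsb])
      show "mat_tr (red g) = mat_tr (red (\<tau> g))" using tr1 mat_tr_red[OF gc] mat_tr_red[OF \<tau>gc] by simp
      show "mat_tr (red b * red g) = mat_tr (red b * red (\<tau> g))"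
        using tr2 mat_tr_red[OF mult_carrier_mat[OF bd(1) gc]] mat_tr_red[OF mult_carrier_mat[OF bd(1) \<tau>gc]]
          red_mult[OF bd(1) gc] red_mult[OF bd(1) \<tau>gc] by simp
      show "det (red g) = det (red (\<tau> g))" using det\<tau> by (simp add: res.hom_det)
    qed
    then obtain p q where pq: "p \<cdot>\<^sub>m 1\<^sub>m 2 + q \<cdot>\<^sub>m red b \<noteq> 0\<^sub>m 2 2"
        "(p \<cdot>\<^sub>m 1\<^sub>m 2 + q \<cdot>\<^sub>m red b) * red g = red (\<tau> g) * (p \<cdot>\<^sub>m 1\<^sub>m 2 + q \<cdot>\<^sub>m red b)"
      by blast
    let ?s = "p \<cdot>\<^sub>m 1\<^sub>m 2 + q \<cdot>\<^sub>m red b"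
    have sc: "?s \<in> carrier_mat 2 2" using rc by simp
    have sb: "?s * red b = red b * ?s"
      using add_mult_distrib_mat[of "p \<cdot>\<^sub>m 1\<^sub>m 2" 2 2 "q \<cdot>\<^sub>m red b" "red b" 2]
        mult_add_distrib_mat[of "red b" 2 2 "p \<cdot>\<^sub>m 1\<^sub>m 2" 2 "q \<cdot>\<^sub>m red b"]
        mult_smult_distrib[OF rc(1) one_carrier_mat, of p] mult_smult_assoc_mat[OF one_carrier_mat rc(1), of p]
        mult_smult_distrib[OF rc(1) rc(1), of q] mult_smult_assoc_mat[OF rc(1) rc(1), of q] rc(1)
      by simp
    \<comment> \<open>Here \<open>b\<close> is intertwined with itself: a nonzero kernel vector of
      \<open>?s\<close> would be a common eigenvector of \<open>b\<close> and \<open>d\<close>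
      modulo \<open>w\<close>.\<close>
    have ds: "det ?s \<noteq> 0"
      by (rule intertwiner_det_nonzero[OF sc rc(1) rc(1) rc(2) pq(1) sb comm_d[OF sc] free])
    obtain s where s: "s \<in> carrier_mat 2 2" "red s = ?s" using red_lift[OF sc] by blast
    have sGL: "s \<in> carrier (GL 2)" using GL_of_red[OF s(1)] ds s(2) by simp
    have sT: "s \<in> T" using sGL sb s(2) by (simp add: T_def)
    define s' where "s' = inv\<^bsub>GL 2\<^esub> s"
    note s' = GL_inv[OF sGL, folded s'_def]
    have s'T: "s' \<in> T" unfolding s'_def by (rule Tinv[OF sT])
    note s'c = Tc[OF s'T]
    \<comment> \<open>Conjugation by \<open>s\<close> reaches \<open>\<tau> g\<close> only modulo
      \<open>w\<close>; the discrepancy lies in \<open>K 2\<close>, and \<chi> has to be trivial on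
      it.\<close>
    define h where "h = s * g * s'"
    have hGL: "h \<in> carrier (GL 2)"
      using monoid.m_closed[OF group.is_monoid[OF group_GL]
          monoid.m_closed[OF group.is_monoid[OF group_GL] sGL g] s'(1)] by (simp add: h_def)
    note hc = GL_carrier_mat[OF hGL]
    have rh: "red h = red (\<tau> g)"
      using S.red_conj_eq_iff[OF gc \<tau>gc s(1) s'c s'(2,3)] pq(2) s(2) by (simp add: h_def)
    define h' where "h' = inv\<^bsub>GL 2\<^esub> h"
    note h' = GL_inv[OF hGL, folded h'_def]
    note h'c = GL_carrier_mat[OF h'(1)]
    have "red (\<tau> g * h') = red (h * h')" using red_mult[OF \<tau>gc h'c] red_mult[OF hc h'c] rh by simp
    then have "red (\<tau> g * h') = 1\<^sub>m 2" using h'(2) red_one by simp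
    then obtain A where A: "A \<in> carrier_mat 2 2" "\<tau> g * h' = kmat 2 A"
      using kmat_of_red_one[OF mult_carrier_mat[OF \<tau>gc h'c]] by blast
    have \<tau>g: "\<tau> g = kmat 2 A * h"
      unfolding A(2)[symmetric] using assoc_mult_mat[OF \<tau>gc h'c hc] h'(3) \<tau>gc by simp
    \<comment> \<open>Equality of determinants over the ring itself, and not only modulo
      \<open>w\<close>, gives the correction factor determinant one, hence
      \<open>w tr A = 0\<close>.\<close>
    have dh: "det h = det g"
    proof -
      have "det h = det s * det g * det s'"
        unfolding h_def using det_mult[OF mult_carrier_mat[OF s(1) gc] s'c] det_mult[OF s(1) gc] by simp
      moreover have "det s * det s' = 1" using det_mult[OF s(1) s'c] s'(2) by simp
      ultimately show ?thesis by (simp add: mult_ac)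
    qed
    have "det (kmat 2 A) = det (\<tau> g) * det h'" using det_mult[OF \<tau>gc h'c] A(2) by simp
    also have "\<dots> = det (h * h')" using det_mult[OF hc h'c] det\<tau> dh by simp
    finally have "w * mat_tr A = 0" using h'(2) det_kmat_2[OF A(1)] by simp
    then have trA: "w * mat_tr (d * A) = 0" using scalar_trace[OF bd(2) \<open>\<not> nonscalar (red d)\<close> A(1)] by blast
    have kT: "kmat 2 A \<in> T" using A rc red_kmat[OF A(1)] by (simp add: T_def)
    \<comment> \<open>The value of \<chi> on \<open>K 2\<close> is read off from the nonzero vector
      \<open>F v\<close>, on which \<open>K 2\<close> acts through the character of
      \<open>d\<close>.\<close>
    have \<chi>k: "\<chi> (kmat 2 A) = 1"
    proof -
      have "F v \<in> S.V\<^sub>K d" by (rule equivariant_VK[OF F(1) bd v(1)])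
      then have "\<sigma> (kmat 2 A) (F v) = scaleU 1 (F v)" using S.VK_iff[OF bd(2)] A(1) trA \<psi>0_0 by simp
      moreover have "\<sigma> (kmat 2 A) (F v) = scaleU (\<chi> (kmat 2 A)) (F v)"
        using FE[OF F(1)] kT by (simp add: eigenspace_def)
      ultimately have "scaleU (\<chi> (kmat 2 A)) (F v) = scaleU 1 (F v)" by simp
      then show ?thesis using v(2) by (simp only: S.scale_cancel_right) simp
    qed
    have "\<tau> g = kmat 2 A * s * g * s'"
      unfolding \<tau>g h_def
      using assoc_mult_mat[OF kmat_closed[OF A(1)] mult_carrier_mat[OF s(1) gc] s'c]
        assoc_mult_mat[OF kmat_closed[OF A(1)] s(1) gc] by simp
    moreover have "\<chi> (kmat 2 A * s) * \<chi> s' = 1"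
      using \<chi>mult[OF kT sT] \<chi>k \<chi>inv[OF sT] by (simp add: s'_def)
    ultimately show ?thesis using Tmult[OF kT sT] s'T by blast
  qed
  show ?thesis
  proof (rule I.multiplicity_one_anti_automorphism[where \<tau> = \<tau>])
    show "\<tau> g \<in> carrier (GL 2)" if "g \<in> carrier (GL 2)" for g using \<tau>GL[OF that] .
    show "\<tau> (g \<otimes>\<^bsub>GL 2\<^esub> h) = \<tau> h \<otimes>\<^bsub>GL 2\<^esub> \<tau> g" if "g \<in> carrier (GL 2)" "h \<in> carrier (GL 2)" for g h
      using \<tau>mult[OF GL_carrier_mat GL_carrier_mat] that by simp
    show "inj_on \<tau> (carrier (GL 2))" by (rule \<tau>inj)
    show "\<exists>s\<in>T. \<exists>t\<in>T. \<tau> g = s \<otimes>\<^bsub>GL 2\<^esub> g \<otimes>\<^bsub>GL 2\<^esub> t \<and> \<chi> s * \<chi> t = 1" if "g \<in> carrier (GL 2)" for g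
      using coset[OF that] by simp
  qed (use FE F v in auto)
qed

text \<open>Once \<open>F' v = c F v\<close> holds at one isotypic vector \<open>v\<close> with
  \<open>F v\<close> nonzero, the equivariant map \<open>F' - c F\<close> vanishes there and so
  everywhere by \<open>equivariant_determined\<close>.\<close>

lemma equivariant_unique:
  assumes F: "equivariant F" "equivariant F'" and nz: "v0 \<in> V" "F v0 \<noteq> 0"
  shows "\<exists>c. \<forall>v\<in>V. F' v = scaleU c (F v)"
proof -
  obtain b d v where bd: "b \<in> carrier_mat 2 2" "d \<in> carrier_mat 2 2"
    and v: "v \<in> P.V\<^sub>K (block_companion b d)" "F v \<noteq> 0"
    and cp: "char_poly (red (block_companion b d)) = char_poly (red x)"
    using nonzero_at_block_companion[OF F(1) nz] by blast
  have ir: "Factorial_Ring.irreducible (char_poly (red (block_companion b d)))" using irr cp by simp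
  have "\<exists>c. F' v = scaleU c (F v)"
  proof (cases "nonscalar (red d)")
    case True
    then show ?thesis
      using proportional_nonscalar[OF bd(2) True equivariant_VK[OF F(1) bd v(1)] equivariant_VK[OF F(2) bd v(1)] v(2)]
      by blast
  next
    case False
    then show ?thesis by (rule proportional_scalar[OF F bd ir _ v])
  qed
  then obtain c where c: "F' v = scaleU c (F v)" by blast
  define H where "H u = F' u - scaleU c (F u)" for u
  have FU: "F u \<in> U" "F' u \<in> U" if "u \<in> V" for u using F that by (auto simp: equivariant_def)
  have "equivariant H"
    unfolding equivariant_def
  proof (intro conjI ballI allI)
    show "H u \<in> U" if "u \<in> V" for u
      unfolding H_def using FU[OF that] S.subspace_V by (intro S.subspace_diff S.V_scale) auto
    show "H (u + u') = H u + H u'" if "u \<in> V" "u' \<in> V" for u u'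
      using F that by (simp add: H_def equivariant_def S.scale_right_distrib)
    show "H (scaleV a u) = scaleU a (H u)" if "u \<in> V" for a u
      using F that by (simp add: H_def equivariant_def S.scale_right_diff_distrib mult.commute)
    show "H (\<pi> (unip X) u) = scaleU (\<psi>0 (mat_tr X)) (H u)" if "X \<in> carrier_mat 2 2" "u \<in> V" for X u
      using F that by (simp add: H_def equivariant_def S.scale_right_diff_distrib mult.commute)
    show "H (\<pi> (diag_embed g) u) = \<sigma> g (H u)" if g: "g \<in> carrier (GL 2)" "u \<in> V" for g u
    proof -
      have "\<sigma> g (H u + scaleU c (F u)) = \<sigma> g (H u) + \<sigma> g (scaleU c (F u))"
        using g FU[OF g(2)] S.subspace_V unfolding H_def
        by (intro S.rho_add S.subspace_diff S.V_scale) auto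
      then have "\<sigma> g (H u) = \<sigma> g (F' u) - scaleU c (\<sigma> g (F u))"
        using FU[OF g(2)] g(1) by (simp add: H_def S.rho_scale)
      then show ?thesis using F g by (simp add: H_def equivariant_def)
    qed
  qed
  moreover have "H v = 0" using c by (simp add: H_def)
  ultimately have "\<forall>u\<in>V. H u = 0" using equivariant_determined[OF F(1) _ bd cp v] by blast
  then show ?thesis by (auto simp: H_def)
qed

end

section \<open>Twisted invariants\<close>

lemma diag_embed_unip:
  assumes g: "g \<in> carrier_mat 2 2" "h \<in> carrier_mat 2 2" "g * h = 1\<^sub>m 2" and X: "X \<in> carrier_mat 2 2"
  shows "diag_embed g * unip X * diag_embed h = unip (g * X * h)"
  using g X by (simp add: diag_embed_def unip_def four_block_2_mult)

context cuspidal_pair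
begin

lemma isotypic_N: "isotypic (GL 4) scaleV V \<pi> N_subgroup (psi \<psi>0)"
proof (intro isotypic.intro isotypic_axioms.intro)
  show sub: "subgroup N_subgroup (GL 4 :: 'r mat monoid)"
  proof (rule group.subgroupI[OF group_GL])
    show "N_subgroup \<subseteq> carrier (GL 4 :: 'r mat monoid)" by (auto simp: N_subgroup_def unip_GL)
    show "N_subgroup \<noteq> ({} :: 'r mat set)" by (auto simp: N_subgroup_def intro: zero_carrier_mat)
    fix a :: "'r mat" assume "a \<in> N_subgroup"
    then obtain X where X: "X \<in> carrier_mat 2 2" "a = unip X" by (auto simp: N_subgroup_def)
    have "inv\<^bsub>GL 4\<^esub> a = unip (- X)"
      using X unip_uminus[OF X(1)] unip_GL[of X] unip_GL[of "- X"]
      by (intro group.inv_equality[OF group_GL]) auto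
    then show "inv\<^bsub>GL 4\<^esub> a \<in> N_subgroup" using X by (auto simp: N_subgroup_def)
    fix b :: "'r mat" assume "b \<in> N_subgroup"
    then show "a \<otimes>\<^bsub>GL 4\<^esub> b \<in> N_subgroup"
      using X by (auto simp: N_subgroup_def unip_mult intro!: imageI)
  qed
  show "finite (N_subgroup :: 'r mat set)"
    using finite_subset[OF subgroup.subset[OF sub] P.finite_GL[OF P.finite_residue]] .
  fix h k :: "'r mat" assume "h \<in> N_subgroup"
  then obtain X where X: "X \<in> carrier_mat 2 2" "h = unip X" by (auto simp: N_subgroup_def)
  then show "psi \<psi>0 h \<noteq> 0" by (simp add: psi_unip \<psi>0_nonzero)
  assume "k \<in> N_subgroup"
  then obtain Y where Y: "Y \<in> carrier_mat 2 2" "k = unip Y" by (auto simp: N_subgroup_def)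
  show "psi \<psi>0 (h \<otimes>\<^bsub>GL 4\<^esub> k) = psi \<psi>0 h * psi \<psi>0 k"
    using X Y by (simp add: unip_mult psi_unip mat_tr_add[of _ 2] \<psi>0_add)
qed (rule P.fd_representation_axioms)

text \<open>Composition with the projection onto the twisted invariants turns a homomorphism into an
  equivariant map on \<open>V\<close> without changing it on the invariants, so proportionality can
  be carried back.\<close>

lemma hom_dim_le_1:
  "hom_dim (GL 2) scaleV (eigenspace scaleV V \<pi> N_subgroup (psi \<psi>0)) (\<lambda>g. \<pi> (diag_embed g)) scaleU U \<sigma> \<le> 1"
proof -
  interpret N: isotypic "GL 4" scaleV V \<pi> N_subgroup "psi \<psi>0" by (rule isotypic_N)
  let ?Hom = "hom_space (GL 2) scaleV N.E (\<lambda>g. \<pi> (diag_embed g)) scaleU U \<sigma>"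
  \<comment> \<open>\<open>GL 2\<close> normalizes \<open>N\<close>, and conjugation preserves
    \<psi> because the trace is a class function; so the averaging commutes with
    \<open>GL 2\<close>.\<close>
  have proj_diag: "N.proj (\<pi> (diag_embed g) v) = \<pi> (diag_embed g) (N.proj v)"
    if g: "g \<in> carrier (GL 2)" and v: "v \<in> V" for g v
  proof -
    define h where "h = inv\<^bsub>GL 2\<^esub> g"
    note h = GL_inv[OF g, folded h_def]
    note c = GL_carrier_mat[OF g] GL_carrier_mat[OF h(1)]
    let ?D = "diag_embed g" and ?E = "diag_embed h"
    have D: "?D \<in> carrier (GL 4)" by (rule diag_embed_GL[OF g])
    have Dc: "?D \<in> carrier_mat 4 4" "?E \<in> carrier_mat 4 4" using c by auto
    have ED: "?E * ?D = 1\<^sub>m 4" using c h by (simp add: diag_embed_mult diag_embed_1)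
    have un: "\<exists>X\<in>carrier_mat 2 2. k = unip X" if "k \<in> N_subgroup" for k :: "'r mat"
      using that by (auto simp: N_subgroup_def)
    have maps: "a * X * b \<in> carrier_mat 2 2" if "a \<in> carrier_mat 2 2" "b \<in> carrier_mat 2 2" "X \<in> carrier_mat 2 2"
      for a b X :: "'r mat" using that by simp
    have cancel: "h * (g * X * h) * g = X" "g * (h * X * g) * h = X" if X: "X \<in> carrier_mat 2 2" for X
    proof -
      have *: "b * (a * X * b) * a = X" if "a \<in> carrier_mat 2 2" "b \<in> carrier_mat 2 2" "b * a = 1\<^sub>m 2"
        for a b :: "'r mat"
        using that X assoc_mult_mat[OF that(2) mult_carrier_mat[OF that(1) X] that(2)]
          assoc_mult_mat[OF that(2,1) X] assoc_mult_mat[OF X that(2,1)] by simp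
      show "h * (g * X * h) * g = X" "g * (h * X * g) * h = X" using * c h by blast+
    qed
    have bij: "bij_betw (\<lambda>k. ?D * k * ?E) N_subgroup N_subgroup"
    proof (rule bij_betw_byWitness[where f' = "\<lambda>k. ?E * k * ?D"])
      show "\<forall>k\<in>N_subgroup. ?E * (?D * k * ?E) * ?D = k"
        using un by (force simp: diag_embed_unip[OF c h(2)] diag_embed_unip[OF c(2,1) h(3)] cancel maps[OF c] maps[OF c(2,1)])
      show "\<forall>k\<in>N_subgroup. ?D * (?E * k * ?D) * ?E = k"
        using un by (force simp: diag_embed_unip[OF c h(2)] diag_embed_unip[OF c(2,1) h(3)] cancel maps[OF c] maps[OF c(2,1)])
      show "(\<lambda>k. ?D * k * ?E) ` N_subgroup \<subseteq> N_subgroup" "(\<lambda>k. ?E * k * ?D) ` N_subgroup \<subseteq> N_subgroup"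
        using maps[OF c] maps[OF c(2,1)]
        by (auto simp: N_subgroup_def diag_embed_unip[OF c h(2)] diag_embed_unip[OF c(2,1) h(3)])
    qed
    have psi: "psi \<psi>0 (?D * k * ?E) = psi \<psi>0 k" if k: "k \<in> N_subgroup" for k
    proof -
      obtain X where X: "X \<in> carrier_mat 2 2" "k = unip X" using un[OF k] by blast
      have "mat_tr (g * X * h) = mat_tr (h * (g * X))" using X c by (intro mat_tr_comm[of _ 2 2]) auto
      also have "h * (g * X) = X" using assoc_mult_mat[OF c(2,1) X(1)] h(3) X by simp
      finally show ?thesis
        using X c by (simp add: diag_embed_unip[OF c h(2)] psi_unip maps[OF c])
    qed
    have "(\<Sum>k\<in>N_subgroup. scaleV (inverse (psi \<psi>0 k)) (\<pi> k (\<pi> ?D v))) =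
        (\<Sum>k\<in>N_subgroup. scaleV (inverse (psi \<psi>0 (?D * k * ?E))) (\<pi> (?D * k * ?E) (\<pi> ?D v)))"
      by (rule sum.reindex_bij_betw[OF bij, symmetric])
    also have "\<dots> = (\<Sum>k\<in>N_subgroup. \<pi> ?D (scaleV (inverse (psi \<psi>0 k)) (\<pi> k v)))"
    proof (rule sum.cong[OF refl])
      fix k :: "'r mat" assume k: "k \<in> N_subgroup"
      note kG = N.H_carrier[OF k]
      note kc = GL_carrier_mat[OF kG]
      have DkE: "?D * k * ?E \<in> carrier (GL 4)" using bij_betwE[OF bij] k N.H_carrier by blast
      have "\<pi> (?D * k * ?E) (\<pi> ?D v) = \<pi> (?D * k * ?E * ?D) v"
        by (rule P.rho_mult_GL[OF DkE D v, symmetric])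
      also have "?D * k * ?E * ?D = ?D * k"
        using assoc_mult_mat[OF mult_carrier_mat[OF Dc(1) kc] Dc(2,1)] ED Dc kc by simp
      also have "\<pi> (?D * k) v = \<pi> ?D (\<pi> k v)" by (rule P.rho_mult_GL[OF D kG v])
      finally show "scaleV (inverse (psi \<psi>0 (?D * k * ?E))) (\<pi> (?D * k * ?E) (\<pi> ?D v)) =
          \<pi> ?D (scaleV (inverse (psi \<psi>0 k)) (\<pi> k v))"
        using P.rho_scale[OF D P.rho_closed[OF kG v]] psi[OF k] by simp
    qed
    also have "\<dots> = \<pi> ?D (\<Sum>k\<in>N_subgroup. scaleV (inverse (psi \<psi>0 k)) (\<pi> k v))"
      using D v N.H_carrier by (intro P.rho_sum[symmetric]) (auto intro!: P.V_scale P.rho_closed)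
    finally show ?thesis
      unfolding N.proj_def using D v N.H_carrier
      by (simp add: P.rho_scale P.V_sum P.V_scale P.rho_closed)
  qed
  have ED: "\<pi> (diag_embed g) v \<in> N.E" if "g \<in> carrier (GL 2)" "v \<in> N.E" for g v
    using proj_diag[OF that(1), of v] N.proj_id[OF that(2)] N.E_subset that
      N.proj_in_E[OF P.rho_closed[OF diag_embed_GL[OF that(1)], of v]] by (auto simp: subset_iff)
  have equi: "equivariant (\<lambda>v. f (N.proj v))" if f: "f \<in> ?Hom" for f
    unfolding equivariant_def
  proof (intro conjI ballI allI)
    show "f (N.proj v) \<in> U" if "v \<in> V" for v
      using f N.proj_in_E[OF that] by (simp add: hom_space_def)
    show "f (N.proj (v + v')) = f (N.proj v) + f (N.proj v')" if "v \<in> V" "v' \<in> V" for v v'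
      using f that by (simp add: hom_space_def N.proj_add N.proj_in_E)
    show "f (N.proj (scaleV c v)) = scaleU c (f (N.proj v))" if "v \<in> V" for c v
      using f that by (simp add: hom_space_def N.proj_scale N.proj_in_E)
    show "f (N.proj (\<pi> (unip X) v)) = scaleU (\<psi>0 (mat_tr X)) (f (N.proj v))"
      if "X \<in> carrier_mat 2 2" "v \<in> V" for X v
    proof -
      have "unip X \<in> N_subgroup" using that by (auto simp: N_subgroup_def)
      then have "N.proj (\<pi> (unip X) v) = scaleV (\<psi>0 (mat_tr X)) (N.proj v)"
        using N.proj_rho[OF _ that(2)] psi_unip[OF that(1)] by metis
      then show ?thesis using f that by (simp add: hom_space_def N.proj_in_E)
    qed
    show "f (N.proj (\<pi> (diag_embed g) v)) = \<sigma> g (f (N.proj v))"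
      if "g \<in> carrier (GL 2)" "v \<in> V" for g v
      using f that by (simp add: hom_space_def N.proj_in_E proj_diag)
  qed
  interpret H: vector_space "\<lambda>c (f :: 'v \<Rightarrow> 'u) v. scaleU c (f v)"
    by standard (auto simp: fun_eq_iff S.scale_right_distrib S.scale_left_distrib)
  \<comment> \<open>One spanning function suffices for the bound on the dimension; 0 serves when
    there are no nonzero homomorphisms.\<close>
  have "\<exists>f0. ?Hom \<subseteq> H.span {f0}"
  proof (cases "?Hom \<subseteq> {0}")
    case True
    then have "?Hom \<subseteq> H.span {0}" using H.span_zero by auto
    then show ?thesis by blast
  next
    case False
    then obtain f0 where f0: "f0 \<in> ?Hom" "f0 \<noteq> 0" by blast
    then obtain e where e: "f0 e \<noteq> 0" by (auto simp: fun_eq_iff)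
    then have eE: "e \<in> N.E" using f0 by (auto simp: hom_space_def)
    have "f \<in> H.span {f0}" if f: "f \<in> ?Hom" for f
    proof -
      obtain c where c: "\<And>v. v \<in> V \<Longrightarrow> f (N.proj v) = scaleU c (f0 (N.proj v))"
        using equivariant_unique[OF equi[OF f0(1)] equi[OF f], of e] eE e N.proj_id[OF eE] N.E_subset by auto
      have "f v = scaleU c (f0 v)" for v
      proof (cases "v \<in> N.E")
        case True
        then show ?thesis using c[of v] N.proj_id[OF True] N.E_subset by auto
      next
        \<comment> \<open>Outside the invariants both functions are 0 by the convention in
          \<open>hom_space\<close>.\<close>
        case False
        then show ?thesis using f f0(1) by (auto simp: hom_space_def)
      qed
      then have "f = (\<lambda>v. scaleU c (f0 v))" by (rule ext)
      then show ?thesis using H.span_scale[OF H.span_base[of f0 "{f0}"], of c] by simp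
    qed
    then show ?thesis by blast
  qed
  then obtain f0 where "?Hom \<subseteq> H.span {f0}" by blast
  from H.dim_le_card[OF this] show ?thesis unfolding hom_dim_def by simp
qed

end

section \<open>The ring of integers modulo the square of the uniformizer\<close>

lemma length_two_char_o2:
  fixes w :: "'f::disc_valued_field oring"
  assumes w: "uniformizer w" and \<psi>0: "additive_character \<psi>0" "\<exists>x. \<psi>0 (abs_o2 w * x) \<noteq> 1"
  shows "length_two_char residue (abs_o2 w) \<psi>0"
proof
  show "residue (x + y) = residue x + residue y" for x y :: "'f o2" by (rule residue_add)
  show "residue (x * y) = residue x * residue y" for x y :: "'f o2" by (rule residue_mult)
  show "surj (residue :: 'f o2 \<Rightarrow> 'f resfield)" by (rule residue_surj)
  show "abs_o2 w * x = abs_o2 w * y \<longleftrightarrow> residue x = residue y" for x y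
    by (rule uniformizer_times_eq_iff[OF w])
  have iff: "residue (abs_o2 r) = 0 \<longleftrightarrow> w dvd r" for r
    by (simp add: residue.abs_eq zero_resfield_def resfield.abs_eq_iff ocong_iff_dvd[OF w])
  show "residue (abs_o2 w) = 0" by (simp add: iff)
  show "\<exists>z. x = abs_o2 w * z" if "residue x = 0" for x
  proof -
    have "\<exists>r. x = abs_o2 r" by (induction x) blast
    then obtain r where r: "x = abs_o2 r" by blast
    then have "w dvd r" using that by (simp add: iff)
    then obtain k where "r = w * k" ..
    then have "x = abs_o2 w * abs_o2 k" by (simp add: r times_o2.abs_eq)
    then show ?thesis by blast
  qed
qed (fact \<psi>0)+

theorem theorem1p6:
  fixes \<psi>0 :: "'f::disc_valued_field o2 \<Rightarrow> complex"
    and w :: "'f oring"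
    and scaleV :: "complex \<Rightarrow> 'v::ab_group_add \<Rightarrow> 'v" and V :: "'v set"
    and \<pi> :: "'f o2 mat \<Rightarrow> 'v \<Rightarrow> 'v"
    and scaleU :: "complex \<Rightarrow> 'u::ab_group_add \<Rightarrow> 'u" and U :: "'u set"
    and \<sigma> :: "'f o2 mat \<Rightarrow> 'u \<Rightarrow> 'u"
  assumes "odd CARD('p::prime_card)"
    and "(\<exists>\<iota> :: 'p padic \<Rightarrow> 'f. finite_unramified \<iota>) \<or>
         (\<exists>\<iota> :: 'p mod_ring fls \<Rightarrow> 'f. finite_unramified \<iota>)"
    and "uniformizer w"
    and "additive_character \<psi>0" and "\<exists>x. \<psi>0 (abs_o2 w * x) \<noteq> 1"
    and "strongly_cuspidal \<psi>0 w scaleV V \<pi>"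
    and "irreducible_representation (GL 2) scaleU U \<sigma>"
  shows "hom_dim (GL 2)
      scaleV (eigenspace scaleV V \<pi> N_subgroup (psi \<psi>0)) (\<lambda>g. \<pi> (diag_embed g))
      scaleU U \<sigma> \<le> 1"
proof -
  interpret length_two_char residue "abs_o2 w" \<psi>0
    by (rule length_two_char_o2) fact+
  interpret P: irreducible_representation "GL 4" scaleV V \<pi>
    using assms(6) by (simp add: strongly_cuspidal_def)
  interpret S: irreducible_representation "GL 2" scaleU U \<sigma> by fact
  \<comment> \<open>\<open>length_two_irrep\<close> cannot be entered yet: it assumes a finite
    residue field, which is derived below from the finite dimension of \<open>V\<close>.\<close>
  interpret P: length_two_rep residue "abs_o2 w" \<psi>0 4 scaleV V \<pi> ..
  obtain x where x: "x \<in> carrier_mat 4 4" "Factorial_Ring.irreducible (char_poly x)"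
    and ne: "eigenspace scaleV V \<pi> (K1 w) (phi \<psi>0 w x) \<noteq> {0}"
    using assms(6) by (auto simp: strongly_cuspidal_def)
  obtain y where y: "y \<in> carrier_mat 4 4" "red y = x" using red_lift[OF x(1)] by blast
  have one_plus: "one_plus w A = kmat 4 A" for A
    by (simp add: one_plus_def kmat_def)
  have K1: "K1 w = K 4" by (simp add: K1_def K_def one_plus)
  have "phi \<psi>0 w x k = kchar 4 y k" if k: "k \<in> K 4" for k
  proof -
    obtain A where A: "A \<in> carrier_mat 4 4" "k = kmat 4 A" using k by (auto simp: K_def)
    then show ?thesis
      using phi_one_plus[OF assms(3) y(1) A(1)] y(2) kchar_kmat[OF y(1) A(1)] by (simp add: one_plus)
  qed
  then have eig: "eigenspace scaleV V \<pi> (K1 w) (phi \<psi>0 w x) = P.V\<^sub>K y"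
    by (auto simp: eigenspace_def K1)
  have "0 \<in> P.V\<^sub>K y"
    using P.subspace_0[OF P.eigenspace_subspace[OF subgroup.subset[OF subgroup_K]]] .
  then obtain v where v: "v \<in> P.V\<^sub>K y" "v \<noteq> 0" using ne eig by blast
  have fin: "finite (UNIV :: 'f resfield set)"
    by (rule P.finite_residue_field[OF y(1) _ _ v]) (use x(2) y(2) in auto)
  interpret cuspidal_pair residue "abs_o2 w" \<psi>0 scaleV V \<pi> scaleU U \<sigma> y v
    by (intro cuspidal_pair.intro length_two_irrep.intro length_two_rep.intro length_two_irrep_axioms.intro
        cuspidal_pair_axioms.intro length_two_char_axioms P.fd_representation_axioms S.fd_representation_axioms
        P.irreducible_representation_axioms S.irreducible_representation_axioms fin y(1) v)
      (use x(2) y(2) in auto)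
  show ?thesis by (rule hom_dim_le_1)
qed

end
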